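(* The sum of two properly infinite positive elements in a $C^*$-algebra need not be properly infinite: there exist a $C^*$-algebra $A$ and properly infinite positive elements $a,b\in A$ such that $a+b$ is not properly infinite.
   Context: A positive element $a$ of a $C^*$-algebra $A$ is properly infinite if its class in the Cuntz semigroup satisfies $\langle a\rangle=2\langle a\rangle$, equivalently $a\oplus a\precsim a$, where $\precsim$ denotes Cuntz subequivalence in $A\otimes\mathcal{K}$ ($x\precsim y$ iff $d_kyd_k^*\to x$ for some sequence $(d_k)$ in $A\otimes\mathcal{K}$) and $\mathcal{K}$ is the algebra of compact operators on a separable infinite-dimensional Hilbert space. *)

theory Defs
  imports "HOL-Analysis.Analysis"
begin

section \<open>The complex Hilbert space of square-summable families\<close>

lemma square_summable_add:
  fixes x y :: "'i \<Rightarrow> complex"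
  assumes "(\<lambda>i. (cmod (x i))\<^sup>2) summable_on UNIV" "(\<lambda>i. (cmod (y i))\<^sup>2) summable_on UNIV"
  shows "(\<lambda>i. (cmod (x i + y i))\<^sup>2) summable_on UNIV"
proof (rule summable_on_comparison_test)
  show "(\<lambda>i. 2 * (cmod (x i))\<^sup>2 + 2 * (cmod (y i))\<^sup>2) summable_on UNIV"
    by (intro summable_on_add summable_on_cmult_right assms)
  fix i
  have "(cmod (x i + y i))\<^sup>2 \<le> (cmod (x i) + cmod (y i))\<^sup>2"
    by (intro power_mono norm_triangle_ineq norm_ge_zero)
  also have "\<dots> \<le> 2 * (cmod (x i))\<^sup>2 + 2 * (cmod (y i))\<^sup>2"
    using sum_squares_bound[of "cmod (x i)" "cmod (y i)"] by (simp add: power2_sum)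
  finally show "(cmod (x i + y i))\<^sup>2 \<le> 2 * (cmod (x i))\<^sup>2 + 2 * (cmod (y i))\<^sup>2" .
qed simp

lemma square_summable_scale:
  fixes x :: "'i \<Rightarrow> complex"
  assumes "(\<lambda>i. (cmod (x i))\<^sup>2) summable_on UNIV"
  shows "(\<lambda>i. (cmod (c * x i))\<^sup>2) summable_on UNIV"
  by (simp add: norm_mult power_mult_distrib summable_on_cmult_right assms)

lemma summable_mult_of_square_summable:
  fixes x y :: "'i \<Rightarrow> complex"
  assumes "(\<lambda>i. (cmod (x i))\<^sup>2) summable_on UNIV" "(\<lambda>i. (cmod (y i))\<^sup>2) summable_on UNIV"
  shows "(\<lambda>i. cnj (x i) * y i) summable_on UNIV"
proof -
  have "(\<lambda>i. cmod (cnj (x i) * y i)) summable_on UNIV"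
  proof (rule summable_on_comparison_test)
    show "(\<lambda>i. (cmod (x i))\<^sup>2 + (cmod (y i))\<^sup>2) summable_on UNIV"
      by (intro summable_on_add assms)
    fix i
    have "2 * cmod (x i) * cmod (y i) \<le> (cmod (x i))\<^sup>2 + (cmod (y i))\<^sup>2"
      by (rule sum_squares_bound)
    moreover have "0 \<le> cmod (x i) * cmod (y i)" by simp
    ultimately have "cmod (x i) * cmod (y i) \<le> (cmod (x i))\<^sup>2 + (cmod (y i))\<^sup>2" by linarith
    thus "cmod (cnj (x i) * y i) \<le> (cmod (x i))\<^sup>2 + (cmod (y i))\<^sup>2"
      by (simp add: norm_mult)
  qed simp
  thus ?thesis by (rule abs_summable_summable)
qed

typedef 'i ell2 = "{x :: 'i \<Rightarrow> complex. (\<lambda>i. (cmod (x i))\<^sup>2) summable_on UNIV}"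
  morphisms ell2_coord Abs_ell2
  by (rule exI[of _ "\<lambda>_. 0"]) simp

setup_lifting type_definition_ell2

lemma ell2_coord_square_summable: "(\<lambda>i. (cmod (ell2_coord x i))\<^sup>2) summable_on UNIV"
  using ell2_coord by blast

lift_definition scaleC :: "complex \<Rightarrow> 'i ell2 \<Rightarrow> 'i ell2" (infixr "*\<^sub>C" 75)
  is "\<lambda>c x i. c * x i"
  by (rule square_summable_scale)

text \<open>Conjugate-linear in the first argument.\<close>

lift_definition cinner :: "'i ell2 \<Rightarrow> 'i ell2 \<Rightarrow> complex"
  is "\<lambda>x y. \<Sum>\<^sub>\<infinity>i. cnj (x i) * y i" .

lemma cinner_self: "cinner x x = of_real (\<Sum>\<^sub>\<infinity>i. (cmod (ell2_coord x i))\<^sup>2)"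
proof -
  have "((\<lambda>i. complex_of_real ((cmod (ell2_coord x i))\<^sup>2)) has_sum
      of_real (\<Sum>\<^sub>\<infinity>i. (cmod (ell2_coord x i))\<^sup>2)) UNIV"
    unfolding has_sum_of_real_iff by (intro has_sum_infsum ell2_coord_square_summable)
  thus ?thesis
    unfolding cinner.rep_eq complex_norm_square by (simp add: infsumI mult.commute)
qed

instantiation ell2 :: (type) real_vector
begin

lift_definition zero_ell2 :: "'a ell2" is "\<lambda>_. 0" by simp

lift_definition plus_ell2 :: "'a ell2 \<Rightarrow> 'a ell2 \<Rightarrow> 'a ell2" is "\<lambda>x y i. x i + y i"
  by (rule square_summable_add)

lift_definition uminus_ell2 :: "'a ell2 \<Rightarrow> 'a ell2" is "\<lambda>x i. - x i" by simp

definition minus_ell2 :: "'a ell2 \<Rightarrow> 'a ell2 \<Rightarrow> 'a ell2" where "minus_ell2 x y = x + - y"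

definition scaleR_ell2 :: "real \<Rightarrow> 'a ell2 \<Rightarrow> 'a ell2" where "scaleR_ell2 r x = of_real r *\<^sub>C x"

instance
proof
  fix x y z :: "'a ell2" and r s :: real
  show "x + y + z = x + (y + z)" by transfer (simp add: add.assoc)
  show "x + y = y + x" by transfer (simp add: add.commute)
  show "0 + x = x" by transfer simp
  show "- x + x = 0" by transfer simp
  show "x - y = x + - y" by (rule minus_ell2_def)
  show "r *\<^sub>R (x + y) = r *\<^sub>R x + r *\<^sub>R y"
    unfolding scaleR_ell2_def by transfer (simp add: distrib_left)
  show "(r + s) *\<^sub>R x = r *\<^sub>R x + s *\<^sub>R x"
    unfolding scaleR_ell2_def by transfer (simp add: distrib_right)
  show "r *\<^sub>R s *\<^sub>R x = (r * s) *\<^sub>R x"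
    unfolding scaleR_ell2_def by transfer (simp add: mult.assoc)
  show "1 *\<^sub>R x = x"
    unfolding scaleR_ell2_def by transfer simp
qed

end

instantiation ell2 :: (type) real_inner
begin

definition inner_ell2 :: "'a ell2 \<Rightarrow> 'a ell2 \<Rightarrow> real" where "inner_ell2 x y = Re (cinner x y)"

definition norm_ell2 :: "'a ell2 \<Rightarrow> real" where "norm_ell2 x = sqrt (inner x x)"

definition dist_ell2 :: "'a ell2 \<Rightarrow> 'a ell2 \<Rightarrow> real" where "dist_ell2 x y = norm (x - y)"

definition sgn_ell2 :: "'a ell2 \<Rightarrow> 'a ell2" where
  "sgn_ell2 x = scaleR (inverse (norm x)) x"

definition uniformity_ell2 :: "('a ell2 \<times> 'a ell2) filter" where
  "uniformity_ell2 = (INF e\<in>{0<..}. principal {(x, y). dist x y < e})"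

definition open_ell2 :: "'a ell2 set \<Rightarrow> bool" where
  "open_ell2 U = (\<forall>x\<in>U. eventually (\<lambda>(x', y). x' = x \<longrightarrow> y \<in> U) uniformity)"

instance
proof
  fix x y z :: "'a ell2" and r s :: real
  show "sgn x = x /\<^sub>R norm x" by (rule sgn_ell2_def)
  show "dist x y = norm (x - y)" by (rule dist_ell2_def)
  show "(uniformity :: ('a ell2 \<times> 'a ell2) filter) = (INF e\<in>{0<..}. principal {(x, y). dist x y < e})"
    by (rule uniformity_ell2_def)
  show "open U = (\<forall>x\<in>U. \<forall>\<^sub>F (x', y) in uniformity. x' = x \<longrightarrow> y \<in> U)" for U :: "'a ell2 set"
    by (rule open_ell2_def)
  show "norm x = sqrt (inner x x)" by (rule norm_ell2_def)
  have "cinner x y = cnj (cinner y x)"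
    by transfer (simp flip: infsum_cnj add: mult.commute)
  thus "inner x y = inner y x" by (simp add: inner_ell2_def)
  have "cinner (x + y) z = cinner x z + cinner y z"
  proof transfer
    fix x y z :: "'a \<Rightarrow> complex"
    assume "(\<lambda>i. (cmod (x i))\<^sup>2) summable_on UNIV" "(\<lambda>i. (cmod (y i))\<^sup>2) summable_on UNIV"
      "(\<lambda>i. (cmod (z i))\<^sup>2) summable_on UNIV"
    thus "(\<Sum>\<^sub>\<infinity>i. cnj (x i + y i) * z i) = (\<Sum>\<^sub>\<infinity>i. cnj (x i) * z i) + (\<Sum>\<^sub>\<infinity>i. cnj (y i) * z i)"
      by (simp add: distrib_right infsum_add summable_mult_of_square_summable)
  qed
  thus "inner (x + y) z = inner x z + inner y z" by (simp add: inner_ell2_def)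
  have "cinner (r *\<^sub>R x) y = of_real r * cinner x y"
    unfolding scaleR_ell2_def by transfer (simp add: mult.assoc infsum_cmult_right')
  thus "inner (r *\<^sub>R x) y = r * inner x y" by (simp add: inner_ell2_def)
  have eq: "inner x x = (\<Sum>\<^sub>\<infinity>i. (cmod (ell2_coord x i))\<^sup>2)"
    by (simp add: inner_ell2_def cinner_self)
  show "0 \<le> inner x x" unfolding eq by (rule infsum_nonneg) simp
  show "inner x x = 0 \<longleftrightarrow> x = 0"
  proof
    assume "inner x x = 0"
    hence "(cmod (ell2_coord x i))\<^sup>2 = 0" for i
      by (intro nonneg_infsum_le_0D[of "\<lambda>i. (cmod (ell2_coord x i))\<^sup>2" UNIV])
         (simp_all add: eq ell2_coord_square_summable)
    hence "ell2_coord x i = 0" for i by simp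
    thus "x = 0" by transfer auto
  next
    assume "x = 0"
    thus "inner x x = 0" unfolding eq by (simp add: zero_ell2.rep_eq)
  qed
qed

end

lemma norm_ell2_sq: "(norm x)\<^sup>2 = (\<Sum>\<^sub>\<infinity>i. (cmod (ell2_coord x i))\<^sup>2)"
  by (simp add: power2_norm_eq_inner inner_ell2_def cinner_self)

lemma norm_scaleC: "norm (c *\<^sub>C x) = cmod c * norm x"
proof -
  have "(norm (c *\<^sub>C x))\<^sup>2 = (cmod c * norm x)\<^sup>2"
    by (simp add: norm_ell2_sq scaleC.rep_eq norm_mult power_mult_distrib infsum_cmult_right')
  thus ?thesis by simp
qed

lift_definition tensor_vec :: "'i ell2 \<Rightarrow> 'j ell2 \<Rightarrow> ('i \<times> 'j) ell2"
  is "\<lambda>x y (i, j). x i * y j"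
proof -
  fix x :: "'i \<Rightarrow> complex" and y :: "'j \<Rightarrow> complex"
  assume "(\<lambda>i. (cmod (x i))\<^sup>2) summable_on UNIV" "(\<lambda>j. (cmod (y j))\<^sup>2) summable_on UNIV"
  hence "(\<lambda>(i, j). (cmod (x i))\<^sup>2 * (cmod (y j))\<^sup>2) summable_on UNIV \<times> UNIV"
    by (intro summable_on_SigmaI[where g = "\<lambda>i. (cmod (x i))\<^sup>2 * (\<Sum>\<^sub>\<infinity>j. (cmod (y j))\<^sup>2)"])
       (auto intro: has_sum_cmult_right summable_on_cmult_left has_sum_infsum)
  thus "(\<lambda>p. (cmod (case p of (i, j) \<Rightarrow> x i * y j))\<^sup>2) summable_on UNIV"
    by (simp add: case_prod_unfold norm_mult power_mult_distrib)
qed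


section \<open>Bounded and compact operators\<close>

text \<open>
  The type \<open>'i op\<close> also contains maps that are only real-linear; \<open>bounded_ops\<close> singles out the
  bounded complex-linear operators. The norm of the type is the operator norm.
\<close>

type_synonym 'i op = "'i ell2 \<Rightarrow>\<^sub>L 'i ell2"

definition bounded_ops :: "'i op set" where
  "bounded_ops = {T. \<forall>c x. blinfun_apply T (c *\<^sub>C x) = c *\<^sub>C blinfun_apply T x}"

lemma bounded_linear_scaleC: "bounded_linear ((*\<^sub>C) c)"
proof (rule bounded_linear_intro[where K = "cmod c"])
  fix x y :: "'i ell2" and r :: real
  show "c *\<^sub>C (x + y) = c *\<^sub>C x + c *\<^sub>C y" by transfer (simp add: distrib_left)
  show "c *\<^sub>C (r *\<^sub>R x) = r *\<^sub>R (c *\<^sub>C x)"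
    unfolding scaleR_ell2_def by transfer (simp add: mult.left_commute)
  show "norm (c *\<^sub>C x) \<le> norm x * cmod c" by (simp add: norm_scaleC mult.commute)
qed

definition scaleC_op :: "complex \<Rightarrow> 'i op \<Rightarrow> 'i op" where
  "scaleC_op c T = Blinfun (\<lambda>x. c *\<^sub>C blinfun_apply T x)"

lemma scaleC_op_apply: "blinfun_apply (scaleC_op c T) x = c *\<^sub>C blinfun_apply T x"
  unfolding scaleC_op_def
  by (rule bounded_linear_Blinfun_apply
      [OF bounded_linear_compose[OF bounded_linear_scaleC blinfun.bounded_linear_right], THEN fun_cong])

text \<open>
  \<open>adj\<close> and \<open>tensor_op\<close> are meaningful on \<open>bounded_ops\<close>, where the
  operator described exists and is unique.
\<close>

definition adj :: "'i op \<Rightarrow> 'i op" where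
  "adj T = (THE S. S \<in> bounded_ops \<and>
     (\<forall>x y. cinner (blinfun_apply T x) y = cinner x (blinfun_apply S y)))"

definition compact_ops :: "'i op set" where
  "compact_ops = {T \<in> bounded_ops. compact (closure (blinfun_apply T ` cball 0 1))}"

definition tensor_op :: "'i op \<Rightarrow> 'j op \<Rightarrow> ('i \<times> 'j) op" where
  "tensor_op S T = (THE R. R \<in> bounded_ops \<and>
     (\<forall>x y. blinfun_apply R (tensor_vec x y) = tensor_vec (blinfun_apply S x) (blinfun_apply T y)))"

text \<open>The projection onto the line spanned by the \<open>n\<close>-th standard basis vector.\<close>

lift_definition coord_vec :: "'i \<Rightarrow> 'i ell2 \<Rightarrow> 'i ell2" is "\<lambda>n x i. if i = n then x i else 0"
  by (rule summable_on_comparison_test) auto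

lemma bounded_linear_coord_vec: "bounded_linear (coord_vec (n :: 'i))"
proof (rule bounded_linear_intro[where K = 1])
  fix x y :: "'i ell2" and r :: real
  show "coord_vec n (x + y) = coord_vec n x + coord_vec n y" by transfer auto
  show "coord_vec n (r *\<^sub>R x) = r *\<^sub>R coord_vec n x"
    unfolding scaleR_ell2_def by transfer auto
  have "(norm (coord_vec n x))\<^sup>2 \<le> (norm x)\<^sup>2"
    unfolding norm_ell2_sq
    by (rule infsum_mono[OF ell2_coord_square_summable ell2_coord_square_summable])
       (simp add: coord_vec.rep_eq)
  thus "norm (coord_vec n x) \<le> norm x * 1" by (simp add: power2_le_iff_abs_le)
qed

definition coord_proj :: "'i \<Rightarrow> 'i op" where
  "coord_proj n = Blinfun (coord_vec n)"

lemma coord_proj_apply: "blinfun_apply (coord_proj n) x = coord_vec n x"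
  unfolding coord_proj_def by (simp add: bounded_linear_Blinfun_apply bounded_linear_coord_vec)


section \<open>C*-algebras, stabilisation and Cuntz subequivalence\<close>

text \<open>
  C*-algebras are norm-closed *-subalgebras of the bounded operators on the Hilbert space with an
  orthonormal basis indexed by \<open>'i\<close>; by Gelfand-Naimark this covers all C*-algebras up to
  isomorphism. They need neither be unital nor act nondegenerately.
\<close>

definition cstar_algebra :: "'i op set \<Rightarrow> bool" where
  "cstar_algebra A \<longleftrightarrow>
     A \<subseteq> bounded_ops \<and> 0 \<in> A \<and>
     (\<forall>x\<in>A. \<forall>y\<in>A. x + y \<in> A) \<and>
     (\<forall>c. \<forall>x\<in>A. scaleC_op c x \<in> A) \<and>
     (\<forall>x\<in>A. \<forall>y\<in>A. x o\<^sub>L y \<in> A) \<and>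
     (\<forall>x\<in>A. adj x \<in> A) \<and>
     closed A"

definition positive_elements :: "'i op set \<Rightarrow> 'i op set" where
  "positive_elements A = {adj x o\<^sub>L x | x. x \<in> A}"

text \<open>
  The spatial tensor product of \<open>A\<close> with the compact operators on the separable Hilbert space
  \<open>nat ell2\<close>; these are nuclear, so there is only one C*-tensor product. The real
  span is a complex subspace, because \<open>A\<close> is closed under complex scalar multiples.
\<close>

definition stabilisation :: "'i op set \<Rightarrow> ('i \<times> nat) op set" where
  "stabilisation A = closure (span {tensor_op a k | a k. a \<in> A \<and> k \<in> compact_ops})"

definition cuntz_below :: "'i op set \<Rightarrow> 'i op \<Rightarrow> 'i op \<Rightarrow> bool" where
  "cuntz_below B x y \<longleftrightarrow>
     (\<exists>d :: nat \<Rightarrow> 'i op. (\<forall>k. d k \<in> B) \<and> (\<lambda>k. d k o\<^sub>L y o\<^sub>L adj (d k)) \<longlonglongrightarrow> x)"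

text \<open>
  Inside the stabilisation, \<open>a\<close> is identified with the infinite matrix \<open>diag(a, 0, 0, \<dots>)\<close> and
  \<open>a \<oplus> a\<close> is \<open>diag(a, a, 0, 0, \<dots>)\<close>.
\<close>

definition corner :: "'i op \<Rightarrow> ('i \<times> nat) op" where
  "corner a = tensor_op a (coord_proj 0)"

definition double :: "'i op \<Rightarrow> ('i \<times> nat) op" where
  "double a = tensor_op a (coord_proj 0) + tensor_op a (coord_proj 1)"

definition properly_infinite :: "'i op set \<Rightarrow> 'i op \<Rightarrow> bool" where
  "properly_infinite A a \<longleftrightarrow> cuntz_below (stabilisation A) (double a) (corner a)"

end

theory Submission
  imports Defs "HOL-Library.Z2"
begin

text \<open>
  Let \<open>S\<^sub>j\<close> be the unit sphere of complex \<open>(j + 1)\<close>-space. The algebra consists of operator fields over the product of all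
  \<open>S\<^sub>j\<close>, equivariant under the antipodal map of each factor, on a sum of blocks of which the \<open>j\<close>-th is
  \<open>j + 1\<close> copies of the line bundle \<open>P\<^sub>j\<close> twisted by the antipodal map of \<open>S\<^sub>j\<close>; up to finitely many
  blocks the operators are block diagonal. The coordinates of \<open>S\<^sub>j\<close> give an invariant unit section of the
  \<open>j\<close>-th block, so a large block contains a trivial line bundle, and by duality every \<open>P\<^sub>j\<close> embeds into a sum of
  \<open>j + 1\<close> such lines.

  The element \<open>a\<close> has eigenvalues \<open>2\<^bsup>-i\<^esup>\<close>, \<open>i \<le> j\<close>, on even blocks and the constant \<open>2\<^bsup>-j\<^esup>\<close> on odd ones, and \<open>b\<close>
  the same with parities exchanged. The spectral part of \<open>a\<close> above any \<open>\<epsilon>\<close> lives on finitely many blocks and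
  on boundedly many copies of each even \<open>P\<^sub>j\<close>; it can be duplicated inside \<open>a\<close>, using far odd blocks for
  the former and the remaining copies of \<open>P\<^sub>j\<close> for the latter. Hence \<open>a\<close> and \<open>b\<close> are properly infinite.
  The leading eigenvalue of \<open>a + b\<close> on every block is at least 1, and 2 on the block 0. Two orthogonal copies of \<open>a + b\<close> would
  embed \<open>P\<^sub>0 \<oplus> \<dots> \<oplus> P\<^sub>J\<^sub>-\<^sub>1\<close> and a trivial line together into the sum of the first \<open>J\<close> blocks, so that
  the sum of the \<open>P\<^sub>j\<^bsup>\<oplus>j\<^esup>\<close>, whose Euler class is not 0, would contain a trivial line. The contradiction is
  made elementary by a mod 2 cup product of sign cochains on a cubical grid.
\<close>

subsection \<open>Square-summable families\<close>

text \<open>Everything turns on one threshold. The coordinates of S_j form a nowhere vanishing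
  invariant section of \<open>j + 1\<close> copies of P_j, but \<open>j\<close> copies have no such
  section: over a subsphere of real dimension 2j their mod 2 Euler class, of degree 2j, is not 0. So
  whole blocks can host trivial lines, but no longer once one copy of every P_j is taken away, as
  the leading eigenvectors of \<open>a + b\<close> demand. For \<open>a\<close> and \<open>b\<close>
  the eigenvalues of one parity decay along the block, so a cut-off leaves ranks bounded
  independently of j; those of the other parity decay with j, so a cut-off leaves finitely many
  blocks, while arbitrarily far blocks keep positive weight and can serve as hosts. Elements of the
  algebra are limits of fields mixing finitely but arbitrarily many blocks, so the obstruction is
  needed for every J; hence an infinite product of spheres of growing dimension. The contradiction
  rests on a balance: 2j parameters for each sphere \<open>j < J\<close> and 2J for a real line in
  the sum of J complex lines and one real line, against 2(j + 1) real equations for each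
  \<open>j < J\<close>. Both numbers are J(J + 1).\<close>

lemma coord_zero [simp]: "ell2_coord 0 i = 0" by (simp add: zero_ell2.rep_eq)
lemma coord_add [simp]: "ell2_coord (x + y) i = ell2_coord x i + ell2_coord y i" by (simp add: plus_ell2.rep_eq)
lemma coord_uminus [simp]: "ell2_coord (- x) i = - ell2_coord x i" by (simp add: uminus_ell2.rep_eq)
lemma coord_diff [simp]: "ell2_coord (x - y) i = ell2_coord x i - ell2_coord y i"
  unfolding minus_ell2_def coord_add coord_uminus by simp
lemma coord_scaleC [simp]: "ell2_coord (c *\<^sub>C x) i = c * ell2_coord x i" by (simp add: scaleC.rep_eq)
lemma coord_scaleR [simp]: "ell2_coord (r *\<^sub>R x) i = of_real r * ell2_coord x i" by (simp add: scaleR_ell2_def)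
lemma coord_sum [simp]: "ell2_coord (\<Sum>a\<in>F. f a) i = (\<Sum>a\<in>F. ell2_coord (f a) i)"
  by (induction F rule: infinite_finite_induct) auto

lemma ell2_eqI: "(\<And>i. ell2_coord x i = ell2_coord y i) \<Longrightarrow> x = y"
  by (metis ell2_coord_inject ext)

lemma scaleC_add_right: "c *\<^sub>C (x + y) = c *\<^sub>C x + c *\<^sub>C y" by (rule ell2_eqI) (simp add: distrib_left)
lemma scaleC_scaleC [simp]: "c *\<^sub>C d *\<^sub>C x = (c * d) *\<^sub>C x" by (rule ell2_eqI) simp
lemma scaleC_one [simp]: "1 *\<^sub>C x = x" by (rule ell2_eqI) simp
lemma scaleC_zero [simp]: "0 *\<^sub>C x = 0" "c *\<^sub>C 0 = 0" by (auto intro: ell2_eqI)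
lemma scaleC_sum: "c *\<^sub>C (\<Sum>a\<in>F. f a) = (\<Sum>a\<in>F. c *\<^sub>C f a)" by (rule ell2_eqI) (simp add: sum_distrib_left)
lemma scaleR_scaleC: "r *\<^sub>R x = of_real r *\<^sub>C x" by (rule scaleR_ell2_def)

lift_definition ket :: "'i \<Rightarrow> 'i ell2" is "\<lambda>v i. if i = v then 1 else 0"
proof -
  fix v :: 'i
  have "(\<lambda>i. (cmod (if i = v then 1 else 0))\<^sup>2) summable_on {v}" by simp
  then show "(\<lambda>i. (cmod (if i = v then 1 else 0))\<^sup>2) summable_on UNIV"
    by (rule summable_on_cong_neutral[THEN iffD1, rotated -1]) auto
qed

lemma coord_ket [simp]: "ell2_coord (ket v) i = (if i = v then 1 else 0)" by (simp add: ket.rep_eq)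

lemma cinner_summable: "(\<lambda>i. cnj (ell2_coord x i) * ell2_coord y i) summable_on UNIV"
  by (intro summable_mult_of_square_summable ell2_coord_square_summable)

lemma cinner_eq: "cinner x y = (\<Sum>\<^sub>\<infinity>i. cnj (ell2_coord x i) * ell2_coord y i)" by (simp add: cinner.rep_eq)

lemma cinner_commute: "cinner x y = cnj (cinner y x)"
  unfolding cinner_eq by (simp flip: infsum_cnj add: mult.commute)
lemma cinner_add_right: "cinner x (y + z) = cinner x y + cinner x z"
  unfolding cinner_eq by (simp add: distrib_left infsum_add cinner_summable)
lemma cinner_add_left: "cinner (x + y) z = cinner x z + cinner y z"
  by (metis cinner_add_right cinner_commute complex_cnj_add)
lemma cinner_scaleC_right: "cinner x (c *\<^sub>C y) = c * cinner x y"
  unfolding cinner_eq by (simp add: mult.left_commute infsum_cmult_right')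
lemma cinner_scaleC_left: "cinner (c *\<^sub>C x) y = cnj c * cinner x y"
  by (metis cinner_scaleC_right cinner_commute complex_cnj_mult)
lemma cinner_zero [simp]: "cinner 0 y = 0" "cinner x 0 = 0" by (simp_all add: cinner_eq)
lemma cinner_sum_left: "cinner (\<Sum>a\<in>F. f a) y = (\<Sum>a\<in>F. cinner (f a) y)"
  by (induction F rule: infinite_finite_induct) (auto simp: cinner_add_left)
lemma cinner_ket_left: "cinner (ket v) y = ell2_coord y v"
proof -
  have "cinner (ket v) y = infsum (\<lambda>i. cnj (ell2_coord (ket v) i) * ell2_coord y i) {v}"
    unfolding cinner_eq by (rule infsum_cong_neutral) auto
  then show ?thesis by simp
qed

lemma cnj_mult_self: "cnj z * z = of_real ((cmod z)\<^sup>2)"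
  by (metis complex_norm_square mult.commute)

text \<open>A unimodular factor turns \<open>cinner x y\<close> into its modulus, a value of the
  real inner product, to which the real inequality applies.\<close>

lemma cinner_Cauchy_Schwarz: "cmod (cinner x y) \<le> norm x * norm y"
proof (cases "cinner x y = 0")
  case False
  define c where "c = cinner x y / of_real (cmod (cinner x y))"
  have c: "cmod c = 1" using False by (simp add: c_def norm_divide)
  have "cinner (c *\<^sub>C x) y = of_real (cmod (cinner x y))"
    using False cnj_mult_self[of "cinner x y"] by (simp add: cinner_scaleC_left c_def power2_eq_square)
  then have "cmod (cinner x y) = inner (c *\<^sub>C x) y" by (simp add: inner_ell2_def)
  also have "\<dots> \<le> norm (c *\<^sub>C x) * norm y" by (rule norm_cauchy_schwarz)
  finally show ?thesis using c by (simp add: norm_scaleC)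
qed simp

lemma cinner_eqI: "(\<And>x. cinner x y = cinner x z) \<Longrightarrow> y = z"
  by (rule ell2_eqI) (metis cinner_ket_left)

text \<open>Truncations converge along the filter of finite index sets, so bounded operators are
  determined by the basis vectors even over an uncountable index set, such as the one used for the
  algebra.\<close>

definition trunc :: "'i set \<Rightarrow> 'i ell2 \<Rightarrow> 'i ell2" where
  "trunc F x = (\<Sum>v\<in>F. ell2_coord x v *\<^sub>C ket v)"

lemma coord_trunc: "finite F \<Longrightarrow> ell2_coord (trunc F x) i = (if i \<in> F then ell2_coord x i else 0)"
  by (simp add: trunc_def if_distrib sum.If_cases cong: if_cong)

lemma trunc_tendsto: "((\<lambda>F. trunc F x) \<longlongrightarrow> x) (finite_subsets_at_top UNIV)"
proof -
  let ?f = "\<lambda>i. (cmod (ell2_coord x i))\<^sup>2"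
  have sm: "?f summable_on A" for A by (rule summable_on_subset_banach[OF ell2_coord_square_summable]) simp
  have "((\<lambda>F. sum ?f F) \<longlongrightarrow> infsum ?f UNIV) (finite_subsets_at_top UNIV)"
    using sm by (simp add: infsum_tendsto)
  then have "((\<lambda>F. infsum ?f UNIV - sum ?f F) \<longlongrightarrow> 0) (finite_subsets_at_top UNIV)"
    using tendsto_diff[OF tendsto_const[of "infsum ?f UNIV"]] by fastforce
  moreover have "(norm (trunc F x - x))\<^sup>2 = infsum ?f UNIV - sum ?f F" if F: "finite F" for F
  proof -
    have "(norm (trunc F x - x))\<^sup>2 = infsum ?f (UNIV - F)"
      unfolding norm_ell2_sq by (rule infsum_cong_neutral) (auto simp: coord_trunc F)
    also have "\<dots> = infsum ?f UNIV - infsum ?f F" by (rule infsum_Diff) (use sm in auto)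
    finally show ?thesis using F by simp
  qed
  then have "\<forall>\<^sub>F F in finite_subsets_at_top UNIV. infsum ?f UNIV - sum ?f F = (norm (trunc F x - x))\<^sup>2"
    by (intro eventually_finite_subsets_at_top_weakI) simp
  ultimately have "((\<lambda>F. (norm (trunc F x - x))\<^sup>2) \<longlongrightarrow> 0) (finite_subsets_at_top UNIV)"
    by (rule Lim_transform_eventually)
  then have "((\<lambda>F. sqrt ((norm (trunc F x - x))\<^sup>2)) \<longlongrightarrow> sqrt 0) (finite_subsets_at_top UNIV)"
    by (rule tendsto_real_sqrt)
  then show ?thesis by (simp add: LIM_zero_iff tendsto_norm_zero_iff)
qed

lemma bounded_opsI: fixes T :: "'i op" shows "(\<And>c x. T (c *\<^sub>C x) = c *\<^sub>C T x) \<Longrightarrow> T \<in> bounded_ops" by (simp add: bounded_ops_def)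
lemma bounded_opsD: fixes T :: "'i op" shows "T \<in> bounded_ops \<Longrightarrow> T (c *\<^sub>C x) = c *\<^sub>C T x" by (simp add: bounded_ops_def)

lemma apply_trunc:
  fixes T :: "'i op"
  assumes "T \<in> bounded_ops"
  shows "T (trunc F x) = (\<Sum>v\<in>F. ell2_coord x v *\<^sub>C T (ket v))"
  unfolding trunc_def blinfun.sum_right by (simp add: bounded_opsD[OF assms])

lemma bounded_ops_eqI:
  fixes S T :: "'i op"
  assumes "S \<in> bounded_ops" "T \<in> bounded_ops" "\<And>v. S (ket v) = T (ket v)"
  shows "S = T"
proof (rule blinfun_eqI)
  fix x
  have lim: "((\<lambda>F. S (trunc F x)) \<longlongrightarrow> S x) (finite_subsets_at_top UNIV)" for S :: "'i op"
    by (intro blinfun.tendsto trunc_tendsto tendsto_const)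
  have "S (trunc F x) = T (trunc F x)" for F by (simp add: apply_trunc assms)
  then show "S x = T x" using tendsto_unique[OF finite_subsets_at_top_neq_bot lim[of S]] lim[of T] by simp
qed

lemma norm_sum_ket:
  assumes "finite F"
  shows "(norm (\<Sum>v\<in>F. f v *\<^sub>C ket v))\<^sup>2 = (\<Sum>v\<in>F. (cmod (f v))\<^sup>2)"
proof -
  have "ell2_coord (\<Sum>v\<in>F. f v *\<^sub>C ket v) i = (if i \<in> F then f i else 0)" for i
    using assms by (simp add: if_distrib sum.If_cases cong: if_cong)
  then have "(norm (\<Sum>v\<in>F. f v *\<^sub>C ket v))\<^sup>2 = (\<Sum>\<^sub>\<infinity>i\<in>F. (cmod (f i))\<^sup>2)"
    unfolding norm_ell2_sq by (intro infsum_cong_neutral) auto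
  then show ?thesis using assms by simp
qed

subsection \<open>Adjoints\<close>

text \<open>The coordinates of \<open>S y\<close> can only be the numbers
  \<open>cinner (T (ket v)) y\<close>; the work lies in their square summability.\<close>

lemma adjoint_exists:
  fixes T :: "'i op"
  assumes T: "T \<in> bounded_ops"
  shows "\<exists>S :: 'i op. S \<in> bounded_ops \<and> norm S \<le> norm T \<and> (\<forall>x y. cinner (T x) y = cinner x (S y))"
proof -
  define w where "w y v = cinner (T (ket v)) y" for y v
  have bound: "(\<Sum>v\<in>F. (cmod (w y v))\<^sup>2) \<le> (norm T * norm y)\<^sup>2" if F: "finite F" for F y
  proof -
    \<comment> \<open>Testing \<open>T\<close> on the vector whose coordinates are the numbers
      \<open>w y v\<close> themselves turns \<open>cinner (T x) y\<close> into the sum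
      \<open>N\<close> to be bounded, and \<open>norm x\<close> into \<open>sqrt N\<close>.\<close>
    define x where "x = (\<Sum>v\<in>F. w y v *\<^sub>C ket v)"
    define N where "N = (\<Sum>v\<in>F. (cmod (w y v))\<^sup>2)"
    have nx: "norm x = sqrt N" unfolding x_def N_def norm_sum_ket[OF F, symmetric] by simp
    have "cinner (T x) y = of_real N"
      unfolding x_def blinfun.sum_right cinner_sum_left bounded_opsD[OF T] cinner_scaleC_left w_def[symmetric] N_def of_real_sum
      by (intro sum.cong refl) (simp only: cnj_mult_self)
    moreover have "N \<ge> 0" unfolding N_def by (rule sum_nonneg) simp
    ultimately have "N = cmod (cinner (T x) y)" by simp
    also have "\<dots> \<le> norm (T x) * norm y" by (rule cinner_Cauchy_Schwarz)
    also have "\<dots> \<le> (norm T * norm x) * norm y" by (intro mult_right_mono norm_blinfun) simp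
    finally have *: "N \<le> (norm T * norm y) * sqrt N" by (simp add: nx mult_ac)
    show ?thesis
    proof (cases "N = 0")
      case False
      then have "sqrt N > 0" using \<open>N \<ge> 0\<close> by simp
      moreover have "sqrt N * sqrt N \<le> (norm T * norm y) * sqrt N" using * \<open>N \<ge> 0\<close> by simp
      ultimately have "sqrt N \<le> norm T * norm y" by (rule mult_right_le_imp_le[rotated])
      then have "(sqrt N)\<^sup>2 \<le> (norm T * norm y)\<^sup>2" using \<open>sqrt N > 0\<close> by (intro power_mono) auto
      then show ?thesis using \<open>N \<ge> 0\<close> by (simp add: N_def)
    qed (simp add: N_def)
  qed
  have sm: "(\<lambda>v. (cmod (w y v))\<^sup>2) summable_on UNIV" for y
    by (rule nonneg_bdd_above_summable_on) (auto intro!: bdd_aboveI2 bound)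
  define S where "S y = Abs_ell2 (w y)" for y
  have S: "ell2_coord (S y) v = w y v" for y v
    unfolding S_def using sm by (simp add: Abs_ell2_inverse)
  have nS: "norm (S y) \<le> norm y * norm T" for y
  proof -
    have "(norm (S y))\<^sup>2 \<le> (norm y * norm T)\<^sup>2"
      unfolding norm_ell2_sq S by (intro infsum_le_finite_sums sm) (metis bound mult.commute)
    then show ?thesis by (rule power2_le_imp_le) simp
  qed
  have bl: "bounded_linear S"
    by (rule bounded_linear_intro[OF _ _ nS])
      (auto intro!: ell2_eqI simp: S w_def cinner_add_right scaleR_scaleC cinner_scaleC_right)
  define S' where "S' = Blinfun S"
  have S': "S' y = S y" for y unfolding S'_def by (simp add: bounded_linear_Blinfun_apply bl)
  have "S' \<in> bounded_ops"
    by (rule bounded_opsI) (auto intro!: ell2_eqI simp: S' S w_def cinner_scaleC_right)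
  moreover have "norm S' \<le> norm T"
    by (rule norm_blinfun_bound) (use nS in \<open>auto simp: S' mult.commute\<close>)
  moreover have "cinner (T x) y = cinner x (S' y)" for x y
  proof -
    have lim: "((\<lambda>F. cinner (T (trunc F x)) y) \<longlongrightarrow> cinner (T x) y) (finite_subsets_at_top UNIV)"
      "((\<lambda>F. cinner (trunc F x) (S' y)) \<longlongrightarrow> cinner x (S' y)) (finite_subsets_at_top UNIV)"
    proof -
      have bl: "bounded_linear (\<lambda>x. cinner x z)" for z :: "'i ell2"
        by (rule bounded_linear_intro[where K = "norm z"])
          (auto simp: cinner_add_left scaleR_scaleC cinner_scaleC_left cinner_Cauchy_Schwarz scaleR_conv_of_real)
      show "((\<lambda>F. cinner (T (trunc F x)) y) \<longlongrightarrow> cinner (T x) y) (finite_subsets_at_top UNIV)"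
        by (intro bounded_linear.tendsto[OF bl] blinfun.tendsto trunc_tendsto tendsto_const)
      show "((\<lambda>F. cinner (trunc F x) (S' y)) \<longlongrightarrow> cinner x (S' y)) (finite_subsets_at_top UNIV)"
        by (intro bounded_linear.tendsto[OF bl] trunc_tendsto)
    qed
    have "cinner (T (trunc F x)) y = cinner (trunc F x) (S' y)" for F
      unfolding apply_trunc[OF T] unfolding trunc_def cinner_sum_left cinner_scaleC_left cinner_ket_left S' S w_def ..
    then show ?thesis using tendsto_unique[OF finite_subsets_at_top_neq_bot lim(1)] lim(2) by simp
  qed
  ultimately show ?thesis by blast
qed

lemma adj_eqI:
  fixes S T :: "'i op"
  assumes "S \<in> bounded_ops" "\<And>x y. cinner (T x) y = cinner x (S y)"
  shows "adj T = S"
  unfolding adj_def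
proof (rule the_equality)
  fix S' :: "'i op" assume S': "S' \<in> bounded_ops \<and> (\<forall>x y. cinner (T x) y = cinner x (S' y))"
  show "S' = S" by (rule blinfun_eqI, rule cinner_eqI) (use S' assms in metis)
qed (use assms in auto)

lemma
  fixes T :: "'i op"
  assumes "T \<in> bounded_ops"
  shows adj_bounded: "adj T \<in> bounded_ops" and cinner_adj: "cinner (T x) y = cinner x (adj T y)"
    and norm_adj_le: "norm (adj T) \<le> norm T"
proof -
  obtain S where S: "S \<in> bounded_ops" "norm S \<le> norm T" "\<forall>x y. cinner (T x) y = cinner x (S y)"
    using adjoint_exists[OF assms] by blast
  then have "adj T = S" by (intro adj_eqI) auto
  then show "adj T \<in> bounded_ops" "cinner (T x) y = cinner x (adj T y)" "norm (adj T) \<le> norm T"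
    using S by auto
qed

lemma cinner_adj':
  fixes T :: "'i op"
  assumes "T \<in> bounded_ops"
  shows "cinner (adj T x) y = cinner x (T y)"
  unfolding cinner_commute[of "adj T x" y] cinner_adj[OF assms, symmetric] by (rule cinner_commute[symmetric])

lemma bounded_ops_add: "S \<in> bounded_ops \<Longrightarrow> T \<in> bounded_ops \<Longrightarrow> S + T \<in> bounded_ops"
  by (auto simp: bounded_ops_def blinfun.add_left scaleC_add_right)
lemma bounded_ops_comp: "S \<in> bounded_ops \<Longrightarrow> T \<in> bounded_ops \<Longrightarrow> S o\<^sub>L T \<in> bounded_ops"
  by (auto simp: bounded_ops_def)
lemma bounded_ops_scaleC: "T \<in> bounded_ops \<Longrightarrow> scaleC_op c T \<in> bounded_ops"
  by (auto simp: bounded_ops_def scaleC_op_apply mult.commute)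
lemma bounded_ops_zero: "0 \<in> bounded_ops"
  by (auto simp: bounded_ops_def)
lemma bounded_ops_sum: "(\<And>a. a \<in> F \<Longrightarrow> f a \<in> bounded_ops) \<Longrightarrow> sum f F \<in> bounded_ops"
  by (induction F rule: infinite_finite_induct) (auto simp: bounded_ops_zero bounded_ops_add)

lemma adj_add: "S \<in> bounded_ops \<Longrightarrow> T \<in> bounded_ops \<Longrightarrow> adj (S + T) = adj S + adj T"
  by (rule adj_eqI) (auto simp: blinfun.add_left cinner_add_left cinner_add_right cinner_adj bounded_ops_add adj_bounded)
definition melem :: "'i op \<Rightarrow> 'i \<Rightarrow> 'i \<Rightarrow> complex" where
  "melem T u v = ell2_coord (T (ket v)) u"

lemma melem_adj:
  assumes "T \<in> bounded_ops"
  shows "melem (adj T) u v = cnj (melem T v u)"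
  unfolding melem_def cinner_ket_left[symmetric] cinner_adj[OF assms, symmetric] by (rule cinner_commute)

lemma melem_add: "melem (S + T) u v = melem S u v + melem T u v" by (simp add: melem_def blinfun.add_left)
lemma melem_scaleC: "melem (scaleC_op c T) u v = c * melem T u v" by (simp add: melem_def scaleC_op_apply)
lemma melem_zero: "melem 0 u v = 0" by (simp add: melem_def)
lemma melem_eqI:
  assumes "S \<in> bounded_ops" "T \<in> bounded_ops" "\<And>u v. melem S u v = melem T u v"
  shows "S = T"
proof (rule bounded_ops_eqI[OF assms(1,2)], rule ell2_eqI)
  show "ell2_coord (S (ket v)) u = ell2_coord (T (ket v)) u" for u v
    using assms(3)[of u v] unfolding melem_def .
qed

lemma ket_expand:
  assumes "finite F" "\<And>v. v \<notin> F \<Longrightarrow> ell2_coord x v = 0"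
  shows "x = (\<Sum>v\<in>F. ell2_coord x v *\<^sub>C ket v)"
proof (rule ell2_eqI)
  fix i
  have "ell2_coord (trunc F x) i = ell2_coord x i"
    unfolding coord_trunc[OF assms(1)] using assms(2)[of i] by simp
  then show "ell2_coord x i = ell2_coord (\<Sum>v\<in>F. ell2_coord x v *\<^sub>C ket v) i"
    unfolding trunc_def by (rule sym)
qed

lemma melem_comp:
  assumes S: "S \<in> bounded_ops" and F: "finite F" "\<And>v. v \<notin> F \<Longrightarrow> melem T v w = 0"
  shows "melem (S o\<^sub>L T) u w = (\<Sum>v\<in>F. melem S u v * melem T v w)"
proof -
  have T: "T (ket w) = (\<Sum>v\<in>F. melem T v w *\<^sub>C ket v)"
    unfolding melem_def by (rule ket_expand[OF F(1)]) (use F(2) in \<open>simp add: melem_def\<close>)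
  have "melem (S o\<^sub>L T) u w = ell2_coord (S (T (ket w))) u" by (simp add: melem_def)
  also have "\<dots> = ell2_coord (S (\<Sum>v\<in>F. melem T v w *\<^sub>C ket v)) u" by (subst T) (rule refl)
  also have "\<dots> = (\<Sum>v\<in>F. melem T v w * melem S u v)"
    by (simp add: melem_def[of S] blinfun.sum_right bounded_opsD[OF S])
  finally show ?thesis by (simp add: mult.commute)
qed

lemma cinner_sum_right: "cinner x (\<Sum>a\<in>F. f a) = (\<Sum>a\<in>F. cinner x (f a))"
  by (induction F rule: infinite_finite_induct) (auto simp: cinner_add_right)

lemma cinner_sum_sum: "cinner (\<Sum>a\<in>F. f a) (\<Sum>b\<in>G. g b) = (\<Sum>a\<in>F. \<Sum>b\<in>G. cinner (f a) (g b))"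
  unfolding cinner_sum_left[of f F "\<Sum>b\<in>G. g b"] by (rule sum.cong[OF refl cinner_sum_right])

lemma adj_sum:
  "(\<And>a. a \<in> F \<Longrightarrow> f a \<in> bounded_ops) \<Longrightarrow> adj (sum f F) = (\<Sum>a\<in>F. adj (f a :: 'x op))"
proof (induction F rule: infinite_finite_induct)
  have "adj (0 :: 'x op) = 0" by (rule adj_eqI) (auto simp: bounded_ops_zero)
  then show "adj (sum f {}) = (\<Sum>a\<in>{}. adj (f a))" by simp
  show "adj (sum f F) = (\<Sum>a\<in>F. adj (f a))" if "infinite F" for F
    using that \<open>adj (0 :: 'x op) = 0\<close> by simp
qed (simp add: adj_add bounded_ops_sum)

subsection \<open>Tensor products of operators\<close>

lemma coord_tensor_vec [simp]: "ell2_coord (tensor_vec x y) (i, j) = ell2_coord x i * ell2_coord y j"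
  by (simp add: tensor_vec.rep_eq)

lemma ket_tensor: "ket (i, j) = tensor_vec (ket i) (ket j)"
proof (rule ell2_eqI)
  show "ell2_coord (ket (i, j)) p = ell2_coord (tensor_vec (ket i) (ket j)) p" for p
    by (cases p) simp
qed

lemma norm_ket [simp]: "norm (ket q) = 1"
proof -
  have "(norm (ket q))\<^sup>2 = 1" using norm_sum_ket[of "{q}" "\<lambda>_. 1"] by simp
  then show ?thesis by (simp add: power2_eq_1_iff) (metis norm_ge_zero not_one_le_zero neg_0_le_iff_le)
qed

lemma bij_swap: "bij_betw prod.swap UNIV UNIV"
  by (simp add: bij_betw_def)

lemma square_summable_prod:
  fixes x :: "('i \<times> 'j) \<Rightarrow> complex"
  assumes 1: "\<And>j. (\<lambda>i. (cmod (x (i, j)))\<^sup>2) summable_on UNIV"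
    and 2: "(\<lambda>j. \<Sum>\<^sub>\<infinity>i. (cmod (x (i, j)))\<^sup>2) summable_on UNIV"
  shows "(\<lambda>p. (cmod (x p))\<^sup>2) summable_on UNIV"
    and "(\<Sum>\<^sub>\<infinity>p. (cmod (x p))\<^sup>2) = (\<Sum>\<^sub>\<infinity>j. \<Sum>\<^sub>\<infinity>i. (cmod (x (i, j)))\<^sup>2)"
proof -
  note b = bij_swap
  have s: "(\<lambda>(j, i). (cmod (x (i, j)))\<^sup>2) summable_on UNIV \<times> UNIV"
    by (rule summable_on_SigmaI[where g = "\<lambda>j. \<Sum>\<^sub>\<infinity>i. (cmod (x (i, j)))\<^sup>2"]) (use 1 2 in \<open>auto intro: has_sum_infsum\<close>)
  have eq: "(\<lambda>(j, i). (cmod (x (i, j)))\<^sup>2) = (\<lambda>p. (cmod (x (prod.swap p)))\<^sup>2)" by auto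
  show "(\<lambda>p. (cmod (x p))\<^sup>2) summable_on UNIV"
    using s summable_on_reindex_bij_betw[OF b, of "\<lambda>p. (cmod (x p))\<^sup>2"] unfolding eq by simp
  have "(\<Sum>\<^sub>\<infinity>p. (cmod (x p))\<^sup>2) = (\<Sum>\<^sub>\<infinity>(j, i)\<in>UNIV \<times> UNIV. (cmod (x (i, j)))\<^sup>2)"
    unfolding eq using infsum_reindex_bij_betw[OF b, of "\<lambda>p. (cmod (x p))\<^sup>2"] by simp
  also have "\<dots> = (\<Sum>\<^sub>\<infinity>j. \<Sum>\<^sub>\<infinity>i. (cmod (x (i, j)))\<^sup>2)"
    using infsum_Sigma'_banach[of "\<lambda>j i. (cmod (x (i, j)))\<^sup>2" UNIV "\<lambda>_. UNIV"] s by simp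
  finally show "(\<Sum>\<^sub>\<infinity>p. (cmod (x p))\<^sup>2) = (\<Sum>\<^sub>\<infinity>j. \<Sum>\<^sub>\<infinity>i. (cmod (x (i, j)))\<^sup>2)" .
qed

lemma square_summable_prod_converse:
  fixes x :: "('i \<times> 'j) \<Rightarrow> complex"
  assumes "(\<lambda>p. (cmod (x p))\<^sup>2) summable_on UNIV"
  shows "(\<lambda>i. (cmod (x (i, j)))\<^sup>2) summable_on UNIV"
    and "(\<lambda>j. \<Sum>\<^sub>\<infinity>i. (cmod (x (i, j)))\<^sup>2) summable_on UNIV"
proof -
  note b = bij_swap
  have eq: "(\<lambda>(j, i). (cmod (x (i, j)))\<^sup>2) = (\<lambda>p. (cmod (x (prod.swap p)))\<^sup>2)" by auto
  have s: "(\<lambda>(j, i). (cmod (x (i, j)))\<^sup>2) summable_on UNIV \<times> UNIV"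
    using assms summable_on_reindex_bij_betw[OF b, of "\<lambda>p. (cmod (x p))\<^sup>2"] unfolding eq by simp
  show "(\<lambda>j. \<Sum>\<^sub>\<infinity>i. (cmod (x (i, j)))\<^sup>2) summable_on UNIV"
    using summable_on_Sigma_banach[of "\<lambda>j i. (cmod (x (i, j)))\<^sup>2" UNIV "\<lambda>_. UNIV"] s by simp
  show "(\<lambda>i. (cmod (x (i, j)))\<^sup>2) summable_on UNIV"
    using summable_on_SigmaD1[of "\<lambda>j i. (cmod (x (i, j)))\<^sup>2" UNIV "\<lambda>_. UNIV" j] s by simp
qed

lift_definition slice :: "'j \<Rightarrow> ('i \<times> 'j) ell2 \<Rightarrow> 'i ell2" is "\<lambda>j x i. x (i, j)"
  by (rule square_summable_prod_converse)

lift_definition embed :: "'j \<Rightarrow> 'i ell2 \<Rightarrow> ('i \<times> 'j) ell2" is "\<lambda>j x p. if snd p = j then x (fst p) else 0"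
proof -
  fix k :: 'j and x :: "'i \<Rightarrow> complex"
  assume x: "(\<lambda>i. (cmod (x i))\<^sup>2) summable_on UNIV"
  show "(\<lambda>p. (cmod (if snd p = k then x (fst p) else 0))\<^sup>2) summable_on UNIV"
  proof (rule square_summable_prod)
    show "(\<lambda>i. (cmod (if snd (i, j) = k then x (fst (i, j)) else 0))\<^sup>2) summable_on UNIV" for j
      using x by (cases "j = k") auto
    have "(\<lambda>j. \<Sum>\<^sub>\<infinity>i. (cmod (if snd (i, j) = k then x (fst (i, j)) else 0))\<^sup>2) summable_on {k}" by simp
    then show "(\<lambda>j. \<Sum>\<^sub>\<infinity>i. (cmod (if snd (i, j) = k then x (fst (i, j)) else 0))\<^sup>2) summable_on UNIV"
      by (rule summable_on_cong_neutral[THEN iffD1, rotated -1]) auto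
  qed
qed

lemma coord_slice [simp]: "ell2_coord (slice j x) i = ell2_coord x (i, j)" by (simp add: slice.rep_eq)
lemma coord_embed [simp]: "ell2_coord (embed j x) p = (if snd p = j then ell2_coord x (fst p) else 0)"
  by (simp add: embed.rep_eq)

lemma norm_sq_slices:
  "(norm x)\<^sup>2 = (\<Sum>\<^sub>\<infinity>j. (norm (slice j x))\<^sup>2)" "(\<lambda>j. (norm (slice j x))\<^sup>2) summable_on UNIV"
  using square_summable_prod_converse[OF ell2_coord_square_summable[of x]]
    square_summable_prod(2)[of "ell2_coord x"] by (simp_all add: norm_ell2_sq)

lemma norm_slice_le: "norm (slice j x) \<le> norm x"
proof -
  have "(norm (slice j x))\<^sup>2 = (\<Sum>\<^sub>\<infinity>k\<in>{j}. (norm (slice k x))\<^sup>2)" by simp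
  also have "\<dots> \<le> (norm x)\<^sup>2"
    unfolding norm_sq_slices(1) by (rule infsum_mono2) (auto intro: norm_sq_slices(2))
  finally show ?thesis by (rule power2_le_imp_le) simp
qed

lemma slice_embed: "slice j (embed k x) = (if j = k then x else 0)"
  by (rule ell2_eqI) auto

lemma norm_embed: "norm (embed j x) = norm x"
proof -
  have "(norm (embed j x))\<^sup>2 = (\<Sum>\<^sub>\<infinity>k. (norm (slice k (embed j x)))\<^sup>2)" by (rule norm_sq_slices)
  also have "\<dots> = (\<Sum>\<^sub>\<infinity>k\<in>{j}. (norm x)\<^sup>2)" by (rule infsum_cong_neutral) (auto simp: slice_embed)
  finally show ?thesis by simp
qed

definition slice_op :: "'j \<Rightarrow> ('i \<times> 'j) ell2 \<Rightarrow>\<^sub>L 'i ell2" where "slice_op j = Blinfun (slice j)"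
definition embed_op :: "'j \<Rightarrow> 'i ell2 \<Rightarrow>\<^sub>L ('i \<times> 'j) ell2" where "embed_op j = Blinfun (embed j)"

lemma slice_op_apply [simp]: "slice_op j x = slice j x"
proof -
  have "bounded_linear (slice j :: ('a \<times> 'b) ell2 \<Rightarrow> 'a ell2)"
    by (rule bounded_linear_intro[where K = 1]) (auto intro!: ell2_eqI norm_slice_le)
  then show ?thesis by (simp add: slice_op_def bounded_linear_Blinfun_apply)
qed

lemma embed_op_apply [simp]: "embed_op j x = embed j x"
proof -
  have "bounded_linear (embed j :: 'a ell2 \<Rightarrow> ('a \<times> 'b) ell2)"
    by (rule bounded_linear_intro[where K = 1]) (auto intro!: ell2_eqI simp: norm_embed)
  then show ?thesis by (simp add: embed_op_def bounded_linear_Blinfun_apply)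
qed

lemma slice_scaleC: "slice j (c *\<^sub>C x) = c *\<^sub>C slice j x" by (rule ell2_eqI) simp
lemma embed_scaleC: "embed j (c *\<^sub>C x) = c *\<^sub>C embed j x" by (rule ell2_eqI) simp

lemma cinner_embed: "cinner (embed j x) y = cinner x (slice j y)"
proof -
  have "cinner (embed j x) y = (\<Sum>\<^sub>\<infinity>p\<in>range (\<lambda>i. (i, j)). cnj (ell2_coord (embed j x) p) * ell2_coord y p)"
    unfolding cinner_eq by (rule infsum_cong_neutral) (auto split: if_splits)
  also have "\<dots> = cinner x (slice j y)"
    unfolding cinner_eq by (subst infsum_reindex) (auto simp: inj_on_def comp_def)
  finally show ?thesis .
qed

lemma ampliation_exists:
  assumes S: "S \<in> (bounded_ops :: 'i op set)"
  shows "\<exists>R :: ('i \<times> 'j) op. R \<in> bounded_ops \<and> (\<forall>x i j. ell2_coord (R x) (i, j) = ell2_coord (S (slice j x)) i)"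
proof -
  define f :: "('i \<times> 'j) ell2 \<Rightarrow> 'i \<times> 'j \<Rightarrow> complex" where "f x = (\<lambda>(i, j). ell2_coord (S (slice j x)) i)" for x
  have 1: "(\<lambda>i. (cmod (f x (i, j)))\<^sup>2) summable_on UNIV" for x j
    using ell2_coord_square_summable by (simp add: f_def)
  have e: "(\<Sum>\<^sub>\<infinity>i. (cmod (f x (i, j)))\<^sup>2) = (norm (S (slice j x)))\<^sup>2" for x j
    by (simp add: f_def norm_ell2_sq)
  have le: "(norm (S (slice j x)))\<^sup>2 \<le> (norm S)\<^sup>2 * (norm (slice j x))\<^sup>2" for x j
    unfolding power_mult_distrib[symmetric] by (intro power_mono norm_blinfun) simp
  have sl: "(\<lambda>j. (norm S)\<^sup>2 * (norm (slice j x))\<^sup>2) summable_on UNIV" for x :: "('i \<times> 'j) ell2"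
    by (intro summable_on_cmult_right norm_sq_slices)
  have 2: "(\<lambda>j. (norm (S (slice j x)))\<^sup>2) summable_on UNIV" for x :: "('i \<times> 'j) ell2"
    by (rule summable_on_comparison_test[OF sl[of x]]) (use le in auto)
  have sm: "(\<lambda>p. (cmod (f x p))\<^sup>2) summable_on UNIV" for x
    by (rule square_summable_prod[OF 1]) (unfold e, rule 2)
  define R where "R x = Abs_ell2 (f x)" for x
  have R: "ell2_coord (R x) p = f x p" for x p
    unfolding R_def using sm by (simp add: Abs_ell2_inverse)
  have nR: "norm (R x) \<le> norm x * norm S" for x
  proof -
    have "(norm (R x))\<^sup>2 = (\<Sum>\<^sub>\<infinity>j. (norm (S (slice j x)))\<^sup>2)"
      unfolding norm_ell2_sq[of "R x"] R using square_summable_prod(2)[OF 1, of x] 2[of x] unfolding e by simp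
    also have "\<dots> \<le> (\<Sum>\<^sub>\<infinity>j. (norm S)\<^sup>2 * (norm (slice j x))\<^sup>2)"
      by (rule infsum_mono[OF 2 sl]) (rule le)
    also have "\<dots> = (norm x * norm S)\<^sup>2"
      by (simp add: infsum_cmult_right' norm_sq_slices(1)[symmetric] power_mult_distrib)
    finally show ?thesis by (rule power2_le_imp_le) simp
  qed
  have sl_add: "slice j (x + y) = slice j x + slice j y" for j :: 'j and x y :: "('i \<times> 'j) ell2"
    by (rule ell2_eqI) simp
  have bl: "bounded_linear R"
    by (rule bounded_linear_intro[OF _ _ nR])
      (auto intro!: ell2_eqI simp: R f_def sl_add blinfun.add_right scaleR_scaleC slice_scaleC bounded_opsD[OF S])
  have "Blinfun R \<in> bounded_ops"
    by (rule bounded_opsI) (auto intro!: ell2_eqI simp: bounded_linear_Blinfun_apply[OF bl] R f_def slice_scaleC bounded_opsD[OF S])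
  then show ?thesis
    by (intro exI[of _ "Blinfun R"]) (simp add: bounded_linear_Blinfun_apply[OF bl] R f_def)
qed

lift_definition swap_vec :: "('i \<times> 'j) ell2 \<Rightarrow> ('j \<times> 'i) ell2" is "\<lambda>x p. x (prod.swap p)"
proof -
  fix x :: "'i \<times> 'j \<Rightarrow> complex"
  assume "(\<lambda>p. (cmod (x p))\<^sup>2) summable_on UNIV"
  then show "(\<lambda>p. (cmod (x (prod.swap p)))\<^sup>2) summable_on UNIV"
    using summable_on_reindex_bij_betw[OF bij_swap, of "\<lambda>p. (cmod (x p))\<^sup>2"] by simp
qed

lemma coord_swap [simp]: "ell2_coord (swap_vec x) (j, i) = ell2_coord x (i, j)" by (simp add: swap_vec.rep_eq)

lemma norm_swap: "norm (swap_vec x) = norm x"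
proof -
  from infsum_reindex_bij_betw[OF bij_swap, of "\<lambda>p. (cmod (ell2_coord x p))\<^sup>2"]
  have "(norm (swap_vec x))\<^sup>2 = (norm x)\<^sup>2" by (simp add: norm_ell2_sq swap_vec.rep_eq)
  then show ?thesis by simp
qed

lemma bounded_linear_swap: "bounded_linear (swap_vec :: ('i \<times> 'j) ell2 \<Rightarrow> ('j \<times> 'i) ell2)"
  by (rule bounded_linear_intro[where K = 1]) (auto intro!: ell2_eqI simp: norm_swap)

text \<open>An ampliation acts on the first factor only, so the second operator is ampliated between
  two exchanges of the factors.\<close>

lemma tensor_op_exists:
  assumes S: "S \<in> (bounded_ops :: 'i op set)" and T: "T \<in> (bounded_ops :: 'j op set)"
  shows "\<exists>R. R \<in> bounded_ops \<and> (\<forall>x y. blinfun_apply R (tensor_vec x y) = tensor_vec (S x) (T y))"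
proof -
  obtain R1 :: "('i \<times> 'j) op" where R1: "R1 \<in> bounded_ops" "\<And>x i j. ell2_coord (R1 x) (i, j) = ell2_coord (S (slice j x)) i"
    using ampliation_exists[OF S] by blast
  obtain R2 :: "('j \<times> 'i) op" where R2: "R2 \<in> bounded_ops" "\<And>x i j. ell2_coord (R2 x) (j, i) = ell2_coord (T (slice i x)) j"
    using ampliation_exists[OF T] by blast
  define W :: "('i \<times> 'j) ell2 \<Rightarrow>\<^sub>L ('j \<times> 'i) ell2" where "W = Blinfun swap_vec"
  define W' :: "('j \<times> 'i) ell2 \<Rightarrow>\<^sub>L ('i \<times> 'j) ell2" where "W' = Blinfun swap_vec"
  have W: "W x = swap_vec x" "W' y = swap_vec y" for x y
    by (simp_all add: W_def W'_def bounded_linear_Blinfun_apply bounded_linear_swap)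
  have sw: "swap_vec (c *\<^sub>C x) = c *\<^sub>C swap_vec x" for c and x :: "('a \<times> 'b) ell2"
    by (rule ell2_eqI) (auto simp: swap_vec.rep_eq)
  have sl: "slice j (tensor_vec x y) = ell2_coord y j *\<^sub>C x" for x :: "'a ell2" and y :: "'b ell2" and j
    by (rule ell2_eqI) simp
  define R where "R = W' o\<^sub>L R2 o\<^sub>L W o\<^sub>L R1"
  have "R \<in> bounded_ops"
    by (rule bounded_opsI) (simp add: R_def W sw bounded_opsD[OF R1(1)] bounded_opsD[OF R2(1)])
  moreover have "R (tensor_vec x y) = tensor_vec (S x) (T y)" for x y
  proof -
    have 1: "R1 (tensor_vec x y) = tensor_vec (S x) y"
      by (rule ell2_eqI) (auto simp: R1(2) sl bounded_opsD[OF S] split: prod.splits)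
    have 2: "swap_vec (tensor_vec (S x) y) = tensor_vec y (S x)"
      by (rule ell2_eqI) (auto split: prod.splits)
    have 3: "R2 (tensor_vec y (S x)) = tensor_vec (T y) (S x)"
      by (rule ell2_eqI) (auto simp: R2(2) sl bounded_opsD[OF T] split: prod.splits)
    have 4: "swap_vec (tensor_vec (T y) (S x)) = tensor_vec (S x) (T y)"
      by (rule ell2_eqI) (auto split: prod.splits)
    show ?thesis by (simp add: R_def W 1 2 3 4)
  qed
  ultimately show ?thesis by blast
qed

lemma tensor_op_eqI:
  assumes R: "R \<in> bounded_ops" "\<And>x y. blinfun_apply R (tensor_vec x y) = tensor_vec (blinfun_apply S x) (blinfun_apply T y)"
  shows "tensor_op S T = R"
  unfolding tensor_op_def
proof (rule the_equality)
  fix R' assume R': "R' \<in> bounded_ops \<and> (\<forall>x y. blinfun_apply R' (tensor_vec x y) = tensor_vec (blinfun_apply S x) (blinfun_apply T y))"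
  show "R' = R"
  proof (rule bounded_ops_eqI)
    show "blinfun_apply R' (ket v) = blinfun_apply R (ket v)" for v
      using R R' by (cases v) (simp add: ket_tensor)
  qed (use R R' in auto)
qed (use R in auto)

lemma
  assumes "S \<in> bounded_ops" "T \<in> bounded_ops"
  shows tensor_op_bounded: "tensor_op S T \<in> bounded_ops"
    and tensor_op_apply: "blinfun_apply (tensor_op S T) (tensor_vec x y) = tensor_vec (blinfun_apply S x) (blinfun_apply T y)"
proof -
  obtain R where R: "R \<in> bounded_ops" "\<And>x y. blinfun_apply R (tensor_vec x y) = tensor_vec (blinfun_apply S x) (blinfun_apply T y)"
    using tensor_op_exists[OF assms] by blast
  then have "tensor_op S T = R" by (rule tensor_op_eqI)
  then show "tensor_op S T \<in> bounded_ops" "blinfun_apply (tensor_op S T) (tensor_vec x y) = tensor_vec (blinfun_apply S x) (blinfun_apply T y)"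
    using R by auto
qed

section \<open>Operators on the stabilised space as infinite matrices\<close>

definition corner_entry :: "'j \<Rightarrow> 'j \<Rightarrow> ('i \<times> 'j) op \<Rightarrow> 'i op" where
  "corner_entry p q R = slice_op p o\<^sub>L R o\<^sub>L embed_op q"

definition unit_entry :: "'j \<Rightarrow> 'j \<Rightarrow> 'i op \<Rightarrow> ('i \<times> 'j) op" where
  "unit_entry p q a = embed_op p o\<^sub>L a o\<^sub>L slice_op q"

definition ket_bra :: "'j \<Rightarrow> 'j \<Rightarrow> 'j op" where
  "ket_bra p q = Blinfun (\<lambda>x. ell2_coord x q *\<^sub>C ket p)"

lemma norm_coord_le: "cmod (ell2_coord x q) \<le> norm x"
proof -
  show ?thesis using cinner_Cauchy_Schwarz[of "ket q" x] by (simp add: cinner_ket_left)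
qed

lemma ket_bra_apply: "ket_bra p q x = ell2_coord x q *\<^sub>C ket p"
proof -
  have "bounded_linear (\<lambda>x. ell2_coord x q *\<^sub>C ket p)"
    by (intro bounded_linear_intro[where K = 1]) (auto intro!: ell2_eqI simp: norm_scaleC norm_coord_le distrib_right)
  then show ?thesis by (simp add: ket_bra_def bounded_linear_Blinfun_apply)
qed

lemma ket_bra_compact: "ket_bra p q \<in> compact_ops"
proof -
  have b: "ket_bra p q \<in> bounded_ops" by (rule bounded_opsI) (simp add: ket_bra_apply)
  define K where "K = (\<lambda>c. c *\<^sub>C ket p) ` cball (0::complex) 1"
  have "continuous_on (cball 0 1) (\<lambda>c. c *\<^sub>C ket p)"
  proof -
    have "bounded_linear (\<lambda>c. c *\<^sub>C ket p)"
      by (intro bounded_linear_intro[where K = 1]) (auto intro!: ell2_eqI simp: norm_scaleC distrib_right scaleR_conv_of_real)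
    then show ?thesis by (rule linear_continuous_on)
  qed
  then have K: "compact K" unfolding K_def by (rule compact_continuous_image) simp
  have "blinfun_apply (ket_bra p q) ` cball 0 1 \<subseteq> K"
    unfolding K_def using norm_coord_le order_trans by (fastforce simp: ket_bra_apply)
  then have "closure (blinfun_apply (ket_bra p q) ` cball 0 1) \<subseteq> K"
    using K by (intro closure_minimal compact_imp_closed)
  then have "compact (closure (blinfun_apply (ket_bra p q) ` cball 0 1))"
    using K by (metis closed_closure compact_Int_closed inf.absorb2)
  then show ?thesis using b by (simp add: compact_ops_def)
qed

lemma unit_entry_bounded: "a \<in> bounded_ops \<Longrightarrow> unit_entry p q a \<in> bounded_ops"
  by (rule bounded_opsI) (simp add: unit_entry_def slice_scaleC embed_scaleC bounded_opsD)

lemma tensor_op_ket_bra: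
  fixes a :: "'i op" and p q :: 'j
  assumes a: "a \<in> bounded_ops"
  shows "tensor_op a (ket_bra p q) = unit_entry p q a"
proof (rule tensor_op_eqI[OF unit_entry_bounded[OF a]], rule ell2_eqI)
  fix x :: "'i ell2" and y :: "'j ell2" and r :: "'i \<times> 'j"
  have "slice q (tensor_vec x y) = ell2_coord y q *\<^sub>C x" by (rule ell2_eqI) simp
  then show "ell2_coord (unit_entry p q a (tensor_vec x y)) r = ell2_coord (tensor_vec (a x) (ket_bra p q y)) r"
    by (cases r) (simp add: unit_entry_def ket_bra_apply bounded_opsD[OF a])
qed

lemma coord_proj_ket_bra: "coord_proj n = ket_bra n n"
  by (rule blinfun_eqI, rule ell2_eqI) (simp add: coord_proj_apply ket_bra_apply coord_vec.rep_eq)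

lemma corner_eq: "a \<in> bounded_ops \<Longrightarrow> corner a = unit_entry 0 0 a"
  by (simp add: corner_def coord_proj_ket_bra tensor_op_ket_bra)
lemma double_eq: "a \<in> bounded_ops \<Longrightarrow> double a = unit_entry 0 0 a + unit_entry 1 1 a"
  by (simp add: double_def coord_proj_ket_bra tensor_op_ket_bra)

lemma embed_zero [simp]: "embed p 0 = 0" by (rule ell2_eqI) simp

lemma unit_entry_zero [simp]: "unit_entry p q 0 = 0"
  by (rule blinfun_eqI) (simp add: unit_entry_def)

lemma unit_entry_comp: "unit_entry p q a o\<^sub>L unit_entry q' r b = (if q = q' then unit_entry p r (a o\<^sub>L b) else 0)"
  by (rule blinfun_eqI) (auto simp: unit_entry_def slice_embed blinfun.zero_right)

lemma cinner_embed': "cinner x (embed j y) = cinner (slice j x) y"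
  using cinner_embed[of j y x] cinner_commute[of x "embed j y"] cinner_commute[of "slice j x" y] by simp

lemma adj_unit_entry: "a \<in> bounded_ops \<Longrightarrow> adj (unit_entry p q a) = unit_entry q p (adj a)"
  by (rule adj_eqI[OF unit_entry_bounded[OF adj_bounded]])
    (simp_all add: unit_entry_def cinner_embed cinner_embed' cinner_adj)

lemma norm_unit_entry_le: "norm (unit_entry p q a) \<le> norm a"
proof (rule norm_blinfun_bound)
  fix x
  have "norm (a (slice q x)) \<le> norm a * norm (slice q x)" by (rule norm_blinfun)
  also have "\<dots> \<le> norm a * norm x" by (intro mult_left_mono norm_slice_le) simp
  finally show "norm (unit_entry p q a x) \<le> norm a * norm x" by (simp add: unit_entry_def norm_embed)
qed simp

lemma unit_entry_diff: "unit_entry p q (a - b) = unit_entry p q a - unit_entry p q b"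
  by (rule blinfun_eqI) (simp add: unit_entry_def blinfun.diff_left blinfun.diff_right embed_op_apply[symmetric] del: embed_op_apply)

lemma unit_entry_tendsto: "(f \<longlonglongrightarrow> a) \<Longrightarrow> (\<lambda>k. unit_entry p q (f k)) \<longlonglongrightarrow> unit_entry p q a"
  unfolding LIM_zero_iff[of _ a, symmetric] LIM_zero_iff[of _ "unit_entry p q a", symmetric]
  by (rule Lim_null_comparison[where g = "\<lambda>k. norm (f k - a)"])
    (auto simp: unit_entry_diff[symmetric] norm_unit_entry_le tendsto_norm_zero)

lemma corner_entry_tensor:
  fixes a :: "'i op" and k :: "'j op"
  assumes "a \<in> bounded_ops" "k \<in> bounded_ops"
  shows "corner_entry p q (tensor_op a k) = scaleC_op (ell2_coord (k (ket q)) p) a"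
proof (rule blinfun_eqI, rule ell2_eqI)
  fix x :: "'i ell2" and i
  have "embed q x = tensor_vec x (ket q)"
  proof (rule ell2_eqI)
    show "ell2_coord (embed q x) r = ell2_coord (tensor_vec x (ket q)) r" for r by (cases r) simp
  qed
  then show "ell2_coord (corner_entry p q (tensor_op a k) x) i = ell2_coord (scaleC_op (ell2_coord (k (ket q)) p) a x) i"
    by (simp add: corner_entry_def tensor_op_apply[OF assms] scaleC_op_apply mult.commute)
qed

lemma norm_corner_entry_le: "norm (corner_entry p q R) \<le> norm R"
proof (rule norm_blinfun_bound)
  fix x
  have "norm (corner_entry p q R x) \<le> norm (R (embed q x))" by (simp add: corner_entry_def norm_slice_le)
  also have "\<dots> \<le> norm R * norm (embed q x)" by (rule norm_blinfun)
  finally show "norm (corner_entry p q R x) \<le> norm R * norm x" by (simp add: norm_embed)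
qed simp

lemma corner_entry_add: "corner_entry p q (R + S) = corner_entry p q R + corner_entry p q S"
  by (rule blinfun_eqI, rule ell2_eqI) (simp add: corner_entry_def blinfun.add_left)
lemma corner_entry_diff: "corner_entry p q (R - S) = corner_entry p q R - corner_entry p q S"
  by (rule blinfun_eqI, rule ell2_eqI) (simp add: corner_entry_def blinfun.diff_left)
lemma corner_entry_scaleR: "corner_entry p q (r *\<^sub>R R) = r *\<^sub>R corner_entry p q R"
  by (rule blinfun_eqI, rule ell2_eqI) (simp add: corner_entry_def blinfun.scaleR_left)
lemma corner_entry_zero: "corner_entry p q 0 = 0"
  by (rule blinfun_eqI, rule ell2_eqI) (simp add: corner_entry_def)

lemma bounded_linear_corner_entry: "bounded_linear (corner_entry p q)"
  by (rule bounded_linear_intro[where K = 1])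
    (simp_all add: corner_entry_add corner_entry_scaleR norm_corner_entry_le)

lemma corner_entry_unit_entry: "corner_entry p q (unit_entry p' q' a) = (if p = p' \<and> q = q' then a else 0)"
  by (rule blinfun_eqI) (auto simp: corner_entry_def unit_entry_def slice_embed blinfun.zero_right)

lemma scaleR_eq_scaleC_op: "r *\<^sub>R T = scaleC_op (of_real r) T"
  by (rule blinfun_eqI) (simp add: scaleC_op_apply blinfun.scaleR_left scaleR_scaleC)

text \<open>An entry of \<open>tensor_op a k\<close> is a scalar multiple of \<open>a\<close>.
  Taking an entry is linear and continuous and \<open>A\<close> is a closed subspace, so this passes
  to the closed span.\<close>

lemma corner_entry_stabilisation:
  assumes A: "cstar_algebra A" and R: "R \<in> stabilisation A"
  shows "corner_entry p q R \<in> A"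
proof -
  define V where "V = {R. corner_entry p q R \<in> A}"
  have Ab: "A \<subseteq> bounded_ops" and cl: "closed A" and A0: "0 \<in> A"
    and Aadd: "\<And>x y. x \<in> A \<Longrightarrow> y \<in> A \<Longrightarrow> x + y \<in> A" and Asc: "\<And>c x. x \<in> A \<Longrightarrow> scaleC_op c x \<in> A"
    using A unfolding cstar_algebra_def by auto
  have "subspace V"
    using A0 Aadd Asc[of _ "of_real r" for r]
    by (auto simp: subspace_def V_def corner_entry_add corner_entry_scaleR corner_entry_zero
        simp flip: scaleR_eq_scaleC_op)
  moreover have "{tensor_op a k | a k. a \<in> A \<and> k \<in> compact_ops} \<subseteq> V"
    using Ab Asc by (auto simp: V_def compact_ops_def corner_entry_tensor)
  ultimately have "span {tensor_op a k | a k. a \<in> A \<and> k \<in> compact_ops} \<subseteq> V"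
    by (intro span_minimal)
  moreover have "closed V"
  proof -
    have "closed (corner_entry p q -` A)"
      by (intro closed_vimage cl linear_continuous_on bounded_linear_corner_entry)
    then show ?thesis by (simp add: V_def vimage_def)
  qed
  ultimately have "stabilisation A \<subseteq> V"
    unfolding stabilisation_def by (rule closure_minimal)
  then show ?thesis using R by (auto simp: V_def)
qed

lemma unit_entry_stabilisation:
  assumes A: "cstar_algebra A" and a: "a \<in> A"
  shows "unit_entry p q a \<in> stabilisation A"
proof -
  have "a \<in> bounded_ops" using A a unfolding cstar_algebra_def by auto
  then have "unit_entry p q a = tensor_op a (ket_bra p q)" by (simp add: tensor_op_ket_bra)
  then show ?thesis unfolding stabilisation_def using a ket_bra_compact[of p q]
    by (intro subsetD[OF closure_subset] span_base) auto
qed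

lemma stabilisation_add:
  assumes "R \<in> stabilisation A" "S \<in> stabilisation A"
  shows "R + S \<in> stabilisation A"
proof -
  let ?S = "span {tensor_op a k | a k. a \<in> A \<and> k \<in> compact_ops}"
  obtain f g where "\<And>n. f n \<in> ?S" "f \<longlonglongrightarrow> R" "\<And>n. g n \<in> ?S" "g \<longlonglongrightarrow> S"
    using assms unfolding stabilisation_def closure_sequential by blast
  then have "\<And>n. f n + g n \<in> ?S" "(\<lambda>n. f n + g n) \<longlonglongrightarrow> R + S"
    by (auto intro: span_add tendsto_add)
  then show ?thesis
    unfolding stabilisation_def closure_sequential by (intro exI[of _ "\<lambda>n. f n + g n"]) auto
qed

lemma closed_bounded_ops: "closed (bounded_ops :: 'i op set)"
proof -
  have eq: "bounded_ops = (\<Inter>c. \<Inter>x. {T :: 'i op. T (c *\<^sub>C x) = c *\<^sub>C T x})" by (auto simp: bounded_ops_def)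
  have ev: "continuous_on UNIV (\<lambda>T :: 'i op. blinfun_apply T x)" for x
    by (intro bounded_linear.continuous_on[OF blinfun.bounded_linear_left] continuous_on_id)
  have "closed {T :: 'i op. T (c *\<^sub>C x) = c *\<^sub>C T x}" for c x
    by (intro closed_Collect_eq ev bounded_linear.continuous_on[OF bounded_linear_scaleC])
  then show ?thesis unfolding eq by (intro closed_INT ballI)
qed

lemma stabilisation_bounded:
  fixes A :: "'i op set"
  assumes A: "cstar_algebra A" and R: "R \<in> stabilisation A"
  shows "R \<in> bounded_ops"
proof -
  have "subspace (bounded_ops :: ('i \<times> nat) op set)"
    by (auto simp: subspace_def bounded_ops_zero bounded_ops_add scaleR_eq_scaleC_op bounded_ops_scaleC)
  moreover have "{tensor_op a k | a k. a \<in> A \<and> k \<in> (compact_ops :: nat op set)} \<subseteq> bounded_ops"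
    using A by (auto simp: cstar_algebra_def compact_ops_def intro!: tensor_op_bounded)
  ultimately have 1: "span {tensor_op a k | a k. a \<in> A \<and> k \<in> (compact_ops :: nat op set)} \<subseteq> bounded_ops"
    by (intro span_minimal)
  have "closure (span {tensor_op a k | a k. a \<in> A \<and> k \<in> (compact_ops :: nat op set)}) \<subseteq> bounded_ops"
    by (rule closure_minimal[OF 1 closed_bounded_ops])
  then show ?thesis using R by (auto simp: stabilisation_def)
qed

section \<open>Proper infiniteness as a condition on two elements of the algebra\<close>

lemma cuntz_corner_entry:
  assumes a: "a \<in> bounded_ops" and d: "d \<in> bounded_ops"
  shows "corner_entry p p' (d o\<^sub>L unit_entry 0 0 a o\<^sub>L adj d) = corner_entry p 0 d o\<^sub>L a o\<^sub>L adj (corner_entry p' 0 d)"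
proof -
  have "adj (corner_entry p' 0 d) = corner_entry 0 p' (adj d)"
    by (rule adj_eqI, rule bounded_opsI)
      (simp_all add: corner_entry_def slice_scaleC embed_scaleC bounded_opsD[OF adj_bounded[OF d]]
        cinner_embed[symmetric] cinner_embed'[symmetric] cinner_adj[OF d])
  then show ?thesis by (intro blinfun_eqI) (simp add: corner_entry_def unit_entry_def)
qed

text \<open>The element \<open>corner a\<close> occupies the matrix position (0, 0), so of the
  conjugating element \<open>d\<close> only column 0 matters. Its entries in rows 0 and 1 are
  \<open>s\<close> and \<open>t\<close>, and the four estimates concern the upper left two by two
  block.\<close>

lemma properly_infiniteD:
  assumes A: "cstar_algebra A" and a: "a \<in> A" and pi: "properly_infinite A a" and e: "e > 0"
  shows "\<exists>s\<in>A. \<exists>t\<in>A. norm ((s o\<^sub>L a o\<^sub>L adj s) - a) < e \<and> norm (s o\<^sub>L a o\<^sub>L adj t) < e \<and>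
    norm (t o\<^sub>L a o\<^sub>L adj s) < e \<and> norm ((t o\<^sub>L a o\<^sub>L adj t) - a) < e"
proof -
  have ab: "a \<in> bounded_ops" using A a unfolding cstar_algebra_def by auto
  obtain D where D: "\<And>k. D k \<in> stabilisation A" "(\<lambda>k. D k o\<^sub>L corner a o\<^sub>L adj (D k)) \<longlonglongrightarrow> double a"
    using pi unfolding properly_infinite_def cuntz_below_def by blast
  from LIMSEQ_D[OF D(2) e] obtain k where k: "norm ((D k o\<^sub>L corner a o\<^sub>L adj (D k)) - double a) < e" by auto
  define d where "d = D k"
  have dA: "d \<in> stabilisation A" and db: "d \<in> bounded_ops"
    using D(1) stabilisation_bounded[OF A] by (auto simp: d_def)
  have e1: "norm ((corner_entry p 0 d o\<^sub>L a o\<^sub>L adj (corner_entry p' 0 d)) - corner_entry p p' (double a)) < e" for p p'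
    using norm_corner_entry_le[of p p' "(D k o\<^sub>L corner a o\<^sub>L adj (D k)) - double a"] k
    unfolding corner_entry_diff corner_eq[OF ab] d_def[symmetric] cuntz_corner_entry[OF ab db] by linarith
  have e2: "corner_entry p p' (double a) = (if p = p' \<and> p < 2 then a else 0)" for p p'
    unfolding double_eq[OF ab] corner_entry_add corner_entry_unit_entry by (auto simp: numeral_2_eq_2 less_Suc_eq)
  from e1[unfolded e2, of 0 0] e1[unfolded e2, of 0 1] e1[unfolded e2, of 1 0] e1[unfolded e2, of 1 1]
    corner_entry_stabilisation[OF A dA, of 0 0] corner_entry_stabilisation[OF A dA, of 1 0]
  show ?thesis by (intro bexI[of _ "corner_entry 0 0 d"] bexI[of _ "corner_entry 1 0 d"]) simp_all
qed

text \<open>The conjugating elements are the matrices with \<open>s k\<close> and \<open>t k\<close>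
  in column 0 and zeros elsewhere.\<close>

lemma properly_infiniteI:
  assumes A: "cstar_algebra A" and a: "a \<in> A"
    and st: "\<And>k. s k \<in> A" "\<And>k. t k \<in> A"
    and lim: "(\<lambda>k. s k o\<^sub>L a o\<^sub>L adj (s k)) \<longlonglongrightarrow> a" "(\<lambda>k. t k o\<^sub>L a o\<^sub>L adj (t k)) \<longlonglongrightarrow> a"
      "(\<lambda>k. s k o\<^sub>L a o\<^sub>L adj (t k)) \<longlonglongrightarrow> 0" "(\<lambda>k. t k o\<^sub>L a o\<^sub>L adj (s k)) \<longlonglongrightarrow> 0"
  shows "properly_infinite A a"
proof -
  have b: "x \<in> bounded_ops" if "x \<in> A" for x using A that unfolding cstar_algebra_def by auto
  note ab = b[OF a] and sb = b[OF st(1)] and tb = b[OF st(2)]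
  define d where "d k = unit_entry 0 0 (s k) + unit_entry (1::nat) 0 (t k)" for k
  have "d k \<in> stabilisation A" for k
    unfolding d_def by (intro stabilisation_add unit_entry_stabilisation A st)
  moreover have "d k o\<^sub>L corner a o\<^sub>L adj (d k) =
      unit_entry 0 0 (s k o\<^sub>L a o\<^sub>L adj (s k)) + unit_entry 0 1 (s k o\<^sub>L a o\<^sub>L adj (t k)) +
      (unit_entry 1 0 (t k o\<^sub>L a o\<^sub>L adj (s k)) + unit_entry 1 1 (t k o\<^sub>L a o\<^sub>L adj (t k)))" for k
    unfolding d_def corner_eq[OF ab]
    by (simp add: adj_add unit_entry_bounded sb tb adj_unit_entry unit_entry_comp add_ac
        bounded_bilinear.add_left[OF bounded_bilinear_blinfun_compose]
        bounded_bilinear.add_right[OF bounded_bilinear_blinfun_compose])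
  moreover have "(\<lambda>k. unit_entry 0 0 (s k o\<^sub>L a o\<^sub>L adj (s k)) + unit_entry 0 1 (s k o\<^sub>L a o\<^sub>L adj (t k)) +
      (unit_entry 1 0 (t k o\<^sub>L a o\<^sub>L adj (s k)) + unit_entry 1 1 (t k o\<^sub>L a o\<^sub>L adj (t k)))) \<longlonglongrightarrow>
      unit_entry 0 0 a + unit_entry 0 1 0 + (unit_entry (1::nat) 0 0 + unit_entry 1 1 a)"
    by (intro tendsto_add unit_entry_tendsto lim)
  ultimately show ?thesis
    unfolding properly_infinite_def cuntz_below_def double_eq[OF ab] by (intro exI[of _ d]) simp
qed

subsection \<open>Common zeros on a cube with identified faces\<close>

declare add_bit_eq_xor [simp del] mult_bit_eq_and [simp del]

lemma bit_add_self [simp]: "b + b = (0::bit)"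
  by (cases b) simp_all

lemma bit_add_cancel: "x + t + (y + t) = x + (y::bit)"
  by (cases x; cases y; cases t) simp_all

lemma bit_add_cancel': "x + t + (t + y) = x + (y::bit)"
  by (cases x; cases y; cases t) simp_all

lemma bit_sum_involution_eq_0:
  fixes f :: "'a \<Rightarrow> bit"
  assumes "finite S"
    and "\<And>x. x \<in> S \<Longrightarrow> i x \<in> S \<and> i (i x) = x \<and> i x \<noteq> x \<and> f (i x) = f x"
  shows "sum f S = 0"
  using assms
proof (induction S rule: finite_psubset_induct)
  case (psubset S)
  show ?case
  proof (cases "S = {}")
    case False
    then obtain x where x: "x \<in> S" by blast
    note ix = psubset.prems[OF x]
    define S' where "S' = S - {x, i x}"
    have "sum f S' = 0"
    proof (rule psubset.IH)
      show "S' \<subset> S" using x by (auto simp: S'_def)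
      fix y assume y: "y \<in> S'"
      then have "i y \<noteq> x" "i y \<noteq> i x" using psubset.prems ix by (metis DiffD1 DiffD2 S'_def insertI1 insertI2)+
      then show "i y \<in> S' \<and> i (i y) = y \<and> i y \<noteq> y \<and> f (i y) = f y"
        using y psubset.prems[of y] by (auto simp: S'_def)
    qed
    moreover have "S = insert x (insert (i x) S')" using x ix by (auto simp: S'_def)
    moreover have "finite S'" "x \<notin> insert (i x) S'" "i x \<notin> S'" using psubset.hyps ix by (auto simp: S'_def)
    ultimately have "sum f S = f x + (f (i x) + 0)"
      by (metis finite_insert sum.insert)
    then show ?thesis using ix by simp
  qed simp
qed

section \<open>Cup products of sign functions on a cubical grid\<close>

abbreviation move :: "(nat \<Rightarrow> int) \<Rightarrow> nat \<Rightarrow> int \<Rightarrow> nat \<Rightarrow> int" where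
  "move z v e \<equiv> z(v := z v + e)"

text \<open>
  A cell of the cubical grid is encoded by doubled coordinates: an even entry is a grid value, an
  odd entry the open interval between its two neighbours. \<open>cup s k z\<close> sums, over all flags of faces
  of the \<open>k\<close>-cell \<open>z\<close>, the cup product of the coboundaries of \<open>s 0, \<dots>, s (k - 1)\<close>.
\<close>

fun cup :: "(nat \<Rightarrow> (nat \<Rightarrow> int) \<Rightarrow> bit) \<Rightarrow> nat \<Rightarrow> (nat \<Rightarrow> int) \<Rightarrow> bit" where
  "cup s 0 z = 1"
| "cup s (Suc k) z = (\<Sum>v | odd (z v). \<Sum>e\<in>{1, -1}. cup s k (move z v e) * (s k (move z v e) + s k z))"

declare cup.simps(2) [simp del]

lemma nested_sum_eq:
  assumes "finite A" "finite B" "\<And>v. v \<in> A \<Longrightarrow> finite (C v)"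
  shows "(\<Sum>v\<in>A. \<Sum>e\<in>B. \<Sum>v'\<in>C v. \<Sum>e'\<in>B. g v e v' e') =
    (\<Sum>(v, e, v', e') \<in> (SIGMA v:A. SIGMA e:B. SIGMA v':C v. B). g v e v' e')"
proof -
  have "(\<Sum>v\<in>A. \<Sum>e\<in>B. \<Sum>v'\<in>C v. \<Sum>e'\<in>B. g v e v' e') =
    (\<Sum>v\<in>A. \<Sum>e\<in>B. \<Sum>(v', e') \<in> (SIGMA v':C v. B). g v e v' e')"
    using assms by (intro sum.cong refl sum.Sigma) auto
  also have "\<dots> = (\<Sum>v\<in>A. \<Sum>(e, v', e') \<in> (SIGMA e:B. SIGMA v':C v. B). g v e v' e')"
    using assms by (intro sum.cong refl sum.Sigma) auto
  also have "\<dots> = (\<Sum>(v, e, v', e') \<in> (SIGMA v:A. SIGMA e:B. SIGMA v':C v. B). g v e v' e')"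
    using assms by (intro sum.Sigma) auto
  finally show ?thesis .
qed

text \<open>The cocycle property modulo 2. When \<open>cup\<close> of a face \<open>y\<close> is
  expanded, the terms with the common factor \<open>s k y\<close> vanish by induction. In the rest
  every face of codimension 2 is reached by two moves in either order, with the same value, so that
  the terms cancel in pairs.\<close>

lemma cup_closed:
  assumes "finite {v. odd (z v)}" "card {v. odd (z v)} = Suc k"
  shows "(\<Sum>v | odd (z v). \<Sum>e\<in>{1, -1}. cup s k (move z v e)) = 0"
  using assms
proof (induction k arbitrary: z)
  case 0
  then obtain v where "{v. odd (z v)} = {v}" by (metis One_nat_def card_1_singletonE)
  then show ?case by simp
next
  case (Suc k)
  let ?O = "\<lambda>z. {v. odd (z v) :: bool}"
  have O: "?O (move z v e) = ?O z - {v}" if "odd (z v)" "e \<in> {1, -1}" for v e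
    using that by auto
  define g where "g v e v' e' = (let y = move (move z v e) v' e' in cup s k y * s k y)" for v e v' e'
  have "(\<Sum>v\<in>?O z. \<Sum>e\<in>{1, -1}. cup s (Suc k) (move z v e)) =
      (\<Sum>v\<in>?O z. \<Sum>e\<in>{1, -1}. \<Sum>v'\<in>?O z - {v}. \<Sum>e'\<in>{1, -1}. g v e v' e')"
  proof (intro sum.cong refl)
    fix v e assume ve: "v \<in> ?O z" "e \<in> {1, -1::int}"
    define y where "y = move z v e"
    have Oy: "?O y = ?O z - {v}" unfolding y_def using O ve by auto
    have zero: "(\<Sum>v'\<in>?O y. \<Sum>e'\<in>{1, -1}. cup s k (move y v' e')) = 0"
      by (rule Suc.IH) (use Oy Suc.prems ve in \<open>auto simp: card_Diff_singleton\<close>)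
    have "cup s (Suc k) y = (\<Sum>v'\<in>?O y. \<Sum>e'\<in>{1, -1}. cup s k (move y v' e') * s k (move y v' e'))
       + (\<Sum>v'\<in>?O y. \<Sum>e'\<in>{1, -1}. cup s k (move y v' e')) * s k y"
      by (simp only: cup.simps distrib_left sum.distrib sum_distrib_right)
    then show "cup s (Suc k) (move z v e) = (\<Sum>v'\<in>?O z - {v}. \<Sum>e'\<in>{1, -1}. g v e v' e')"
      unfolding zero unfolding Oy by (simp add: g_def Let_def y_def)
  qed
  also have "\<dots> = (\<Sum>(v, e, v', e') \<in> (SIGMA v:?O z. SIGMA e:{1, -1}. SIGMA v':?O z - {v}. {1, -1}). g v e v' e')"
    by (rule nested_sum_eq) (use Suc.prems in auto)
  also have "\<dots> = 0"
    by (rule bit_sum_involution_eq_0[where i = "\<lambda>(v, e, v', e'). (v', e', v, e)"])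
       (use Suc.prems in \<open>auto simp: g_def fun_upd_twist\<close>)
  finally show ?case .
qed

text \<open>This turns a nonzero count into sign changes: in some flag all factors are nonzero, and
  factor number \<open>i\<close> is the difference of \<open>s i\<close> at two faces of
  \<open>z\<close>.\<close>

lemma cup_nonzero:
  assumes "cup s k z \<noteq> 0" "i < k"
  shows "\<exists>x y. (\<forall>v. x v = z v \<or> odd (z v) \<and> \<bar>x v - z v\<bar> = 1) \<and>
    (\<forall>v. y v = z v \<or> odd (z v) \<and> \<bar>y v - z v\<bar> = 1) \<and> s i x \<noteq> s i y"
  using assms
proof (induction k arbitrary: z)
  case (Suc k)
  from Suc.prems(1) obtain v where v: "odd (z v)"
    and nz: "(\<Sum>e\<in>{1, -1}. cup s k (move z v e) * (s k (move z v e) + s k z)) \<noteq> 0"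
    by (metis (no_types, lifting) cup.simps(2) mem_Collect_eq sum.neutral)
  from nz obtain e :: int where e: "e \<in> {1, -1}" and nz': "cup s k (move z v e) * (s k (move z v e) + s k z) \<noteq> 0"
    by (metis (no_types, lifting) sum.neutral)
  show ?case
  proof (cases "i = k")
    case True
    have "s k (move z v e) \<noteq> s k z" using nz' by auto
    then have "s i (move z v e) \<noteq> s i z" using True by simp
    moreover have "\<forall>w. move z v e w = z w \<or> odd (z w) \<and> \<bar>move z v e w - z w\<bar> = 1" using v e by auto
    ultimately show ?thesis by blast
  next
    case False
    with Suc.prems have "i < k" by simp
    have "cup s k (move z v e) \<noteq> 0" using nz' by auto
    from Suc.IH[OF this \<open>i < k\<close>] obtain x y where xy:
      "\<forall>w. x w = move z v e w \<or> odd (move z v e w) \<and> \<bar>x w - move z v e w\<bar> = 1"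
      "\<forall>w. y w = move z v e w \<or> odd (move z v e w) \<and> \<bar>y w - move z v e w\<bar> = 1" "s i x \<noteq> s i y"
      by blast
    have near: "x w = z w \<or> odd (z w) \<and> \<bar>x w - z w\<bar> = 1"
      if "\<forall>w. x w = move z v e w \<or> odd (move z v e w) \<and> \<bar>x w - move z v e w\<bar> = 1" for x w
      using that[rule_format, of w] v e by (cases "w = v") auto
    show ?thesis using near[OF xy(1)] near[OF xy(2)] xy(3) by blast
  qed
qed simp

lemma tendsto_fun_iff:
  fixes f :: "'a \<Rightarrow> 'b \<Rightarrow> 'c::topological_space"
  shows "(f \<longlongrightarrow> l) F \<longleftrightarrow> (\<forall>v. ((\<lambda>i. f i v) \<longlongrightarrow> l v) F)"
  by (simp add: limitin_componentwise flip: limitin_canonical_iff euclidean_product_topology)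

definition flip :: "(nat \<Rightarrow> bool) \<Rightarrow> (nat \<Rightarrow> 'a::uminus) \<Rightarrow> nat \<Rightarrow> 'a" where
  "flip F z = (\<lambda>v. if F v then - z v else z v)"

text \<open>
  On the face of the cube where a coordinate \<open>p\<close> has modulus 1, points are identified by the
  involution flipping the coordinates in \<open>a (blk p)\<close>; the \<open>k\<close>-th function changes sign
  under it iff \<open>c (blk p) k\<close>.
\<close>

locale cube_identification =
  fixes n :: nat and blk :: "nat \<Rightarrow> nat" and a c :: "nat \<Rightarrow> nat \<Rightarrow> bool"
  assumes a_blk: "p < n \<Longrightarrow> a (blk p) p"
    and a_eq_c: "p \<le> k \<Longrightarrow> k < n \<Longrightarrow> a (blk p) k = c (blk p) k"
begin

definition cells :: "int \<Rightarrow> nat \<Rightarrow> (nat \<Rightarrow> int) set" where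
  "cells M d = {z. (\<forall>v<d. odd (z v) \<and> \<bar>z v\<bar> < M) \<and> (\<forall>v\<ge>d. z v = 0)}"

context
  fixes M :: int and s :: "nat \<Rightarrow> (nat \<Rightarrow> int) \<Rightarrow> bit"
  assumes M: "even M" "M > 0"
    and s: "\<And>k z p. \<lbrakk>k < n; \<forall>v. \<bar>z v\<bar> \<le> M; \<forall>v\<ge>n. z v = 0; p < n; \<bar>z p\<bar> = M\<rbrakk> \<Longrightarrow>
      s k (flip (a (blk p)) z) = s k z + of_bool (c (blk p) k)"
begin

text \<open>The flip permutes the faces of a boundary cell and adds the same constant to all values
  of \<open>s k\<close> there; the constant cancels in the differences.\<close>

lemma cup_flip:
  assumes "\<forall>v. \<bar>z v\<bar> \<le> M" "\<forall>v\<ge>n. z v = 0" "p < n" "\<bar>z p\<bar> = M" "k \<le> n"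
  shows "cup s k (flip (a (blk p)) z) = cup s k z"
  using assms
proof (induction k arbitrary: z)
  case (Suc k)
  let ?F = "flip (a (blk p))"
  have O: "{v. odd (?F z v)} = {v. odd (z v)}" by (simp add: flip_def)
  have sz: "s k (?F z) = s k z + of_bool (c (blk p) k)" using Suc.prems by (intro s) auto
  have step: "cup s k (?F (move z v e)) * (s k (?F (move z v e)) + s k (?F z)) =
      cup s k (move z v e) * (s k (move z v e) + s k z)" if "odd (z v)" "e \<in> {1, -1}" for v e
  proof -
    \<comment> \<open>Since \<open>M\<close> is even, so is \<open>z p\<close>; hence the move uses
      another coordinate and the smaller cell remains on the boundary face.\<close>
    have "v \<noteq> p" using Suc.prems(4) M that
      by (metis abs_dvd_iff dvd_abs_iff)
    have "\<bar>z v\<bar> \<noteq> M" using M that by (metis dvd_abs_iff)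
    then have "\<bar>z v\<bar> < M" using Suc.prems by (metis order_le_less)
    then have "\<forall>w. \<bar>move z v e w\<bar> \<le> M" using Suc.prems that by auto
    moreover have "\<forall>w\<ge>n. move z v e w = 0" using Suc.prems that by (metis even_zero fun_upd_apply)
    moreover have "\<bar>move z v e p\<bar> = M" using \<open>v \<noteq> p\<close> Suc.prems by simp
    ultimately have "cup s k (?F (move z v e)) = cup s k (move z v e)"
      "s k (?F (move z v e)) = s k (move z v e) + of_bool (c (blk p) k)"
      using Suc.prems(3,5) by - (rule Suc.IH s; simp)+
    then show ?thesis using sz by (simp add: bit_add_cancel)
  qed
  have mv: "move (?F z) v e = ?F (move z v (if a (blk p) v then - e else e))" for v e
    by (auto simp: flip_def)
  have "cup s (Suc k) (?F z) = (\<Sum>v | odd (z v). \<Sum>e\<in>{1, -1}.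
      cup s k (?F (move z v e)) * (s k (?F (move z v e)) + s k (?F z)))"
    unfolding cup.simps O
  proof (rule sum.cong[OF refl])
    fix v assume "v \<in> {v. odd (z v)}"
    show "(\<Sum>e\<in>{1, -1}. cup s k (move (?F z) v e) * (s k (move (?F z) v e) + s k (?F z))) =
      (\<Sum>e\<in>{1, -1}. cup s k (?F (move z v e)) * (s k (?F (move z v e)) + s k (?F z)))"
      unfolding mv by (cases "a (blk p) v") (simp_all add: add.commute)
  qed
  also have "\<dots> = cup s (Suc k) z"
    unfolding cup.simps by (intro sum.cong refl) (use step in blast)
  finally show ?case .
qed simp

lemma finite_cells: "finite (cells M d)"
proof (rule finite_subset)
  show "cells M d \<subseteq> {z. \<forall>v. (v \<in> {..<d} \<longrightarrow> z v \<in> {-M..M}) \<and> (v \<notin> {..<d} \<longrightarrow> z v = 0)}"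
    by (force simp: cells_def)
  show "finite \<dots>" by (rule finite_set_of_finite_funs) auto
qed

text \<open>
  Peeling off the last variable: in \<open>\<Sum>z. \<Sum>y. cup s d y * (s d y + [z d < 0])\<close>, the sum being over
  the \<open>d\<close>-faces \<open>y\<close> of \<open>z\<close>, interior faces and faces on the boundary of the cube cancel in pairs, and
  only the faces in the hyperplane \<open>y d = 0\<close> survive.
\<close>

lemma sum_cup_Suc:
  assumes d: "d < n"
  shows "(\<Sum>z\<in>cells M (Suc d). cup s (Suc d) z) = (\<Sum>z\<in>cells M d. cup s d z)"
proof -
  define side where "side z = (of_bool (z d < 0) :: bit)" for z :: "nat \<Rightarrow> int"
  define G where "G = (\<lambda>(z, v, e). cup s d (move z v e) * (s d (move z v e) + side z))"
  define T where "T = cells M (Suc d) \<times> {..d} \<times> {1, -1::int}"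
  define U where "U = {(z, v, e) \<in> T. v = d \<and> z d + e = 0}"
  \<comment> \<open>The triple \<open>(z, v, e)\<close> is the cell \<open>z\<close> with its face
    in direction \<open>e\<close> of coordinate \<open>v\<close>. \<open>I\<close> passes to the
    other cell at this face or, on the boundary of the cube, to the identified face on the opposite
    side.\<close>
  define I where "I = (\<lambda>(z, v, e). if \<bar>z v + e\<bar> = M then (flip (a (blk v)) z, v, - e)
    else (move z v (2 * e), v, - e))"
  have finT: "finite T" unfolding T_def using finite_cells by auto
  have O: "{v. odd (z v)} = {..d}" if "z \<in> cells M (Suc d)" for z
    using that unfolding cells_def
    by (auto simp: less_Suc_eq_le) (metis dvd_0_right not_less_eq_eq)
  have "(\<Sum>z\<in>cells M (Suc d). cup s (Suc d) z) = (\<Sum>z\<in>cells M (Suc d). \<Sum>v\<in>{..d}. \<Sum>e\<in>{1, -1}. G (z, v, e))"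
  proof (rule sum.cong[OF refl])
    fix z assume z: "z \<in> cells M (Suc d)"
    \<comment> \<open>In \<open>cup s (Suc d) z\<close> the value \<open>s d z\<close> multiplies a
      sum which is 0, so it may be exchanged for any function of \<open>z\<close>; the choice of
      \<open>side\<close> is what separates the two halves of the cube.\<close>
    have zero: "(\<Sum>v\<in>{..d}. \<Sum>e\<in>{1, -1}. cup s d (move z v e)) = 0"
      using cup_closed[of z d s] O[OF z] by simp
    have "cup s (Suc d) z + (\<Sum>v\<in>{..d}. \<Sum>e\<in>{1, -1}. cup s d (move z v e)) * (s d z + side z)
       = (\<Sum>v\<in>{..d}. \<Sum>e\<in>{1, -1}. cup s d (move z v e) * (s d (move z v e) + s d z + (s d z + side z)))"
      unfolding cup.simps O[OF z] by (simp only: distrib_left sum.distrib sum_distrib_right)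
    then show "cup s (Suc d) z = (\<Sum>v\<in>{..d}. \<Sum>e\<in>{1, -1}. G (z, v, e))"
      by (simp only: zero G_def prod.case bit_add_cancel' mult_zero_left add_0_right)
  qed
  also have "\<dots> = sum G T"
    unfolding T_def by (simp only: sum.cartesian_product split_def prod.collapse)
  also have "\<dots> = sum G (T - U) + sum G U"
    using finT by (intro sum.subset_diff) (auto simp: U_def)
  also have "sum G (T - U) = 0"
  proof (rule bit_sum_involution_eq_0[where i = I])
    show "finite (T - U)" using finT by simp
    fix t assume t: "t \<in> T - U"
    obtain z v e where tz: "t = (z, v, e)" by (cases t) auto
    from t tz have z: "z \<in> cells M (Suc d)" and v: "v \<le> d" and e: "e = 1 \<or> e = -1"
      and nU: "v \<noteq> d \<or> z d + e \<noteq> 0"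
      by (auto simp: T_def U_def)
    have zv: "odd (z v)" "\<bar>z v\<bar> < M" using z v by (auto simp: cells_def)
    have zd: "odd (z d)" using z by (auto simp: cells_def)
    have z0: "\<And>w. \<not> w < Suc d \<Longrightarrow> z w = 0" and zM: "\<And>w. \<bar>z w\<bar> < M" using z M(2) 
      by (auto simp: cells_def) (metis abs_0 not_less_eq_eq not_less)
    have conclude: "I t \<in> T - U \<and> I (I t) = t \<and> I t \<noteq> t \<and> G (I t) = G t"
      if "I t = (z', v, - e)" "I (z', v, - e) = t" "z' \<in> cells M (Suc d)" "(z', v, - e) \<notin> U"
        "G (z', v, - e) = G t" for z'
      using that v e tz by (auto simp: T_def)
    show "I t \<in> T - U \<and> I (I t) = t \<and> I t \<noteq> t \<and> G (I t) = G t"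
    proof (cases "\<bar>z v + e\<bar> = M")
      case True
      have av: "a (blk v) v" using a_blk v d by auto
      define z' where "z' = flip (a (blk v)) z"
      have z'v: "z' v = - z v" using av by (simp add: z'_def flip_def)
      have z': "z' \<in> cells M (Suc d)" using z by (auto simp: z'_def cells_def flip_def)
      have ff: "flip (a (blk v)) z' = z" by (auto simp: z'_def flip_def)
      have mv: "move z' v (- e) = flip (a (blk v)) (move z v e)"
        using av by (auto simp: z'_def flip_def)
      have cell: "\<forall>w. \<bar>move z v e w\<bar> \<le> M" "\<forall>w\<ge>n. move z v e w = 0" "\<bar>move z v e v\<bar> = M"
        using zM z0 True d v by (auto intro: less_imp_le)
      have cupF: "cup s d (move z' v (- e)) = cup s d (move z v e)"
        unfolding mv by (rule cup_flip) (use cell d v in auto)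
      have sF: "s d (move z' v (- e)) = s d (move z v e) + of_bool (c (blk v) d)"
        unfolding mv by (rule s) (use cell d v in auto)
      \<comment> \<open>This uses \<open>v \<le> d\<close>: for such faces coordinate
        \<open>d\<close> and the function \<open>s d\<close> obey the same sign rule, so
        \<open>side\<close> and \<open>s d\<close> change together and \<open>G\<close> is
        preserved.\<close>
      have ac: "a (blk v) d = c (blk v) d" using a_eq_c v d by auto
      have "z d \<noteq> 0" using zd by auto
      then have sideF: "side z' = side z + of_bool (c (blk v) d)"
        unfolding side_def z'_def flip_def ac by auto
      have GG: "G (z', v, - e) = G (z, v, e)"
        unfolding G_def by (simp only: prod.case cupF sF sideF bit_add_cancel)
      have "(z', v, -e) \<notin> U"
        using nU z'v by (auto simp: U_def)
      have It: "I t = (z', v, - e)" using True tz by (simp add: I_def z'_def)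
      have "\<bar>z' v + - e\<bar> = M" using True z'v by simp
      then have "I (z', v, - e) = t" using tz ff by (simp add: I_def)
      with It show ?thesis by (rule conclude) (fact z' \<open>(z', v, -e) \<notin> U\<close> GG[folded tz])+
    next
      case False
      define z' where "z' = move z v (2 * e)"
      have ev: "even (z v + e)" using zv e by auto
      from ev obtain m where m: "z v + e = 2 * m" by (rule evenE)
      from M(1) obtain k where k: "M = 2 * k" by (rule evenE)
      have "\<bar>z v + e\<bar> < M" using False zv e by linarith
      \<comment> \<open>Both sides of the preceding inequality are even, which leaves a gap of 2,
        enough for the neighbouring cell to lie inside the cube.\<close>
      then have lt: "\<bar>z v + e\<bar> < M - 1" unfolding m k by presburger
      have z': "z' \<in> cells M (Suc d)" using z lt e zv v by (auto simp: z'_def cells_def)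
      have mv: "move z' v (- e) = move z v e" by (auto simp: z'_def)
      have "side z' = side z"
      proof (cases "v = d")
        case True
        then have "z d + e \<noteq> 0" using nU by simp
        then have "(z d + 2 * e < 0) = (z d < 0)" using e zd by presburger
        then show ?thesis using True by (simp add: side_def z'_def)
      qed (simp add: side_def z'_def)
      then have GG: "G (z', v, - e) = G (z, v, e)" unfolding G_def using mv by simp
      have "(z', v, -e) \<notin> U" using nU by (auto simp: U_def z'_def)
      moreover have "z' v + - e = z v + e" by (simp add: z'_def)
      moreover have "move z' v (2 * - e) = z" by (auto simp: z'_def)
      ultimately have "I t = (z', v, - e)" "I (z', v, - e) = t"
        using False False[unfolded add.commute[of "z v"]] tz by (simp_all add: I_def z'_def)
      then show ?thesis by (rule conclude) (fact z' \<open>(z', v, -e) \<notin> U\<close> GG[folded tz])+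
    qed
  qed
  also have "sum G U = (\<Sum>(y, t)\<in>cells M d \<times> {1, -1}. G (y(d := t), d, - t))"
  proof (rule sum.reindex_bij_witness[where j = "\<lambda>(z, v, e). (z(d := 0), z d)" and i = "\<lambda>(y, t). (y(d := t), d, - t)"])
    fix t assume "t \<in> U"
    moreover obtain z v e where "t = (z, v, e)" by (cases t)
    ultimately have t: "t = (z, d, e)" "z \<in> cells M (Suc d)" "e = 1 \<or> e = -1" "e = - z d"
      by (auto simp: U_def T_def)
    show "(\<lambda>(y, t). (y(d := t), d, - t)) ((\<lambda>(z, v, e). (z(d := 0), z d)) t) = t" using t by auto
    show "(\<lambda>(z, v, e). (z(d := 0), z d)) t \<in> cells M d \<times> {1, -1}"
      using t by (auto simp: cells_def)
    show "(case (\<lambda>(z, v, e). (z(d := 0), z d)) t of (y, t) \<Rightarrow> G (y(d := t), d, - t)) = G t" using t by auto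
  next
    fix yt assume "yt \<in> cells M d \<times> {1, -1::int}"
    then obtain y t where yt: "yt = (y, t)" "y \<in> cells M d" "t = 1 \<or> t = -1" by auto
    have "M > 1" using M by (metis dvd_1_left even_numeral int_one_le_iff_zero_less odd_one order_le_less zdvd1_eq)
    then show "(case yt of (y, t) \<Rightarrow> (y(d := t), d, - t)) \<in> U"
      using yt by (auto simp: U_def T_def cells_def less_Suc_eq)
    have "y d = 0" using yt by (auto simp: cells_def)
    then show "(\<lambda>(z, v, e). (z(d := 0), z d)) (case yt of (y, t) \<Rightarrow> (y(d := t), d, - t)) = yt"
      using yt by auto
  qed
  also have "\<dots> = (\<Sum>y\<in>cells M d. \<Sum>t\<in>{1, -1}. G (y(d := t), d, - t))"
    by (simp only: sum.cartesian_product)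
  also have "\<dots> = (\<Sum>y\<in>cells M d. cup s d y)"
  proof (rule sum.cong[OF refl])
    fix y assume "y \<in> cells M d"
    then have y: "move (y(d := t)) d (- t) = y" for t by (auto simp: cells_def)
    \<comment> \<open>The two cells adjacent to \<open>y\<close> lie on different sides of the
      hyperplane, so their terms differ by exactly \<open>cup s d y\<close>.\<close>
    have "x + (x + 1) = 1" for x :: bit by (cases x) simp_all
    then show "(\<Sum>t\<in>{1, -1}. G (y(d := t), d, - t)) = cup s d y"
      using y[of 1] y[of "-1"] by (simp add: G_def side_def distrib_left[symmetric])
  qed
  finally show ?thesis by simp
qed

text \<open>Peeling off all variables leaves the origin, a single cell of dimension 0 with
  \<open>cup\<close> equal to 1; so the mod 2 sum over the top cells is 1, whatever the sign
  functions are.\<close>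

lemma ex_cup_nonzero: "\<exists>z\<in>cells M n. cup s n z \<noteq> 0"
proof -
  have "(\<Sum>z\<in>cells M d. cup s d z) = 1" if "d \<le> n" for d
    using that
  proof (induction d)
    case 0
    have "cells M 0 = {\<lambda>_. 0}" by (auto simp: cells_def)
    then show ?case by simp
  qed (simp add: sum_cup_Suc)
  then show ?thesis by (metis order_refl sum.neutral zero_neq_one)
qed

end

section \<open>From sign changes on grids to a common zero of continuous functions\<close>

definition cube :: "(nat \<Rightarrow> real) set" where
  "cube = {p. (\<forall>v. \<bar>p v\<bar> \<le> 1) \<and> (\<forall>v\<ge>n. p v = 0)}"

lemma compact_cube: "compact cube"
proof -
  have "cube = PiE UNIV (\<lambda>v. if v < n then {-1..1} else {0})"
    by (auto simp: cube_def PiE_UNIV_domain abs_le_iff Pi_iff split: if_splits)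
      (metis abs_le_iff minus_le_iff abs_zero zero_le_one not_less)+
  moreover have "compactin (product_topology (\<lambda>_. euclidean) UNIV) (PiE UNIV (\<lambda>v. if v < n then {-1..1::real} else {0}))"
    by (subst compactin_PiE) auto
  ultimately show ?thesis by (simp add: euclidean_product_topology)
qed

theorem ex_common_zero:
  fixes f :: "nat \<Rightarrow> (nat \<Rightarrow> real) \<Rightarrow> real"
  assumes cont: "\<And>k. k < n \<Longrightarrow> continuous_on cube (f k)"
    and sym: "\<And>k p q. \<lbrakk>k < n; p \<in> cube; q < n; \<bar>p q\<bar> = 1\<rbrakk> \<Longrightarrow>
      f k (flip (a (blk q)) p) = (if c (blk q) k then - f k p else f k p)"
    \<comment> \<open>antisymmetric tie-break for the sign of \<open>f k\<close> at its zeros on the boundary\<close>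
    and tie: "\<And>k p q. \<lbrakk>k < n; p \<in> cube; q < n; \<bar>p q\<bar> = 1\<rbrakk> \<Longrightarrow>
      t k (flip (a (blk q)) p) \<longleftrightarrow> t k p \<noteq> c (blk q) k"
  shows "\<exists>p\<in>cube. \<forall>k<n. f k p = 0"
proof -
  \<comment> \<open>\<open>P N z\<close> is the midpoint of the cell \<open>z\<close> of the grid
    with mesh \<open>1 / (N + 1)\<close>, whence the 2 in the denominator. The bit
    \<open>s N k z\<close> is the sign of \<open>f k\<close> there; at a zero, where the sign could
    not change under the identification, \<open>t k\<close> decides instead.\<close>
  define P where "P N z = (\<lambda>v. real_of_int (z v) / (2 * real (Suc N)))" for N and z :: "nat \<Rightarrow> int"
  define s where "s N k z = (of_bool (if f k (P N z) = 0 then t k (P N z) else f k (P N z) < 0) :: bit)" for N k z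
  have "\<exists>z x y. P N z \<in> cube \<and> (\<forall>k<n. P N (x k) \<in> cube \<and> P N (y k) \<in> cube \<and> f k (P N (x k)) * f k (P N (y k)) \<le> 0 \<and>
      (\<forall>v. \<bar>P N (x k) v - P N z v\<bar> \<le> inverse (real (Suc N))) \<and> (\<forall>v. \<bar>P N (y k) v - P N z v\<bar> \<le> inverse (real (Suc N))))" for N
  proof -
    define M where "M = 2 * int (Suc N)"
    have P: "P N z \<in> cube" if "\<forall>v. \<bar>z v\<bar> \<le> M" "\<forall>v\<ge>n. z v = 0" for z
    proof -
      have "\<bar>real_of_int (z v)\<bar> \<le> 2 * real (Suc N)" for v
        using that(1)[rule_format, of v] unfolding M_def by linarith
      then show ?thesis using that by (auto simp: cube_def P_def abs_divide)
    qed
    have Pflip: "P N (flip F z) = flip F (P N z)" for F z by (auto simp: P_def flip_def)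
    have s_flip: "s N k (flip (a (blk p)) z) = s N k z + of_bool (c (blk p) k)"
      if "k < n" "\<forall>v. \<bar>z v\<bar> \<le> M" "\<forall>v\<ge>n. z v = 0" "p < n" "\<bar>z p\<bar> = M" for k z p
    proof -
      have 1: "\<bar>P N z p\<bar> = 1"
      proof -
        have "\<bar>real_of_int (z p)\<bar> = 2 * real (Suc N)" using that(5) unfolding M_def by linarith
        then show ?thesis by (simp add: P_def abs_divide)
      qed
      show ?thesis
        using sym[OF that(1) P[OF that(2,3)] that(4) 1] tie[OF that(1) P[OF that(2,3)] that(4) 1]
        unfolding s_def Pflip by (cases "f k (P N z) < 0"; cases "f k (P N z) = 0") auto
    qed
    have "even M" "M > 0" by (simp_all add: M_def)
    then have "\<exists>z\<in>cells M n. cup (s N) n z \<noteq> 0" by (rule ex_cup_nonzero) (rule s_flip)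
    then obtain z where z: "z \<in> cells M n" "cup (s N) n z \<noteq> 0" by blast
    have zM: "\<bar>z v\<bar> < M" for v using z(1) unfolding cells_def M_def by (cases "v < n") auto
    have z0: "\<forall>v\<ge>n. z v = 0" using z(1) unfolding cells_def[of M] by auto
    have ex: "\<exists>x y. (\<forall>v. x v = z v \<or> odd (z v) \<and> \<bar>x v - z v\<bar> = 1) \<and>
        (\<forall>v. y v = z v \<or> odd (z v) \<and> \<bar>y v - z v\<bar> = 1) \<and> s N k x \<noteq> s N k y" if "k < n" for k
      using cup_nonzero[OF z(2) that] by blast
    then obtain x y where xy: "\<And>k. k < n \<Longrightarrow> (\<forall>v. x k v = z v \<or> odd (z v) \<and> \<bar>x k v - z v\<bar> = 1) \<and>
        (\<forall>v. y k v = z v \<or> odd (z v) \<and> \<bar>y k v - z v\<bar> = 1) \<and> s N k (x k) \<noteq> s N k (y k)"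
      by metis
    have near: "P N x \<in> cube \<and> (\<forall>v. \<bar>P N x v - P N z v\<bar> \<le> inverse (real (Suc N)))"
      if "\<forall>v. x v = z v \<or> odd (z v) \<and> \<bar>x v - z v\<bar> = 1" for x
    proof
      show "P N x \<in> cube"
      proof (rule P)
        show "\<forall>v. \<bar>x v\<bar> \<le> M" using that zM by (smt (verit))
        show "\<forall>v\<ge>n. x v = 0" using that z0 by (metis even_zero)
      qed
      show "\<forall>v. \<bar>P N x v - P N z v\<bar> \<le> inverse (real (Suc N))"
      proof
        fix v
        have "\<bar>x v - z v\<bar> \<le> 2" using that by (smt (verit))
        then have "\<bar>real_of_int (x v) - real_of_int (z v)\<bar> \<le> 2" by linarith
        then have "\<bar>real_of_int (x v) - real_of_int (z v)\<bar> * (1 + real N) \<le> 2 * (1 + real N)"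
          by (rule mult_right_mono) simp
        then show "\<bar>P N x v - P N z v\<bar> \<le> inverse (real (Suc N))"
          by (simp add: P_def diff_divide_distrib[symmetric] abs_divide divide_simps)
      qed
    qed
    have "f k (P N (x k)) * f k (P N (y k)) \<le> 0" if "k < n" for k
    proof -
      have "s N k (x k) \<noteq> s N k (y k)" using xy that by blast
      then show ?thesis unfolding s_def
        by (auto split: if_splits simp: mult_le_0_iff of_bool_eq_iff)
    qed
    moreover have "P N z \<in> cube" using P zM z0 by (auto intro: less_imp_le)
    ultimately show ?thesis using near xy by blast
  qed
  then obtain z x y where zxy: "\<And>N. P N (z N) \<in> cube"
    "\<And>N k. k < n \<Longrightarrow> P N (x N k) \<in> cube \<and> P N (y N k) \<in> cube \<and> f k (P N (x N k)) * f k (P N (y N k)) \<le> 0 \<and>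
      (\<forall>v. \<bar>P N (x N k) v - P N (z N) v\<bar> \<le> inverse (real (Suc N))) \<and>
      (\<forall>v. \<bar>P N (y N k) v - P N (z N) v\<bar> \<le> inverse (real (Suc N)))"
    by metis
  have "seq_compact cube" using compact_cube by (simp add: compact_eq_seq_compact_metric)
  from this[unfolded seq_compact_def comp_def, rule_format, of "\<lambda>i. P i (z i)", OF zxy(1)]
  obtain p r where p: "p \<in> cube" "strict_mono r" "(\<lambda>i. P (r i) (z (r i))) \<longlonglongrightarrow> p"
    by blast
  have "f k p = 0" if k: "k < n" for k
  proof -
    have lim: "(\<lambda>i. f k (g (r i))) \<longlonglongrightarrow> f k p"
      if g: "\<And>N. g N \<in> cube" "\<And>N v. \<bar>g N v - P N (z N) v\<bar> \<le> inverse (real (Suc N))" for g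
    proof -
      have "(\<lambda>i. g (r i)) \<longlonglongrightarrow> p"
        unfolding tendsto_fun_iff
      proof
        fix v
        have "(\<lambda>i. P (r i) (z (r i)) v) \<longlonglongrightarrow> p v"
          using p(3) unfolding tendsto_fun_iff by blast
        moreover have "(\<lambda>i. g (r i) v - P (r i) (z (r i)) v) \<longlonglongrightarrow> 0"
        proof (rule Lim_null_comparison)
          show "\<forall>\<^sub>F i in sequentially. norm (g (r i) v - P (r i) (z (r i)) v) \<le> inverse (real (Suc (r i)))"
            using g(2) by simp
          show "(\<lambda>i. inverse (real (Suc (r i)))) \<longlonglongrightarrow> 0"
            using LIMSEQ_subseq_LIMSEQ[OF LIMSEQ_inverse_real_of_nat p(2)] by (simp add: comp_def)
        qed
        ultimately show "(\<lambda>i. g (r i) v) \<longlonglongrightarrow> p v"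
          using tendsto_add by fastforce
      qed
      from continuous_on_tendsto_compose[OF cont[OF k] this p(1)] show ?thesis
        using g(1) by simp
    qed
    \<comment> \<open>The two points of opposite sign have the same limit, so the nonpositive
      products converge to a square.\<close>
    have "(\<lambda>i. f k (P (r i) (x (r i) k)) * f k (P (r i) (y (r i) k))) \<longlonglongrightarrow> f k p * f k p"
      using zxy(2)[OF k] by (intro tendsto_mult lim[of "\<lambda>i. P i (x i k)"] lim[of "\<lambda>i. P i (y i k)"]) blast+
    then have "f k p * f k p \<le> 0"
      using zxy(2)[OF k] by (intro LIMSEQ_le_const2) blast+
    then show ?thesis by (metis antisym mult_eq_0_iff zero_le_square)
  qed
  then show ?thesis using p(1) by blast
qed

end

subsection \<open>Zeros of equivariant families over a product of spheres\<close>

text \<open>The base is the product over \<open>j\<close> of the unit spheres of complex \<open>(j + 1)\<close>-space.\<close>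

definition coord :: "(nat \<Rightarrow> real) \<Rightarrow> nat \<Rightarrow> nat \<Rightarrow> complex" where
  "coord x j i = Complex (x (prod_encode (j, 2 * i))) (x (prod_encode (j, 2 * i + 1)))"

definition base :: "(nat \<Rightarrow> real) set" where
  "base = {x. \<forall>j. (\<Sum>i\<le>j. (cmod (coord x j i))\<^sup>2) = 1}"

definition antipode :: "nat \<Rightarrow> (nat \<Rightarrow> real) \<Rightarrow> nat \<Rightarrow> real" where
  "antipode j = flip (\<lambda>m. fst (prod_decode m) = j)"

definition sg :: "nat \<Rightarrow> nat \<Rightarrow> complex" where
  "sg m j = (if j = m then - 1 else 1)"

lemma sg_sq: "sg m j * sg m j = 1" "sg m j * (sg m j * w) = w"
  by (simp_all add: sg_def)

text \<open>Block \<open>j\<close> is the interval from \<open>j * (j - 1)\<close> up to, but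
  excluding, \<open>j * (j + 1)\<close>. It has length \<open>2 * j\<close>, and block 0 is
  empty.\<close>

definition blk :: "nat \<Rightarrow> nat" where
  "blk v = (LEAST j. v < j * (j + 1))"

lemma blk_bounds: "blk v * (blk v - 1) \<le> v \<and> v < blk v * (blk v + 1)"
proof
  have "v < Suc v * (Suc v + 1)" by simp
  then show "v < blk v * (blk v + 1)" unfolding blk_def by (rule LeastI)
  show "blk v * (blk v - 1) \<le> v"
  proof (rule ccontr)
    assume "\<not> ?thesis"
    then have "v < (blk v - 1) * (blk v - 1 + 1)" "blk v \<noteq> 0" by (auto simp: mult.commute)
    moreover have "blk v \<le> k" if "v < k * (k + 1)" for k
      unfolding blk_def using that by (rule Least_le)
    ultimately have "blk v \<le> blk v - 1" by blast
    then show False using \<open>blk v \<noteq> 0\<close> by simp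
  qed
qed

lemma blk_eq: "q < 2 * j \<Longrightarrow> blk (j * (j - 1) + q) = j"
proof (unfold blk_def, rule Least_equality)
  assume q: "q < 2 * j"
  then obtain i where i: "j = Suc i" by (cases j) auto
  show "j * (j - 1) + q < j * (j + 1)" using q by (simp add: i)
  fix k assume "j * (j - 1) + q < k * (k + 1)"
  then have "i * (i + 1) < k * (k + 1)" by (simp add: i)
  then have "i < k" by (metis add_le_mono1 mult_le_mono not_le)
  then show "j \<le> k" by (simp add: i)
qed

lemma blk_mono: "u \<le> v \<Longrightarrow> blk u \<le> blk v"
  unfolding blk_def[of u] using blk_bounds[of v] by (intro Least_le) linarith

lemma blk_le: "v < J * (J + 1) \<Longrightarrow> blk v \<le> J"
  unfolding blk_def by (rule Least_le)

lemma sum_pairs: "(\<Sum>i<m. g (2 * i) + g (2 * i + 1)) = (\<Sum>q<2 * m. g q)" for g :: "nat \<Rightarrow> 'a::comm_monoid_add"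
  by (induction m) (simp_all add: add.assoc)

text \<open>
  A point of the cube of dimension \<open>J (J + 1)\<close> describes a point of the base, the first \<open>2 j\<close> coordinates
  of the \<open>j\<close>-th sphere being read off from block \<open>j < J\<close>, and, in block \<open>J\<close>, the real and imaginary parts of
  coefficients of \<open>J\<close> line bundles and one trivial real line. The last, positive coordinate of a sphere is a product which
  vanishes on the boundary of its block, so that opposite boundary points are antipodal. The function
  numbered \<open>v\<close> is a component in the bundle \<open>out_block v\<close>.
\<close>

context
  fixes J :: nat
begin

definition out_block where "out_block v = (if blk v < J then blk v else (v - J * (J - 1)) div 2)"
text \<open>An index \<open>b < J\<close> stands for the antipodal map of sphere \<open>b\<close>,
  which negates the functions with values in P_b; \<open>b = J\<close> stands for multiplying all
  coefficients by -1, which negates every function, by linearity.\<close>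

definition negates where "negates b v \<longleftrightarrow> b = J \<or> b = out_block v"
text \<open>The coordinates of block \<open>J\<close> are coefficients of twisted line bundles,
  hence they are also negated together with the sphere of their bundle.\<close>

definition flips where "flips b v \<longleftrightarrow> (if blk v < J then b = blk v else negates b v)"

lemma out_block_less: "v < J * (J + 1) \<Longrightarrow> out_block v < J"
proof (cases "blk v < J")
  case False
  assume "v < J * (J + 1)"
  with False have "blk v = J" using blk_le[of v J] by linarith
  then have "v < J * (J + 1)" "J * (J - 1) \<le> v" using blk_bounds[of v] by auto
  moreover have "J * (J + 1) = J * (J - 1) + 2 * J" by (cases J) auto
  ultimately show ?thesis using False unfolding out_block_def by simp
qed (simp add: out_block_def)

interpretation cube_identification "J * (J + 1)" blk flips negates
proof
  fix p k :: nat
  assume "p < J * (J + 1)"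
  then show "flips (blk p) p" using blk_le[of p J] by (auto simp: flips_def negates_def)
next
  fix p k :: nat
  assume "p \<le> k" "k < J * (J + 1)"
  \<comment> \<open>The two rules differ only for \<open>blk p = J\<close> and
    \<open>blk k < J\<close>. Numbering the coefficients after the spheres excludes this
    case.\<close>
  then have "blk p \<le> blk k" "blk k \<le> J" using blk_mono blk_le by auto
  then show "flips (blk p) k = negates (blk p) k" by (auto simp: flips_def negates_def out_block_def)
qed

definition cube_coord :: "(nat \<Rightarrow> real) \<Rightarrow> nat \<Rightarrow> nat \<Rightarrow> real" where
  "cube_coord p j q = (if j < J then p (j * (j - 1) + q) else 0)"
text \<open>The value 0 beyond \<open>q = 2 * j\<close> confines the point to a sphere of real
  dimension \<open>2 * j\<close>, on which \<open>j\<close> copies of the bundle are already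
  obstructed. For \<open>j \<ge> J\<close> all cube coordinates are 0 and the point is
  constant.\<close>

definition raw_coord :: "(nat \<Rightarrow> real) \<Rightarrow> nat \<Rightarrow> nat \<Rightarrow> real" where
  "raw_coord p j q = (if q < 2 * j then cube_coord p j q else if q = 2 * j then \<Prod>q<2 * j. 1 - (cube_coord p j q)\<^sup>2 else 0)"
definition raw_norm :: "(nat \<Rightarrow> real) \<Rightarrow> nat \<Rightarrow> real" where
  "raw_norm p j = (\<Sum>q<2 * Suc j. (raw_coord p j q)\<^sup>2)"
definition base_point :: "(nat \<Rightarrow> real) \<Rightarrow> nat \<Rightarrow> real" where
  "base_point p m = (case prod_decode m of (j, q) \<Rightarrow> raw_coord p j q / sqrt (raw_norm p j))"
definition fibre_coeff :: "(nat \<Rightarrow> real) \<Rightarrow> nat \<Rightarrow> complex" where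
  "fibre_coeff p k = Complex (p (J * (J - 1) + 2 * k)) (p (J * (J - 1) + 2 * k + 1))"
definition trivial_coeff :: "(nat \<Rightarrow> real) \<Rightarrow> real" where
  "trivial_coeff p = (\<Prod>q<2 * J. 1 - (p (J * (J - 1) + q))\<^sup>2)"

lemma raw_norm_pos: "raw_norm p j > 0"
proof -
  have "raw_norm p j \<noteq> 0"
  proof
    assume "raw_norm p j = 0"
    then have 0: "raw_coord p j q = 0" if "q < 2 * Suc j" for q
      using that unfolding raw_norm_def by (subst (asm) sum_nonneg_eq_0_iff) auto
    have "cube_coord p j q = 0" if "q < 2 * j" for q using 0[of q] that by (simp add: raw_coord_def)
    then have "raw_coord p j (2 * j) = 1" by (simp add: raw_coord_def)
    then show False using 0[of "2 * j"] by simp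
  qed
  moreover have "raw_norm p j \<ge> 0" unfolding raw_norm_def by (rule sum_nonneg) simp
  ultimately show ?thesis by simp
qed

lemma base_point_base: "base_point p \<in> base"
proof -
  have "(\<Sum>i\<le>j. (cmod (coord (base_point p) j i))\<^sup>2) = 1" for j
  proof -
    have "(cmod (coord (base_point p) j i))\<^sup>2 = (raw_coord p j (2 * i))\<^sup>2 / raw_norm p j + (raw_coord p j (2 * i + 1))\<^sup>2 / raw_norm p j" for i
      using raw_norm_pos[of p j] by (simp add: coord_def base_point_def cmod_power2 power_divide)
    then have "(\<Sum>i\<le>j. (cmod (coord (base_point p) j i))\<^sup>2) = (\<Sum>i<Suc j. (raw_coord p j (2 * i))\<^sup>2 / raw_norm p j + (raw_coord p j (2 * i + 1))\<^sup>2 / raw_norm p j)"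
      by (simp add: lessThan_Suc_atMost)
    also have "\<dots> = (\<Sum>q<2 * Suc j. (raw_coord p j q)\<^sup>2 / raw_norm p j)" by (rule sum_pairs)
    also have "\<dots> = raw_norm p j / raw_norm p j" unfolding raw_norm_def by (rule sum_divide_distrib[symmetric])
    also have "\<dots> = 1" using raw_norm_pos[of p j] by simp
    finally show ?thesis .
  qed
  then show ?thesis by (simp add: base_def)
qed

lemma cont_coordinate [continuous_intros]: "continuous_on S (\<lambda>p::nat \<Rightarrow> real. p v)"
  by (rule continuous_on_subset[OF continuous_on_product_coordinates]) simp

lemma cont_raw_coord: "continuous_on S (\<lambda>p. raw_coord p j q)"
proof -
  have "continuous_on S (\<lambda>p. cube_coord p j q)" for q
    unfolding cube_coord_def by (cases "j < J") (auto intro!: continuous_intros)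
  then show ?thesis
    unfolding raw_coord_def by (cases "q < 2 * j"; cases "q = 2 * j") (auto intro!: continuous_intros)
qed

lemma cont_base_point: "continuous_on S base_point"
proof (rule continuous_on_coordinatewise_then_product)
  fix m
  obtain j q where "prod_decode m = (j, q)" by (cases "prod_decode m")
  moreover have "sqrt (raw_norm p j) \<noteq> 0" for p using raw_norm_pos[of p j] by simp
  moreover have "continuous_on S (\<lambda>p. raw_norm p j)"
    unfolding raw_norm_def by (intro continuous_intros cont_raw_coord)
  ultimately show "continuous_on S (\<lambda>p. base_point p m)"
    by (auto simp: base_point_def intro!: continuous_intros cont_raw_coord)
qed

lemma flip_lt:
  assumes b: "b < J" "v < J * (J + 1)" "blk v = b" "\<bar>p v\<bar> = 1"
  shows "base_point (flip (flips b) p) = antipode b (base_point p)" "k < J \<Longrightarrow> fibre_coeff (flip (flips b) p) k = sg b k * fibre_coeff p k"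
    "trivial_coeff (flip (flips b) p) = trivial_coeff p"
proof -
  let ?p = "flip (flips b) p"
  have cube_coord: "cube_coord ?p j q = (if j = b then - cube_coord p j q else cube_coord p j q)" if "q < 2 * j" for j q
    using that b(1) blk_eq[of q j] by (auto simp: cube_coord_def flip_def flips_def)
  have cube_coord2: "(cube_coord ?p j q)\<^sup>2 = (cube_coord p j q)\<^sup>2" if "q < 2 * j" for j q
    using cube_coord[OF that] by simp
  have "(\<Prod>q<2 * b. 1 - (cube_coord p b q)\<^sup>2) = 0"
  proof -
    let ?q = "v - b * (b - 1)"
    have bv: "b * (b - 1) \<le> v" "v < b * (b + 1)" using blk_bounds[of v] b(3) by auto
    moreover have "b * (b + 1) = b * (b - 1) + 2 * b" by (cases b) auto
    ultimately have "?q < 2 * b" "cube_coord p b ?q = p v" using b(1) by (auto simp: cube_coord_def)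
    moreover have "(p v)\<^sup>2 = 1" using b(4) by (metis power2_abs one_power2)
    ultimately show ?thesis by (intro prod_zero) (auto intro!: bexI[of _ ?q])
  qed
  then have raw_coord: "raw_coord ?p j q = (if j = b then - raw_coord p j q else raw_coord p j q)" for j q
    using cube_coord[of q j] cube_coord2[of _ j] by (auto simp: raw_coord_def)
  then have "raw_norm ?p j = raw_norm p j" for j by (simp add: raw_norm_def)
  then show "base_point ?p = antipode b (base_point p)"
    using raw_coord by (auto simp: base_point_def antipode_def flip_def split: prod.splits)
  have aJ: "flips b (J * (J - 1) + q) \<longleftrightarrow> q div 2 = b" if "q < 2 * J" for q
    using b(1) blk_eq[OF that] by (auto simp: flips_def negates_def out_block_def)
  show "fibre_coeff ?p k = sg b k * fibre_coeff p k" if "k < J"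
    using that aJ[of "2 * k"] aJ[of "2 * k + 1"]
    by (auto simp: fibre_coeff_def flip_def sg_def complex_eq_iff)
  show "trivial_coeff ?p = trivial_coeff p" unfolding trivial_coeff_def flip_def by (intro prod.cong) auto
qed

text \<open>The boundary of block \<open>J\<close> is the equator of the sphere of coefficients: the
  trivial coefficient vanishes there, so negating the other ones negates the whole vector.\<close>

lemma flip_eq:
  assumes b: "v < J * (J + 1)" "blk v = J" "\<bar>p v\<bar> = 1"
  shows "base_point (flip (flips J) p) = base_point p" "k < J \<Longrightarrow> fibre_coeff (flip (flips J) p) k = - fibre_coeff p k"
    "trivial_coeff (flip (flips J) p) = 0" "trivial_coeff p = 0"
proof -
  let ?p = "flip (flips J) p"
  have "cube_coord ?p j q = cube_coord p j q" if "q < 2 * j" for j q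
    using that blk_eq[of q j] by (auto simp: cube_coord_def flip_def flips_def)
  then have raw_coord: "raw_coord ?p j q = raw_coord p j q" for j q by (auto simp: raw_coord_def)
  then have "raw_norm ?p j = raw_norm p j" for j by (simp add: raw_norm_def)
  then show "base_point ?p = base_point p" using raw_coord by (auto simp: base_point_def split: prod.splits)
  have aJ: "flips J (J * (J - 1) + q)" if "q < 2 * J" for q
    using blk_eq[OF that] by (auto simp: flips_def negates_def)
  show "fibre_coeff ?p k = - fibre_coeff p k" if "k < J"
    using that aJ[of "2 * k"] aJ[of "2 * k + 1"] by (auto simp: fibre_coeff_def flip_def complex_eq_iff)
  have "\<exists>q<2 * J. (p (J * (J - 1) + q))\<^sup>2 = 1"
  proof -
    have bv: "J * (J - 1) \<le> v" "v < J * (J + 1)" using blk_bounds[of v] b(2) by auto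
    moreover have "J * (J + 1) = J * (J - 1) + 2 * J" by (cases J) auto
    moreover have "(p v)\<^sup>2 = 1" using b(3) by (metis power2_abs one_power2)
    ultimately show ?thesis by (intro exI[of _ "v - J * (J - 1)"]) auto
  qed
  then show "trivial_coeff p = 0" unfolding trivial_coeff_def by (intro prod_zero) auto
  moreover have "trivial_coeff ?p = trivial_coeff p" unfolding trivial_coeff_def flip_def by (intro prod.cong) auto
  ultimately show "trivial_coeff ?p = 0" by simp
qed

text \<open>
  The tie-break for a function of block \<open>j\<close> is the parity of the signs of the first extreme
  coordinates on the faces of blocks \<open>j\<close>, \<open>J\<close> and of the block acting on the latter coordinate.
\<close>

definition onface where "onface p b \<longleftrightarrow> (\<exists>v<J * (J + 1). blk v = b \<and> \<bar>p v\<bar> = (1::real))"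
definition extremal where "extremal p b = (LEAST v. v < J * (J + 1) \<and> blk v = b \<and> \<bar>p v\<bar> = (1::real))"
definition face_neg where "face_neg p b \<longleftrightarrow> onface p b \<and> p (extremal p b) < 0"
definition tie where "tie v p \<longleftrightarrow> face_neg p (out_block v) \<noteq> (face_neg p J \<noteq> (onface p J \<and> face_neg p (out_block (extremal p J))))"

lemma extremal: "onface p b \<Longrightarrow> extremal p b < J * (J + 1) \<and> blk (extremal p b) = b \<and> \<bar>p (extremal p b)\<bar> = 1"
  unfolding onface_def extremal_def by (rule LeastI_ex) auto

lemma onface_flip: "onface (flip F p) b = onface p b" and extremal_flip: "extremal (flip F p) b = extremal p b"
proof -
  have "\<bar>flip F p v\<bar> = \<bar>p v\<bar>" for v by (simp add: flip_def)
  then show "onface (flip F p) b = onface p b" "extremal (flip F p) b = extremal p b"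
    by (simp_all add: onface_def extremal_def)
qed

lemma face_neg_flip: "face_neg (flip F p) b \<longleftrightarrow> (face_neg p b \<noteq> (onface p b \<and> F (extremal p b)))"
  using extremal[of p b] unfolding face_neg_def onface_flip extremal_flip by (auto simp: flip_def)

text \<open>For \<open>b < J\<close> the flip on a face of block \<open>b\<close> changes
  \<open>face_neg\<close> at \<open>b\<close>. It also changes \<open>face_neg\<close> at
  \<open>J\<close> if \<open>b\<close> acts on the extremal coordinate of block \<open>J\<close>;
  the third term of \<open>tie\<close> then changes too and undoes this. For \<open>b = J\<close>
  only \<open>face_neg\<close> at \<open>J\<close> changes, as it should for every function.\<close>

lemma tie_flip:
  assumes v: "v < J * (J + 1)" and q: "q < J * (J + 1)" "\<bar>p q\<bar> = 1"
  shows "tie v (flip (flips (blk q)) p) \<longleftrightarrow> tie v p \<noteq> negates (blk q) v"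
proof -
  have on: "onface p (blk q)" using q by (auto simp: onface_def)
  have ov: "out_block v < J" by (rule out_block_less[OF v])
  have lt: "onface p b \<and> flips c (extremal p b) \<longleftrightarrow> onface p b \<and> c = b" if "b < J" for b c
    using extremal[of p b] that by (auto simp: flips_def)
  have oi: "out_block (extremal p J) < J" if "onface p J" using extremal[OF that] out_block_less by blast
  have eJ: "onface p J \<and> flips c (extremal p J) \<longleftrightarrow> onface p J \<and> (c = J \<or> c = out_block (extremal p J))" for c
    using extremal[of p J] by (auto simp: flips_def negates_def)
  show ?thesis
    unfolding tie_def face_neg_flip onface_flip extremal_flip lt[OF ov] eJ negates_def
    using on ov oi lt[of "out_block (extremal p J)" "blk q"] by (cases "onface p J"; cases "blk q = J") auto
qed

text \<open>A theorem of Borsuk-Ulam type. \<open>A k j i\<close> describes a map from P_k to copy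
  \<open>i\<close> of P_j and \<open>B j i\<close> one from the trivial real line. The combined
  bundle map has as target the sum of the first \<open>J\<close> blocks and fails to be injective at
  some point.\<close>

theorem equivariant_zero:
  fixes A :: "nat \<Rightarrow> nat \<Rightarrow> nat \<Rightarrow> (nat \<Rightarrow> real) \<Rightarrow> complex" and B :: "nat \<Rightarrow> nat \<Rightarrow> (nat \<Rightarrow> real) \<Rightarrow> complex"
  assumes contA: "\<And>k j i. continuous_on base (A k j i)" and contB: "\<And>j i. continuous_on base (B j i)"
    and symA: "\<And>m k j i x. x \<in> base \<Longrightarrow> A k j i (antipode m x) = sg m k * sg m j * A k j i x"
    and symB: "\<And>m j i x. x \<in> base \<Longrightarrow> B j i (antipode m x) = sg m j * B j i x"
  shows "\<exists>x\<in>base. \<exists>\<xi> l. (l \<noteq> 0 \<or> (\<exists>k<J. \<xi> k \<noteq> 0)) \<and>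
    (\<forall>j<J. \<forall>i\<le>j. (\<Sum>k<J. \<xi> k * A k j i x) + complex_of_real l * B j i x = 0)"
proof -
  define F where "F p j i = (\<Sum>k<J. fibre_coeff p k * A k j i (base_point p)) + complex_of_real (trivial_coeff p) * B j i (base_point p)" for p j i
  \<comment> \<open>Functions of block \<open>j < J\<close> are the components 1 to \<open>j\<close>
    of target block \<open>j\<close>; the component 0 of every target block is left to block
    \<open>J\<close>. With real and imaginary parts told apart by \<open>par\<close>, all components
    are covered once.\<close>
  define idx where "idx v = (if blk v < J then (v - blk v * (blk v - 1)) div 2 + 1 else 0)" for v
  define par where "par v = (if blk v < J then v - blk v * (blk v - 1) else v - J * (J - 1)) mod 2" for v
  define f where "f v p = (if par v = 0 then Re (F p (out_block v) (idx v)) else Im (F p (out_block v) (idx v)))" for v p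
  have contF: "continuous_on S (\<lambda>p. F p j i)" for S j i
  proof -
    have "continuous_on S (\<lambda>p. A k j i (base_point p))" "continuous_on S (\<lambda>p. B j i (base_point p))" for k
      by (rule continuous_on_compose2[OF contA cont_base_point] continuous_on_compose2[OF contB cont_base_point]; use base_point_base in blast)+
    moreover have "continuous_on S (\<lambda>p. fibre_coeff p k)" for k
      unfolding fibre_coeff_def by (auto intro!: continuous_intros simp: continuous_on_Complex)
    ultimately show ?thesis unfolding F_def trivial_coeff_def by (intro continuous_intros)
  qed
  have F_flip: "F (flip (flips (blk q)) p) j i = (if blk q = J \<or> blk q = j then - F p j i else F p j i)"
    if "q < J * (J + 1)" "\<bar>p q\<bar> = 1" for p q j i
  proof (cases "blk q = J")
    case True
    then show ?thesis using flip_eq[of q p] that by (simp add: F_def sum_negf)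
  next
    case False
    then have b: "blk q < J" using blk_le[OF that(1)] by simp
    have "F (flip (flips (blk q)) p) j i = sg (blk q) j * F p j i"
      unfolding F_def
      by (simp add: flip_lt[where b = "blk q" and v = q and p = p, OF b that(1) refl that(2)] symA symB base_point_base sum_distrib_left distrib_left sg_sq mult_ac)
    then show ?thesis using False by (auto simp: sg_def)
  qed
  have "\<exists>p\<in>cube. \<forall>v<J * (J + 1). f v p = 0"
  proof (rule ex_common_zero[where t = tie])
    show "continuous_on cube (f v)" for v
      unfolding f_def by (cases "par v = 0") (auto intro!: continuous_intros contF)
    show "f k (flip (flips (blk q)) p) = (if negates (blk q) k then - f k p else f k p)"
      if "k < J * (J + 1)" "p \<in> cube" "q < J * (J + 1)" "\<bar>p q\<bar> = 1" for k p q
      unfolding f_def F_flip[where q = q and p = p, OF that(3,4)] negates_def by auto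
    show "tie k (flip (flips (blk q)) p) \<longleftrightarrow> tie k p \<noteq> negates (blk q) k"
      if "k < J * (J + 1)" "p \<in> cube" "q < J * (J + 1)" "\<bar>p q\<bar> = 1" for k p q
      by (rule tie_flip) (use that in auto)
  qed
  then obtain p where p: "\<And>v. v < J * (J + 1) \<Longrightarrow> f v p = 0" by blast
  have JJ: "j * (j + 1) = j * (j - 1) + 2 * j" for j :: nat by (cases j) auto
  have F0: "F p j i = 0" if ji: "j < J" "i \<le> j" for j i
  proof (cases i)
    case 0
    have "f (J * (J - 1) + (2 * j + e)) p = (if e = 0 then Re (F p j 0) else Im (F p j 0))"
      and "J * (J - 1) + (2 * j + e) < J * (J + 1)" if "e < 2" for e
    proof -
      have "blk (J * (J - 1) + (2 * j + e)) = J" using that ji by (intro blk_eq) auto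
      then show "f (J * (J - 1) + (2 * j + e)) p = (if e = 0 then Re (F p j 0) else Im (F p j 0))"
        using that by (auto simp: f_def idx_def par_def out_block_def)
      show "J * (J - 1) + (2 * j + e) < J * (J + 1)" unfolding JJ[of J] using that ji by linarith
    qed
    from this[of 0] this[of 1] show ?thesis using p 0 by (auto simp: complex_eq_iff)
  next
    case (Suc i')
    have "f (j * (j - 1) + (2 * i' + e)) p = (if e = 0 then Re (F p j i) else Im (F p j i))"
      and "j * (j - 1) + (2 * i' + e) < J * (J + 1)" if "e < 2" for e
    proof -
      have e: "2 * i' + e < 2 * j" using that ji Suc by linarith
      then have "blk (j * (j - 1) + (2 * i' + e)) = j" by (rule blk_eq)
      then show "f (j * (j - 1) + (2 * i' + e)) p = (if e = 0 then Re (F p j i) else Im (F p j i))"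
        using that ji Suc by (auto simp: f_def idx_def par_def out_block_def)
      have "j * (j + 1) \<le> J * (J + 1)" using ji by (intro mult_le_mono) auto
      then show "j * (j - 1) + (2 * i' + e) < J * (J + 1)" using e JJ[of j] by linarith
    qed
    from this[of 0] this[of 1] show ?thesis using p by (auto simp: complex_eq_iff)
  qed
  have "trivial_coeff p \<noteq> 0 \<or> (\<exists>k<J. fibre_coeff p k \<noteq> 0)"
  proof (rule ccontr)
    assume "\<not> ?thesis"
    then have trivial_coeff: "trivial_coeff p = 0" and fibre_coeff: "\<And>k. k < J \<Longrightarrow> fibre_coeff p k = 0" by auto
    have "p (J * (J - 1) + q) = 0" if "q < 2 * J" for q
    proof -
      have "q div 2 < J" and q: "q = 2 * (q div 2) \<or> q = 2 * (q div 2) + 1" using that by presburger+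
      then have "p (J * (J - 1) + 2 * (q div 2)) = 0" "p (J * (J - 1) + (2 * (q div 2) + 1)) = 0"
        using fibre_coeff[of "q div 2"] by (simp_all add: fibre_coeff_def complex_eq_iff)
      then show ?thesis using q by metis
    qed
    then show False using trivial_coeff by (simp add: trivial_coeff_def)
  qed
  then show ?thesis using F0 base_point_base[of p] unfolding F_def by blast
qed

end

subsection \<open>The algebra\<close>

text \<open>
  A vector is a family indexed by all pairs of a point \<open>x\<close> of the base, taken as a discrete set, and a basis vector
  \<open>(j, i)\<close>, \<open>i \<le> j\<close>, of the fibre; \<open>idx j i x\<close> encodes such a pair as a single sequence.
\<close>

definition idx :: "nat \<Rightarrow> nat \<Rightarrow> (nat \<Rightarrow> real) \<Rightarrow> nat \<Rightarrow> real" where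
  "idx j i x = case_nat (real (prod_encode (j, i))) x"

definition lev :: "(nat \<Rightarrow> real) \<Rightarrow> nat" where "lev u = fst (prod_decode (nat \<lfloor>u 0\<rfloor>))"
definition pos :: "(nat \<Rightarrow> real) \<Rightarrow> nat" where "pos u = snd (prod_decode (nat \<lfloor>u 0\<rfloor>))"
definition pt :: "(nat \<Rightarrow> real) \<Rightarrow> nat \<Rightarrow> real" where "pt u = (\<lambda>n. u (Suc n))"

lemma idx_simps [simp]: "lev (idx j i x) = j" "pos (idx j i x) = i" "pt (idx j i x) = x"
  by (simp_all add: lev_def pos_def pt_def idx_def)

lemma idx_eq_iff [simp]: "idx j i x = idx j' i' x' \<longleftrightarrow> j = j' \<and> i = i' \<and> x = x'"
  by (metis idx_simps)

text \<open>The index type also contains sequences that encode no pair of a base point and a fibre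
  basis vector; the rows and columns of core operators at such indices are 0.\<close>

definition valid :: "(nat \<Rightarrow> real) \<Rightarrow> bool" where
  "valid u \<longleftrightarrow> (\<exists>x\<in>base. \<exists>j i. i \<le> j \<and> u = idx j i x)"

lemma valid_idx [simp]: "valid (idx j i x) \<longleftrightarrow> x \<in> base \<and> i \<le> j"
  by (auto simp: valid_def)

lemma valid_eq: "valid u \<Longrightarrow> u = idx (lev u) (pos u) (pt u)"
  by (auto simp: valid_def)

lemma coord_antipode: "coord (antipode m x) j i = sg m j * coord x j i"
  by (auto simp: coord_def antipode_def flip_def sg_def complex_eq_iff)

lemma antipode_base: "x \<in> base \<Longrightarrow> antipode m x \<in> base"
  by (simp add: base_def coord_antipode norm_mult sg_def)

lemma cont_coord: "continuous_on S (\<lambda>x. coord x j i)"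
  unfolding coord_def
  by (intro continuous_on_Complex continuous_on_subset[OF continuous_on_product_coordinates] subset_UNIV)

lemma coord_le_1: "x \<in> base \<Longrightarrow> i \<le> j \<Longrightarrow> cmod (coord x j i) \<le> 1"
proof -
  assume x: "x \<in> base" "i \<le> j"
  have "(cmod (coord x j i))\<^sup>2 \<le> (\<Sum>i\<le>j. (cmod (coord x j i))\<^sup>2)"
    by (rule member_le_sum) (use x in auto)
  then show ?thesis using x by (simp add: base_def abs_square_le_1)
qed

definition block_diag :: "nat \<Rightarrow> (nat \<Rightarrow> real) op \<Rightarrow> bool" where
  "block_diag J T \<longleftrightarrow> (\<forall>u v. melem T u v \<noteq> 0 \<longrightarrow> (\<exists>x\<in>base. \<exists>j i j' i'.
    u = idx j i x \<and> v = idx j' i' x \<and> i \<le> j \<and> i' \<le> j' \<and> (j = j' \<or> j < J \<and> j' < J)))"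

definition core :: "(nat \<Rightarrow> real) op set" where
  "core = {T \<in> bounded_ops. (\<exists>J. block_diag J T) \<and>
    (\<forall>j i j' i'. continuous_on base (\<lambda>x. melem T (idx j i x) (idx j' i' x))) \<and>
    (\<forall>m j i j' i'. \<forall>x\<in>base. melem T (idx j i (antipode m x)) (idx j' i' (antipode m x)) =
      sg m j * sg m j' * melem T (idx j i x) (idx j' i' x))}"

lemma block_diag_mono: "block_diag J T \<Longrightarrow> J \<le> J' \<Longrightarrow> block_diag J' T"
  unfolding block_diag_def by (meson order_less_le_trans)

lemma core_bounded: "T \<in> core \<Longrightarrow> T \<in> bounded_ops" by (simp add: core_def)

lemma core_zero: "0 \<in> core"
  by (auto simp: core_def block_diag_def melem_zero bounded_ops_zero)

lemma core_add:
  assumes "S \<in> core" "T \<in> core"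
  shows "S + T \<in> core"
proof -
  obtain J1 J2 where "block_diag J1 S" "block_diag J2 T" using assms by (auto simp: core_def)
  then have "block_diag (max J1 J2) S" "block_diag (max J1 J2) T" by (auto intro: block_diag_mono)
  then have "block_diag (max J1 J2) (S + T)" unfolding block_diag_def melem_add by (metis add.right_neutral)
  then show ?thesis using assms
    by (auto simp: core_def melem_add bounded_ops_add distrib_left intro!: continuous_on_add)
qed

lemma core_sum: "(\<And>a. a \<in> F \<Longrightarrow> f a \<in> core) \<Longrightarrow> sum f F \<in> core"
  by (induction F rule: infinite_finite_induct) (auto simp: core_zero core_add)

lemma core_scaleC:
  assumes T: "T \<in> core"
  shows "scaleC_op c T \<in> core"
proof -
  obtain J where "block_diag J T" using T by (auto simp: core_def)
  then have "block_diag J (scaleC_op c T)" unfolding block_diag_def melem_scaleC mult_eq_0_iff by blast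
  then show ?thesis using T
    by (auto simp: core_def melem_scaleC bounded_ops_scaleC mult.left_commute intro!: continuous_on_mult_left)
qed

lemma core_adj: "T \<in> core \<Longrightarrow> adj T \<in> core"
proof -
  assume T: "T \<in> core"
  then obtain J where J: "block_diag J T" by (auto simp: core_def)
  have "block_diag J (adj T)"
    unfolding block_diag_def melem_adj[OF core_bounded[OF T]]
    using J unfolding block_diag_def by (metis complex_cnj_zero_iff)
  moreover have "cnj (sg m j) = sg m j" for m j by (simp add: sg_def)
  ultimately show ?thesis using T
    by (auto simp: core_def melem_adj adj_bounded mult_ac intro!: continuous_on_cnj)
qed

text \<open>A column in block \<open>j''\<close> meets only block \<open>j''\<close> and blocks
  below \<open>J\<close>, over the same point. So products have finite entry formulas with a range
  independent of \<open>x\<close>, from which continuity and equivariance of the entries follow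
  termwise.\<close>

lemma melem_comp_block:
  assumes S: "S \<in> bounded_ops" and T: "block_diag J T"
  shows "melem (S o\<^sub>L T) u (idx j'' i'' x) =
    (\<Sum>(j', i')\<in>(SIGMA j':{..max J j''}. {..j'}). melem S u (idx j' i' x) * melem T (idx j' i' x) (idx j'' i'' x))"
proof -
  define P where "P = (SIGMA j':{..max J j''}. {..j'})"
  define F where "F = (\<lambda>(j', i'). idx j' i' x) ` P"
  have inj: "inj_on (\<lambda>(j', i'). idx j' i' x) P" by (auto simp: inj_on_def)
  have "finite F" by (simp add: F_def P_def)
  moreover have "melem T v (idx j'' i'' x) = 0" if "v \<notin> F" for v
  proof (rule ccontr)
    assume "\<not> ?thesis"
    then obtain y j i j' i' where "v = idx j i y" "idx j'' i'' x = idx j' i' y" "i \<le> j" "j = j' \<or> j < J \<and> j' < J"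
      using T unfolding block_diag_def by meson
    then have "v \<in> F" by (force simp: F_def P_def)
    then show False using that by blast
  qed
  ultimately have "melem (S o\<^sub>L T) u (idx j'' i'' x) = (\<Sum>v\<in>F. melem S u v * melem T v (idx j'' i'' x))"
    by (rule melem_comp[OF S])
  also have "\<dots> = (\<Sum>(j', i')\<in>P. melem S u (idx j' i' x) * melem T (idx j' i' x) (idx j'' i'' x))"
    unfolding F_def by (subst sum.reindex[OF inj]) (simp add: case_prod_unfold)
  finally show ?thesis by (simp add: P_def)
qed

lemma sg_cancel: "(p * sg m j * s) * (sg m j * r * t) = p * r * (s * t)"
proof -
  have "(p * sg m j * s) * (sg m j * r * t) = (sg m j * sg m j) * (p * r * (s * t))" by (simp only: mult_ac)
  then show ?thesis by (simp add: sg_sq)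
qed

lemma core_comp:
  assumes S: "S \<in> core" and T: "T \<in> core"
  shows "S o\<^sub>L T \<in> core"
proof -
  obtain J1 J2 where "block_diag J1 S" "block_diag J2 T" using assms by (auto simp: core_def)
  define J where "J = max J1 J2"
  have JS: "block_diag J S" and JT: "block_diag J T"
    using \<open>block_diag J1 S\<close> \<open>block_diag J2 T\<close> by (auto intro: block_diag_mono simp: J_def)
  note bS = core_bounded[OF S] and bT = core_bounded[OF T]
  note comp = melem_comp_block[OF bS JT]
  have "block_diag J (S o\<^sub>L T)"
    unfolding block_diag_def
  proof (intro allI impI)
    fix u w assume nz: "melem (S o\<^sub>L T) u w \<noteq> 0"
    have "T (ket w) \<noteq> 0"
      using nz by (auto simp: melem_def)
    then obtain v0 where "melem T v0 w \<noteq> 0" by (metis coord_zero ell2_eqI melem_def)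
    then obtain x j'' i'' where w: "w = idx j'' i'' x" using JT unfolding block_diag_def by meson
    obtain q where "(case q of (j', i') \<Rightarrow> melem S u (idx j' i' x) * melem T (idx j' i' x) (idx j'' i'' x)) \<noteq> 0"
      using nz[unfolded w comp] by (rule sum.not_neutral_contains_not_neutral)
    then obtain j' i' where "melem S u (idx j' i' x) \<noteq> 0" "melem T (idx j' i' x) (idx j'' i'' x) \<noteq> 0"
      by (cases q) (auto simp: mult_eq_0_iff)
    then have "\<exists>y\<in>base. \<exists>j i j1 i1. u = idx j i y \<and> idx j' i' x = idx j1 i1 y \<and> i \<le> j \<and> i1 \<le> j1 \<and> (j = j1 \<or> j < J \<and> j1 < J)"
      "\<exists>y\<in>base. \<exists>j i j1 i1. idx j' i' x = idx j i y \<and> idx j'' i'' x = idx j1 i1 y \<and> i \<le> j \<and> i1 \<le> j1 \<and> (j = j1 \<or> j < J \<and> j1 < J)"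
      using JS JT unfolding block_diag_def by blast+
    then show "\<exists>x\<in>base. \<exists>j i j' i'. u = idx j i x \<and> w = idx j' i' x \<and> i \<le> j \<and> i' \<le> j' \<and> (j = j' \<or> j < J \<and> j' < J)"
      unfolding w by auto
  qed
  moreover have "continuous_on base (\<lambda>x. melem (S o\<^sub>L T) (idx j i x) (idx j'' i'' x))" for j i j'' i''
    unfolding comp case_prod_unfold using S T
    by (intro continuous_on_sum continuous_on_mult) (auto simp: core_def)
  moreover have "melem (S o\<^sub>L T) (idx j i (antipode m x)) (idx j'' i'' (antipode m x)) =
      sg m j * sg m j'' * melem (S o\<^sub>L T) (idx j i x) (idx j'' i'' x)" if "x \<in> base" for m j i j'' i'' x
    unfolding comp sum_distrib_left
  proof (intro sum.cong refl)
    fix q assume "q \<in> (SIGMA j':{..max J j''}. {..j'})"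
    obtain j' i' where q: "q = (j', i')" by (cases q)
    have "melem S (idx j i (antipode m x)) (idx j' i' (antipode m x)) = sg m j * sg m j' * melem S (idx j i x) (idx j' i' x)"
      "melem T (idx j' i' (antipode m x)) (idx j'' i'' (antipode m x)) = sg m j' * sg m j'' * melem T (idx j' i' x) (idx j'' i'' x)"
      using S T that by (auto simp: core_def)
    then show "(case q of (j', i') \<Rightarrow> melem S (idx j i (antipode m x)) (idx j' i' (antipode m x)) *
        melem T (idx j' i' (antipode m x)) (idx j'' i'' (antipode m x))) =
      sg m j * sg m j'' * (case q of (j', i') \<Rightarrow> melem S (idx j i x) (idx j' i' x) * melem T (idx j' i' x) (idx j'' i'' x))"
      unfolding q prod.case by (simp only: sg_cancel)
  qed
  ultimately show ?thesis using bounded_ops_comp[OF bS bT] unfolding core_def by blast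
qed

definition alg :: "(nat \<Rightarrow> real) op set" where "alg = closure core"

lemma norm_scaleC_op_le: "norm (scaleC_op c T) \<le> cmod c * norm T"
proof (rule norm_blinfun_bound)
  fix x
  show "norm (scaleC_op c T x) \<le> cmod c * norm T * norm x"
    unfolding scaleC_op_apply norm_scaleC mult.assoc by (intro mult_left_mono norm_blinfun) simp
qed simp

lemma adj_tendsto:
  assumes f: "\<And>n. f n \<in> bounded_ops" and T: "T \<in> bounded_ops" and lim: "f \<longlonglongrightarrow> T"
  shows "(\<lambda>n. adj (f n)) \<longlonglongrightarrow> adj T"
proof -
  have m: "- T = scaleC_op (-1) T" for T :: "'i op"
    by (rule blinfun_eqI, rule ell2_eqI) (simp add: scaleC_op_apply blinfun.minus_left)
  have d: "f n - T \<in> bounded_ops" for n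
    using bounded_ops_add[OF f[of n] bounded_ops_scaleC[OF T, of "-1"]] by (simp add: m[symmetric])
  have "adj (f n) = adj ((f n - T) + T)" for n by simp
  then have "adj (f n) - adj T = adj (f n - T)" for n
    unfolding adj_add[OF d T] by simp
  then have le: "norm (adj (f n) - adj T) \<le> norm (f n - T)" for n by (simp add: norm_adj_le[OF d])
  have "(\<lambda>n. norm (f n - T)) \<longlonglongrightarrow> 0" using lim by (simp add: LIM_zero tendsto_norm_zero)
  from Lim_null_comparison[OF always_eventually[OF allI[OF le]] this]
  have "(\<lambda>n. adj (f n) - adj T) \<longlonglongrightarrow> 0" .
  then show ?thesis by (rule LIM_zero_cancel)
qed

lemma alg_seq: "T \<in> alg \<Longrightarrow> \<exists>f. (\<forall>n. f n \<in> core) \<and> f \<longlonglongrightarrow> T"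
  unfolding alg_def closure_sequential by blast

lemma alg_limI: "(\<And>n. f n \<in> core) \<Longrightarrow> f \<longlonglongrightarrow> T \<Longrightarrow> T \<in> alg"
  unfolding alg_def closure_sequential by blast

lemma core_alg: "T \<in> core \<Longrightarrow> T \<in> alg"
  unfolding alg_def using closure_subset by blast

lemma alg_bounded: "T \<in> alg \<Longrightarrow> T \<in> bounded_ops"
proof -
  have "closure core \<subseteq> bounded_ops"
    by (rule closure_minimal[OF _ closed_bounded_ops]) (auto simp: core_bounded)
  then show "T \<in> alg \<Longrightarrow> T \<in> bounded_ops" by (auto simp: alg_def)
qed

lemma cstar_algebra_alg: "cstar_algebra alg"
  unfolding cstar_algebra_def
proof (intro conjI ballI allI)
  show "alg \<subseteq> bounded_ops" using alg_bounded by blast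
  show "0 \<in> alg" by (rule core_alg[OF core_zero])
  show "closed alg" by (simp add: alg_def)
next
  fix x y assume "x \<in> alg" "y \<in> alg"
  with alg_seq[of x] alg_seq[of y]
  obtain f g where fg: "\<And>n. f n \<in> core" "f \<longlonglongrightarrow> x" "\<And>n. g n \<in> core" "g \<longlonglongrightarrow> y" by blast
  show "x + y \<in> alg" by (rule alg_limI[of "\<lambda>n. f n + g n"]) (use fg in \<open>auto intro: core_add tendsto_add\<close>)
  show "x o\<^sub>L y \<in> alg"
    by (rule alg_limI[of "\<lambda>n. f n o\<^sub>L g n"])
      (use fg in \<open>auto intro: core_comp bounded_bilinear.tendsto[OF bounded_bilinear_blinfun_compose]\<close>)
next
  fix x c assume "x \<in> alg"
  with alg_seq[of x] obtain f where f: "\<And>n. f n \<in> core" "f \<longlonglongrightarrow> x" by blast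
  have "bounded_linear (scaleC_op c :: 'i op \<Rightarrow> 'i op)" for c
    by (rule bounded_linear_intro[where K = "cmod c"])
      (auto intro!: blinfun_eqI ell2_eqI
        simp: scaleC_op_apply blinfun.add_left blinfun.scaleR_left distrib_left norm_scaleC_op_le mult.commute)
  then show "scaleC_op c x \<in> alg"
    by (intro alg_limI[of "\<lambda>n. scaleC_op c (f n)"]) (auto intro: core_scaleC f bounded_linear.tendsto)
next
  fix x assume "x \<in> alg"
  with alg_seq[of x] obtain f where f: "\<And>n. f n \<in> core" "f \<longlonglongrightarrow> x" by blast
  show "adj x \<in> alg"
    by (rule alg_limI[of "\<lambda>n. adj (f n)"]) (use f \<open>x \<in> alg\<close> in \<open>auto intro: core_adj adj_tendsto core_bounded alg_bounded\<close>)
qed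

subsection \<open>Weighted composition operators\<close>

text \<open>A matrix with at most one nonzero entry per row. If \<pi> is injective on the support of
  \<phi>, the same holds for columns, and a bound for the entries bounds the norm.\<close>

definition wop :: "('i \<Rightarrow> complex) \<Rightarrow> ('i \<Rightarrow> 'i) \<Rightarrow> 'i op" where
  "wop \<phi> \<pi> = Blinfun (\<lambda>x. Abs_ell2 (\<lambda>u. \<phi> u * ell2_coord x (\<pi> u)))"

context
  fixes \<phi> :: "'i \<Rightarrow> complex" and \<pi> :: "'i \<Rightarrow> 'i" and C :: real
  assumes bd: "\<And>u. cmod (\<phi> u) \<le> C" and inj: "inj_on \<pi> {u. \<phi> u \<noteq> 0}"
begin

lemma wop_sum_bound:
  fixes x :: "'i ell2"
  shows "(\<lambda>u. (cmod (\<phi> u * ell2_coord x (\<pi> u)))\<^sup>2) summable_on UNIV"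
    and "(\<Sum>\<^sub>\<infinity>u. (cmod (\<phi> u * ell2_coord x (\<pi> u)))\<^sup>2) \<le> (norm x * C)\<^sup>2"
proof -
  have C: "C \<ge> 0" using bd[of undefined] norm_ge_zero order_trans by blast
  let ?S = "{u. \<phi> u \<noteq> 0}" and ?g = "\<lambda>v. (cmod (ell2_coord x v))\<^sup>2"
  have sg: "?g summable_on B" for B by (rule summable_on_subset_banach[OF ell2_coord_square_summable]) simp
  have gs: "(\<lambda>u. ?g (\<pi> u)) summable_on ?S"
    using summable_on_reindex[OF inj, of ?g] sg by (simp add: comp_def)
  have le: "(cmod (\<phi> u * ell2_coord x (\<pi> u)))\<^sup>2 \<le> C\<^sup>2 * ?g (\<pi> u)" for u
    unfolding norm_mult power_mult_distrib by (intro mult_right_mono power_mono bd) simp_all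
  have s: "(\<lambda>u. (cmod (\<phi> u * ell2_coord x (\<pi> u)))\<^sup>2) summable_on ?S"
    by (rule summable_on_comparison_test[OF summable_on_cmult_right[OF gs, of "C\<^sup>2"]]) (use le in auto)
  show "(\<lambda>u. (cmod (\<phi> u * ell2_coord x (\<pi> u)))\<^sup>2) summable_on UNIV"
    by (rule summable_on_cong_neutral[THEN iffD1, rotated -1, OF s]) auto
  have "(\<Sum>\<^sub>\<infinity>u. (cmod (\<phi> u * ell2_coord x (\<pi> u)))\<^sup>2) = (\<Sum>\<^sub>\<infinity>u\<in>?S. (cmod (\<phi> u * ell2_coord x (\<pi> u)))\<^sup>2)"
    by (rule infsum_cong_neutral) auto
  also have "\<dots> \<le> (\<Sum>\<^sub>\<infinity>u\<in>?S. C\<^sup>2 * ?g (\<pi> u))"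
    by (rule infsum_mono[OF s summable_on_cmult_right[OF gs]]) (rule le)
  also have "\<dots> = C\<^sup>2 * infsum ?g (\<pi> ` ?S)"
    by (simp add: infsum_cmult_right' infsum_reindex[OF inj] comp_def)
  also have "\<dots> \<le> C\<^sup>2 * infsum ?g UNIV"
    by (intro mult_left_mono infsum_mono2) (auto simp: sg)
  also have "\<dots> = (norm x * C)\<^sup>2" by (simp add: norm_ell2_sq[symmetric] power_mult_distrib mult.commute)
  finally show "(\<Sum>\<^sub>\<infinity>u. (cmod (\<phi> u * ell2_coord x (\<pi> u)))\<^sup>2) \<le> (norm x * C)\<^sup>2" .
qed

lemma wop_apply: "ell2_coord (wop \<phi> \<pi> x) u = \<phi> u * ell2_coord x (\<pi> u)"
  and norm_wop: "norm (wop \<phi> \<pi>) \<le> C" and wop_bounded: "wop \<phi> \<pi> \<in> bounded_ops"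
proof -
  have C: "C \<ge> 0" using bd[of undefined] norm_ge_zero order_trans by blast
  define f where "f x = Abs_ell2 (\<lambda>u. \<phi> u * ell2_coord x (\<pi> u))" for x
  have f: "ell2_coord (f x) u = \<phi> u * ell2_coord x (\<pi> u)" for x u
    unfolding f_def using wop_sum_bound(1)[of x] by (simp add: Abs_ell2_inverse)
  have nf: "norm (f x) \<le> norm x * C" for x
    by (rule power2_le_imp_le) (use wop_sum_bound(2)[of x] C in \<open>simp_all add: norm_ell2_sq[of "f x"] f\<close>)
  have bl: "bounded_linear f"
    by (rule bounded_linear_intro[OF _ _ nf]) (auto intro!: ell2_eqI simp: f distrib_left)
  have w: "wop \<phi> \<pi> x = f x" for x unfolding wop_def f_def[symmetric] by (simp add: bounded_linear_Blinfun_apply[OF bl])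
  show "ell2_coord (wop \<phi> \<pi> x) u = \<phi> u * ell2_coord x (\<pi> u)" by (simp add: w f)
  show "norm (wop \<phi> \<pi>) \<le> C" by (rule norm_blinfun_bound[OF C]) (use nf in \<open>simp add: w mult.commute\<close>)
  show "wop \<phi> \<pi> \<in> bounded_ops" by (rule bounded_opsI) (auto intro!: ell2_eqI simp: w f)
qed

lemma melem_wop: "melem (wop \<phi> \<pi>) u v = (if \<pi> u = v then \<phi> u else 0)"
  by (simp add: melem_def wop_apply)

lemma adj_wop_ket: "adj (wop \<phi> \<pi>) (ket u) = cnj (\<phi> u) *\<^sub>C ket (\<pi> u)"
proof (rule ell2_eqI)
  show "ell2_coord (adj (wop \<phi> \<pi>) (ket u)) v = ell2_coord (cnj (\<phi> u) *\<^sub>C ket (\<pi> u)) v" for v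
    using melem_adj[OF wop_bounded, of v u] by (simp add: melem_def[of "adj _"] melem_wop)
qed

end

subsection \<open>Diagonal elements\<close>

definition diag :: "(nat \<Rightarrow> nat \<Rightarrow> real) \<Rightarrow> (nat \<Rightarrow> real) op" where
  "diag e = wop (\<lambda>u. if valid u then of_real (e (lev u) (pos u)) else 0) (\<lambda>u. u)"

context
  fixes e :: "nat \<Rightarrow> nat \<Rightarrow> real" and C :: real
  assumes e: "\<forall>j i. \<bar>e j i\<bar> \<le> C"
begin

lemma diag_wop: "cmod (if valid u then of_real (e (lev u) (pos u)) else 0) \<le> C"
    "inj_on (\<lambda>u. u) {u. (if valid u then complex_of_real (e (lev u) (pos u)) else 0) \<noteq> 0}"
  using e[rule_format, of "lev u" "pos u"] by auto

lemma diag_bounded: "diag e \<in> bounded_ops" and norm_diag: "norm (diag e) \<le> C"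
    and melem_diag: "melem (diag e) u v = (if u = v \<and> valid u then of_real (e (lev u) (pos u)) else 0)"
  unfolding diag_def using wop_bounded[OF diag_wop] norm_wop[OF diag_wop] melem_wop[OF diag_wop] by auto

lemma diag_ket: "diag e (ket u) = (if valid u then of_real (e (lev u) (pos u)) else 0) *\<^sub>C ket u"
  by (rule ell2_eqI) (auto simp: diag_def wop_apply[OF diag_wop])

lemma diag_core: "diag e \<in> core"
proof -
  have "block_diag 0 (diag e)"
    unfolding block_diag_def melem_diag by (auto simp: valid_def split: if_splits)
  moreover have "continuous_on base (\<lambda>x. melem (diag e) (idx j i x) (idx j' i' x))" for j i j' i'
  proof -
    have "continuous_on base (\<lambda>x. melem (diag e) (idx j i x) (idx j' i' x)) \<longleftrightarrow>
        continuous_on base (\<lambda>x. if j = j' \<and> i = i' \<and> i \<le> j then complex_of_real (e j i) else 0)"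
      by (rule continuous_on_cong) (auto simp: melem_diag)
    then show ?thesis by simp
  qed
  ultimately show ?thesis
    by (auto simp: core_def diag_bounded melem_diag antipode_base sg_sq mult.assoc[symmetric])
qed

lemma adj_diag: "adj (diag e) = diag e"
  by (rule melem_eqI) (auto simp: diag_bounded adj_bounded melem_adj melem_diag)

end

lemma diag_comp:
  assumes "\<forall>j i. \<bar>e j i\<bar> \<le> C" "\<forall>j i. \<bar>f j i\<bar> \<le> C'"
  shows "diag e o\<^sub>L diag f = diag (\<lambda>j i. e j i * f j i)"
proof -
  have "\<bar>e j i * f j i\<bar> \<le> C * C'" for j i
    unfolding abs_mult using assms[rule_format, of j i] by (intro mult_mono) auto
  then have ef: "\<forall>j i. \<bar>e j i * f j i\<bar> \<le> C * C'" by blast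
  show ?thesis
  proof (rule bounded_ops_eqI)
    show "diag e o\<^sub>L diag f \<in> bounded_ops" by (intro bounded_ops_comp diag_bounded[OF assms(1)] diag_bounded[OF assms(2)])
    show "diag (\<lambda>j i. e j i * f j i) \<in> bounded_ops" by (rule diag_bounded[OF ef])
    show "(diag e o\<^sub>L diag f) (ket v) = diag (\<lambda>j i. e j i * f j i) (ket v)" for v
      by (simp add: diag_ket[OF assms(1)] diag_ket[OF assms(2)] diag_ket[OF ef]
          bounded_opsD[OF diag_bounded[OF assms(1)]] mult.commute)
  qed
qed

lemma diag_add:
  assumes "\<forall>j i. \<bar>e j i\<bar> \<le> C" "\<forall>j i. \<bar>f j i\<bar> \<le> C'"
  shows "diag e + diag f = diag (\<lambda>j i. e j i + f j i)"
proof -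
  have "\<bar>e j i + f j i\<bar> \<le> C + C'" for j i
    using assms(1)[rule_format, of j i] assms(2)[rule_format, of j i] by linarith
  then have ef: "\<forall>j i. \<bar>e j i + f j i\<bar> \<le> C + C'" by blast
  show ?thesis
    by (rule melem_eqI)
      (auto simp: melem_add melem_diag[OF assms(1)] melem_diag[OF assms(2)] melem_diag[OF ef]
        intro!: bounded_ops_add diag_bounded[OF assms(1)] diag_bounded[OF assms(2)] diag_bounded[OF ef])
qed

lemma diag_diff:
  assumes "\<forall>j i. \<bar>e j i\<bar> \<le> C" "\<forall>j i. \<bar>f j i\<bar> \<le> C'"
  shows "diag e - diag f = diag (\<lambda>j i. e j i - f j i)"
proof -
  have "\<bar>e j i - f j i\<bar> \<le> C + C'" for j i
    using assms(1)[rule_format, of j i] assms(2)[rule_format, of j i] by linarith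
  then have ef: "\<forall>j i. \<bar>e j i - f j i\<bar> \<le> C + C'" by blast
  have "diag (\<lambda>j i. e j i - f j i) + diag f = diag (\<lambda>j i. e j i - f j i + f j i)"
    by (rule diag_add[OF ef assms(2)])
  then show ?thesis by (simp add: diff_eq_eq)
qed

lemma diag_positive:
  assumes e: "\<And>j i. 0 \<le> e j i" "\<And>j i. e j i \<le> 1"
  shows "diag e \<in> positive_elements alg"
proof -
  have s: "\<forall>j i. \<bar>sqrt (e j i)\<bar> \<le> 1" using e by simp
  have "diag e = adj (diag (\<lambda>j i. sqrt (e j i))) o\<^sub>L diag (\<lambda>j i. sqrt (e j i))"
    using e by (simp add: adj_diag[OF s] diag_comp[OF s s])
  then show ?thesis unfolding positive_elements_def using core_alg[OF diag_core[OF s]] by blast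
qed

subsection \<open>The two properly infinite elements\<close>

definition eig :: "nat \<Rightarrow> nat \<Rightarrow> nat \<Rightarrow> real" where
  "eig p j i = (if j mod 2 = p then (1 / 2) ^ i else (1 / 2) ^ j)"

lemma eig_bounds: "0 < eig p j i" "eig p j i \<le> 1" "\<forall>j i. \<bar>eig p j i\<bar> \<le> 1"
  by (auto simp: eig_def power_le_one)

definition host_vec :: "nat \<Rightarrow> (nat \<Rightarrow> real) \<Rightarrow> (nat \<Rightarrow> real) ell2" where
  "host_vec l x = (\<Sum>m\<le>l. coord x l m *\<^sub>C ket (idx l m x))"

lemma cinner_host_vec: "x \<in> base \<Longrightarrow> cinner (host_vec l x) (host_vec l' x') = (if l = l' \<and> x = x' then 1 else 0)"
proof -
  assume x: "x \<in> base"
  have c: "ell2_coord (host_vec l x) u = (if pt u = x \<and> lev u = l \<and> u = idx l (pos u) x \<and> pos u \<le> l then coord x l (pos u) else 0)" for l x u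
  proof (cases "\<exists>i\<le>l. u = idx l i x")
    case True
    then obtain i where i: "i \<le> l" "u = idx l i x" by blast
    then show ?thesis by (simp add: host_vec_def if_distrib sum.delta cong: if_cong)
  next
    case False
    then have "ell2_coord (host_vec l x) u = 0" by (auto simp: host_vec_def intro!: sum.neutral)
    then show ?thesis using False by auto
  qed
  have "cinner (host_vec l x) (host_vec l' x') = (\<Sum>m\<le>l. cnj (coord x l m) * ell2_coord (host_vec l' x') (idx l m x))"
    by (simp add: host_vec_def[of l x] cinner_sum_left cinner_scaleC_left cinner_ket_left)
  also have "\<dots> = (\<Sum>m\<le>l. if l = l' \<and> x = x' then of_real ((cmod (coord x l m))\<^sup>2) else 0)"
    by (intro sum.cong refl) (auto simp: c cnj_mult_self)
  also have "\<dots> = (if l = l' \<and> x = x' then of_real (\<Sum>m\<le>l. (cmod (coord x l m))\<^sup>2) else 0)"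
    by (cases "l = l' \<and> x = x'") auto
  also have "(\<Sum>m\<le>l. (cmod (coord x l m))\<^sup>2) = 1" using x by (simp add: base_def)
  finally show ?thesis by simp
qed

lemma cinner_host_vec_ket: "l \<noteq> j \<Longrightarrow> cinner (host_vec l x) (ket (idx j i y)) = 0" "l \<noteq> j \<Longrightarrow> cinner (ket (idx j i y)) (host_vec l x) = 0"
  by (auto simp: host_vec_def cinner_sum_left cinner_sum_right cinner_scaleC_left cinner_scaleC_right cinner_ket_left)

text \<open>
  \<open>host_vec l x\<close> is an invariant unit section of block \<open>l\<close>, and an eigenvector of \<open>diag (eig p)\<close> when
  \<open>l\<close> is not of parity \<open>p\<close>. The \<open>e\<close>-th copy (\<open>e = 0, 1\<close>) of the basis vector \<open>(j, i)\<close> of a low block is spread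
  over the lines spanned by \<open>host_vec l x\<close> for the \<open>j + 1\<close> blocks \<open>l = host p e j i i'\<close>, with coefficients
  \<open>coord x j i'\<close>; that of a basis vector of a high block of parity \<open>p\<close> is shifted by \<open>(e + 1) n\<close> in its block.
\<close>

definition host :: "nat \<Rightarrow> nat \<Rightarrow> nat \<Rightarrow> nat \<Rightarrow> nat \<Rightarrow> nat" where
  "host p e j i i' = 2 * prod_encode (e, prod_encode (j, prod_encode (i, i'))) + (1 - p)"

lemma host_eq_iff: "host p e j i i' = host p f k l l' \<longleftrightarrow> e = f \<and> j = k \<and> i = l \<and> i' = l'"
  by (auto simp: host_def)

context
  fixes p n :: nat
  assumes p: "p < 2"
begin

lemma host_mod: "host p e j i i' mod 2 \<noteq> p"
proof -
  have "host p e j i i' mod 2 = (1 - p) mod 2" unfolding host_def by simp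
  then show ?thesis using p by (cases "p = 0") auto
qed

text \<open>These are the eigenvalues reproduced exactly at stage \<open>n\<close>; all others are
  at most \<open>(1 / 2) ^ n\<close>. The bound \<open>3 * n\<close> gives a high block enough room
  for its first \<open>n\<close> basis vectors to be shifted by \<open>n\<close> and by
  \<open>2 * n\<close>.\<close>

definition active :: "nat \<Rightarrow> nat \<Rightarrow> bool" where
  "active j i \<longleftrightarrow> j < 3 * n \<or> j mod 2 = p \<and> i < n"

text \<open>The shift divides the eigenvalue by \<open>2 ^ ((e + 1) * n)\<close>. The weight
  restoring it is a square root because it enters twice, through the duplicator and through its
  adjoint.\<close>

definition hi\<phi> :: "nat \<Rightarrow> (nat \<Rightarrow> real) \<Rightarrow> complex" where
  "hi\<phi> e u = (if valid u \<and> 3 * n \<le> lev u \<and> lev u mod 2 = p \<and> pos u < n then of_real (sqrt (2 ^ ((e + 1) * n))) else 0)"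
definition hi\<pi> :: "nat \<Rightarrow> (nat \<Rightarrow> real) \<Rightarrow> nat \<Rightarrow> real" where
  "hi\<pi> e u = idx (lev u) (pos u + (e + 1) * n) (pt u)"
text \<open>On the host line the eigenvalue is a power of 1/2 with exponent \<open>host\<close>, so
  this weight brings it back to \<open>eig p j i\<close>. Conjugates appear since it is the adjoint
  that carries basis vectors to combinations of host sections.\<close>

definition lo\<phi> :: "nat \<Rightarrow> nat \<Rightarrow> nat \<Rightarrow> (nat \<Rightarrow> real) \<Rightarrow> complex" where
  "lo\<phi> e i' m u = (if valid u \<and> lev u < 3 * n \<and> i' \<le> lev u \<and> m \<le> host p e (lev u) (pos u) i'
    then of_real (sqrt (eig p (lev u) (pos u) * 2 ^ host p e (lev u) (pos u) i')) *
      cnj (coord (pt u) (lev u) i' * coord (pt u) (host p e (lev u) (pos u) i') m) else 0)"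
definition lo\<pi> :: "nat \<Rightarrow> nat \<Rightarrow> nat \<Rightarrow> (nat \<Rightarrow> real) \<Rightarrow> nat \<Rightarrow> real" where
  "lo\<pi> e i' m u = idx (host p e (lev u) (pos u) i') m (pt u)"
text \<open>Only the finitely many blocks below \<open>3 * n\<close> are sent to hosts, so one
  number exceeds all levels involved; it is the \<open>J\<close> in \<open>block_diag\<close> for
  these operators.\<close>

definition host_bound :: nat where
  "host_bound = Suc (Max (insert (3 * n) ((\<lambda>(e, j, i, i'). host p e j i i') ` ({..1} \<times> {..3 * n} \<times> {..3 * n} \<times> {..3 * n}))))"

lemma host_bound: "e \<le> 1 \<Longrightarrow> j < 3 * n \<Longrightarrow> i \<le> j \<Longrightarrow> i' \<le> j \<Longrightarrow> host p e j i i' < host_bound" and host_bound_n: "3 * n < host_bound"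
proof -
  let ?S = "insert (3 * n) ((\<lambda>(e, j, i, i'). host p e j i i') ` ({..1} \<times> {..3 * n} \<times> {..3 * n} \<times> {..3 * n}))"
  show "3 * n < host_bound" unfolding host_bound_def less_Suc_eq_le by (rule Max_ge) auto
  assume "e \<le> 1" "j < 3 * n" "i \<le> j" "i' \<le> j"
  then have "host p e j i i' \<in> ?S"
    by (intro insertI2 rev_image_eqI[of "(e, j, i, i')"]) auto
  then show "host p e j i i' < host_bound" unfolding host_bound_def less_Suc_eq_le by (intro Max_ge) auto
qed

lemma hi_wop: "cmod (hi\<phi> e u) \<le> sqrt (2 ^ ((e + 1) * n))" "inj_on (hi\<pi> e) {u. hi\<phi> e u \<noteq> 0}"
proof -
  show "cmod (hi\<phi> e u) \<le> sqrt (2 ^ ((e + 1) * n))" by (auto simp: hi\<phi>_def)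
  show "inj_on (hi\<pi> e) {u. hi\<phi> e u \<noteq> 0}"
    by (rule inj_onI) (auto simp: hi\<phi>_def hi\<pi>_def split: if_splits dest!: valid_eq; metis)
qed

lemma lo_wop:
  assumes e: "e \<le> 1"
  shows "cmod (lo\<phi> e i' m u) \<le> sqrt (2 ^ host_bound)" "inj_on (lo\<pi> e i' m) {u. lo\<phi> e i' m u \<noteq> 0}"
proof -
  show "cmod (lo\<phi> e i' m u) \<le> sqrt (2 ^ host_bound)"
  proof (cases "valid u \<and> lev u < 3 * n \<and> i' \<le> lev u \<and> m \<le> host p e (lev u) (pos u) i'")
    case True
    then obtain x j i where u: "u = idx j i x" "x \<in> base" "i \<le> j" by (auto simp: valid_def)
    let ?h = "host p e j i i'"
    have h: "?h < host_bound" using True e by (intro host_bound) (auto simp: u)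
    have 1: "cmod (coord x j i') * cmod (coord x ?h m) \<le> 1 * 1"
      using True u by (intro mult_mono coord_le_1) (auto simp: u)
    have "eig p j i * 2 ^ ?h \<le> 1 * 2 ^ host_bound"
      by (intro mult_mono power_increasing) (use eig_bounds(2)[of p j i] h in auto)
    then have 2: "sqrt (eig p j i * 2 ^ ?h) \<le> sqrt (2 ^ host_bound)" by simp
    have "cmod (lo\<phi> e i' m u) = sqrt (eig p j i * 2 ^ ?h) * (cmod (coord x j i') * cmod (coord x ?h m))"
      using True eig_bounds(1)[of p j i] by (simp add: lo\<phi>_def u norm_mult)
    also have "\<dots> \<le> sqrt (2 ^ host_bound) * (1 * 1)"
      by (intro mult_mono[OF 2 1]) simp_all
    finally show ?thesis by simp
  qed (auto simp: lo\<phi>_def)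
  show "inj_on (lo\<pi> e i' m) {u. lo\<phi> e i' m u \<noteq> 0}"
    by (rule inj_onI) (auto simp: lo\<phi>_def lo\<pi>_def host_eq_iff split: if_splits dest!: valid_eq; metis)
qed

definition duplicator :: "nat \<Rightarrow> (nat \<Rightarrow> real) op" where
  "duplicator e = wop (hi\<phi> e) (hi\<pi> e) + (\<Sum>i'<3 * n. \<Sum>m<host_bound. wop (lo\<phi> e i' m) (lo\<pi> e i' m))"

lemma hi_core: "e \<le> 1 \<Longrightarrow> wop (hi\<phi> e) (hi\<pi> e) \<in> core"
proof -
  assume e: "e \<le> 1"
  note m = melem_wop[OF hi_wop] and b = wop_bounded[OF hi_wop]
  have "block_diag 0 (wop (hi\<phi> e) (hi\<pi> e))"
    unfolding block_diag_def m
  proof (intro allI impI)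
    fix u v assume nz: "(if hi\<pi> e u = v then hi\<phi> e u else 0) \<noteq> 0"
    then have u: "valid u" "3 * n \<le> lev u" "pos u < n" and v: "v = hi\<pi> e u" by (auto simp: hi\<phi>_def split: if_splits)
    have "(e + 1) * n \<le> 2 * n" using e by (intro mult_le_mono1) simp
    then have "pos u + (e + 1) * n \<le> lev u" using u by linarith
    then show "\<exists>x\<in>base. \<exists>j i j' i'. u = idx j i x \<and> v = idx j' i' x \<and> i \<le> j \<and> i' \<le> j' \<and> (j = j' \<or> j < 0 \<and> j' < 0)"
      using u(1) by (auto simp: valid_def v hi\<pi>_def)
  qed
  moreover have "continuous_on base (\<lambda>x. melem (wop (hi\<phi> e) (hi\<pi> e)) (idx j i x) (idx j' i' x))" for j i j' i'
  proof -
    have "continuous_on base (\<lambda>x. melem (wop (hi\<phi> e) (hi\<pi> e)) (idx j i x) (idx j' i' x)) \<longleftrightarrow>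
        continuous_on base (\<lambda>x. if j = j' \<and> i + (e + 1) * n = i' \<and> i \<le> j \<and> 3 * n \<le> j \<and> j mod 2 = p \<and> i < n
          then complex_of_real (sqrt (2 ^ ((e + 1) * n))) else 0)"
      by (rule continuous_on_cong) (auto simp: m hi\<phi>_def hi\<pi>_def)
    then show ?thesis by simp
  qed
  moreover have "melem (wop (hi\<phi> e) (hi\<pi> e)) (idx j i (antipode q x)) (idx j' i' (antipode q x)) =
      sg q j * sg q j' * melem (wop (hi\<phi> e) (hi\<pi> e)) (idx j i x) (idx j' i' x)" if "x \<in> base" for q j i j' i' x
    using that by (auto simp: m hi\<phi>_def hi\<pi>_def antipode_base sg_sq mult.assoc[symmetric])
  ultimately show ?thesis using b unfolding core_def by blast
qed

lemma lo_core:
  assumes e: "e \<le> 1"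
  shows "wop (lo\<phi> e i' m) (lo\<pi> e i' m) \<in> core"
proof -
  note mm = melem_wop[OF lo_wop[OF e]] and b = wop_bounded[OF lo_wop[OF e]]
  have "block_diag host_bound (wop (lo\<phi> e i' m) (lo\<pi> e i' m))"
    unfolding block_diag_def mm
  proof (intro allI impI)
    fix u v assume nz: "(if lo\<pi> e i' m u = v then lo\<phi> e i' m u else 0) \<noteq> 0"
    then have u: "valid u" "lev u < 3 * n" "i' \<le> lev u" "m \<le> host p e (lev u) (pos u) i'" and v: "v = lo\<pi> e i' m u"
      by (auto simp: lo\<phi>_def split: if_splits)
    obtain x j i where ux: "x \<in> base" "i \<le> j" "u = idx j i x" using u(1) by (auto simp: valid_def)
    then have "host p e j i i' < host_bound" "j < host_bound" using u e host_bound[of e j i i'] host_bound_n by auto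
    then show "\<exists>x\<in>base. \<exists>j i j' i'. u = idx j i x \<and> v = idx j' i' x \<and> i \<le> j \<and> i' \<le> j' \<and> (j = j' \<or> j < host_bound \<and> j' < host_bound)"
      using ux u by (auto simp: v lo\<pi>_def)
  qed
  moreover have "continuous_on base (\<lambda>x. melem (wop (lo\<phi> e i' m) (lo\<pi> e i' m)) (idx j i x) (idx j1 i1 x))" for j i j1 i1
  proof -
    have "continuous_on base (\<lambda>x. melem (wop (lo\<phi> e i' m) (lo\<pi> e i' m)) (idx j i x) (idx j1 i1 x)) \<longleftrightarrow>
        continuous_on base (\<lambda>x. if host p e j i i' = j1 \<and> m = i1 \<and> i \<le> j \<and> j < 3 * n \<and> i' \<le> j \<and> m \<le> host p e j i i'
          then of_real (sqrt (eig p j i * 2 ^ host p e j i i')) * cnj (coord x j i' * coord x (host p e j i i') m) else 0)"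
      by (rule continuous_on_cong) (auto simp: mm lo\<phi>_def lo\<pi>_def)
    then show ?thesis
      by (cases "host p e j i i' = j1 \<and> m = i1 \<and> i \<le> j \<and> j < 3 * n \<and> i' \<le> j \<and> m \<le> host p e j i i'")
        (auto intro!: continuous_intros cont_coord)
  qed
  moreover have "melem (wop (lo\<phi> e i' m) (lo\<pi> e i' m)) (idx j i (antipode q x)) (idx j1 i1 (antipode q x)) =
      sg q j * sg q j1 * melem (wop (lo\<phi> e i' m) (lo\<pi> e i' m)) (idx j i x) (idx j1 i1 x)" if "x \<in> base" for q j i j1 i1 x
  proof -
    have "cnj (sg q j) = sg q j" for j by (simp add: sg_def)
    then show ?thesis
      using that by (auto simp: mm lo\<phi>_def lo\<pi>_def antipode_base coord_antipode mult_ac)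
  qed
  ultimately show ?thesis using b unfolding core_def by blast
qed

lemma duplicator_core: "e \<le> 1 \<Longrightarrow> duplicator e \<in> core"
  unfolding duplicator_def by (intro core_add core_sum hi_core lo_core)

lemma adj_duplicator_ket:
  assumes e: "e \<le> 1" and x: "x \<in> base" "i \<le> j"
  shows "adj (duplicator e) (ket (idx j i x)) =
    (if j < 3 * n then \<Sum>i'\<le>j. (of_real (sqrt (eig p j i * 2 ^ host p e j i i')) * coord x j i') *\<^sub>C host_vec (host p e j i i') x
     else if j mod 2 = p \<and> i < n then of_real (sqrt (2 ^ ((e + 1) * n))) *\<^sub>C ket (idx j (i + (e + 1) * n) x) else 0)"
proof -
  have bl: "wop (lo\<phi> e i' m) (lo\<pi> e i' m) \<in> bounded_ops" for i' m using lo_core[OF e] core_bounded by blast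
  have "adj (duplicator e) = adj (wop (hi\<phi> e) (hi\<pi> e)) + (\<Sum>i'<3 * n. \<Sum>m<host_bound. adj (wop (lo\<phi> e i' m) (lo\<pi> e i' m)))"
    unfolding duplicator_def
    by (simp add: adj_add adj_sum bounded_ops_sum bl core_bounded[OF hi_core[OF e]])
  then have *: "adj (duplicator e) (ket (idx j i x)) = cnj (hi\<phi> e (idx j i x)) *\<^sub>C ket (hi\<pi> e (idx j i x)) +
      (\<Sum>i'<3 * n. \<Sum>m<host_bound. cnj (lo\<phi> e i' m (idx j i x)) *\<^sub>C ket (lo\<pi> e i' m (idx j i x)))"
    by (simp add: blinfun.add_left blinfun.sum_left adj_wop_ket[OF hi_wop] adj_wop_ket[OF lo_wop[OF e]])
  show ?thesis
  proof (cases "j < 3 * n")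
    case True
    have "(\<Sum>m<host_bound. cnj (lo\<phi> e i' m (idx j i x)) *\<^sub>C ket (lo\<pi> e i' m (idx j i x))) =
      (if i' \<le> j then (of_real (sqrt (eig p j i * 2 ^ host p e j i i')) * coord x j i') *\<^sub>C host_vec (host p e j i i') x else 0)" for i'
    proof (cases "i' \<le> j")
      case i': True
      let ?h = "host p e j i i'"
      have "(\<Sum>m<host_bound. cnj (lo\<phi> e i' m (idx j i x)) *\<^sub>C ket (lo\<pi> e i' m (idx j i x))) =
          (\<Sum>m\<le>?h. cnj (lo\<phi> e i' m (idx j i x)) *\<^sub>C ket (lo\<pi> e i' m (idx j i x)))"
        by (rule sum.mono_neutral_right) (use host_bound[OF e True x(2) i'] in \<open>auto simp: lo\<phi>_def\<close>)
      also have "\<dots> = (of_real (sqrt (eig p j i * 2 ^ ?h)) * coord x j i') *\<^sub>C host_vec ?h x"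
        unfolding host_vec_def scaleC_sum
        by (intro sum.cong refl) (use True i' x in \<open>simp add: lo\<phi>_def lo\<pi>_def mult_ac\<close>)
      finally show ?thesis using i' by simp
    qed (auto simp: lo\<phi>_def)
    then have "adj (duplicator e) (ket (idx j i x)) = (\<Sum>i'<3 * n. if i' \<le> j then
        (of_real (sqrt (eig p j i * 2 ^ host p e j i i')) * coord x j i') *\<^sub>C host_vec (host p e j i i') x else 0)"
      using True by (simp add: * hi\<phi>_def)
    also have "\<dots> = (\<Sum>i'\<le>j. (of_real (sqrt (eig p j i * 2 ^ host p e j i i')) * coord x j i') *\<^sub>C host_vec (host p e j i i') x)"
      using True by (intro sum.mono_neutral_cong_right) auto
    finally show ?thesis using True by simp
  next
    case False
    then show ?thesis unfolding * using x by (simp add: lo\<phi>_def hi\<phi>_def hi\<pi>_def)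
  qed
qed

lemma diag_host_vec:
  assumes "x \<in> base"
  shows "diag (eig p) (host_vec (host p e j i i') x) = of_real ((1 / 2) ^ host p e j i i') *\<^sub>C host_vec (host p e j i i') x"
  unfolding host_vec_def blinfun.sum_right scaleC_sum
proof (intro sum.cong refl)
  fix m assume "m \<in> {..host p e j i i'}"
  moreover have "eig p (host p e j i i') m = (1 / 2) ^ host p e j i i'" using host_mod by (simp add: eig_def)
  ultimately show "diag (eig p) (coord x (host p e j i i') m *\<^sub>C ket (idx (host p e j i i') m x)) =
      of_real ((1 / 2) ^ host p e j i i') *\<^sub>C coord x (host p e j i i') m *\<^sub>C ket (idx (host p e j i i') m x)"
    using assms by (simp add: bounded_opsD[OF diag_bounded[OF eig_bounds(3)]] diag_ket[OF eig_bounds(3)] mult.commute)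
qed

text \<open>These are the matrix entries of the conjugated element. Images of low basis vectors with
  different labels are orthogonal because \<open>host\<close> is injective, those of a low and a
  high one because their blocks have different parity, and those of high ones within a block because
  the shifts by \<open>n\<close> and \<open>2 * n\<close> do not overlap.\<close>

lemma cinner_duplicator:
  assumes e: "e \<le> 1" "f \<le> 1" and x: "x \<in> base" "i \<le> j" and y: "y \<in> base" "k \<le> l"
  shows "cinner (adj (duplicator e) (ket (idx j i x))) (diag (eig p) (adj (duplicator f) (ket (idx l k y)))) =
    (if e = f \<and> j = l \<and> i = k \<and> x = y \<and> active j i then of_real (eig p j i) else 0)"
proof -
  note b = bounded_opsD[OF diag_bounded[OF eig_bounds(3)]]
  note A = adj_duplicator_ket[OF e(1) x] and B = adj_duplicator_ket[OF e(2) y]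
  let ?c = "\<lambda>e j i x i'. complex_of_real (sqrt (eig p j i * 2 ^ host p e j i i')) * coord x j i'"
  have DB: "diag (eig p) (adj (duplicator f) (ket (idx l k y))) =
    (if l < 3 * n then \<Sum>k'\<le>l. (?c f l k y k' * of_real ((1 / 2) ^ host p f l k k')) *\<^sub>C host_vec (host p f l k k') y
     else if l mod 2 = p \<and> k < n then (of_real (sqrt (2 ^ ((f + 1) * n))) * of_real ((1/2) ^ (k + (f + 1) * n))) *\<^sub>C ket (idx l (k + (f + 1) * n) y) else 0)"
  proof (cases "l < 3 * n")
    case True
    then show ?thesis unfolding B
      by (simp add: blinfun.sum_right b diag_host_vec[OF y(1)] del: of_real_power)
  next
    case False
    have "(f + 1) * n \<le> 2 * n" using e by (intro mult_le_mono1) simp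
    then have "k < n \<Longrightarrow> k + (f + 1) * n \<le> l" using False by linarith
    moreover have "l mod 2 = p \<Longrightarrow> eig p l q = (1 / 2) ^ q" for q by (simp add: eig_def)
    ultimately show ?thesis using False y unfolding B
      by (simp add: blinfun.zero_right b diag_ket[OF eig_bounds(3)] del: of_real_power)
  qed
  show ?thesis
  proof (cases "j < 3 * n"; cases "l < 3 * n")
    assume jl: "j < 3 * n" "l < 3 * n"
    have "cinner (adj (duplicator e) (ket (idx j i x))) (diag (eig p) (adj (duplicator f) (ket (idx l k y)))) =
        (\<Sum>i'\<le>j. \<Sum>k'\<le>l. cnj (?c e j i x i') * (?c f l k y k' * of_real ((1 / 2) ^ host p f l k k')) *
          (if e = f \<and> j = l \<and> i = k \<and> i' = k' \<and> x = y then 1 else 0))"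
      unfolding A DB if_P[OF jl(1)] if_P[OF jl(2)] cinner_sum_sum
      by (intro sum.cong refl) (simp add: cinner_scaleC_left cinner_scaleC_right cinner_host_vec[OF x(1)]
          host_eq_iff mult.assoc del: of_real_power complex_cnj_mult)
    also have "\<dots> = (if e = f \<and> j = l \<and> i = k \<and> x = y then of_real (eig p j i) else 0)"
    proof (cases "e = f \<and> j = l \<and> i = k \<and> x = y")
      case True
      then have eq: "f = e" "l = j" "k = i" "y = x" by auto
      have h: "cnj (?c e j i x i') * (?c e j i x i' * of_real ((1 / 2) ^ h)) =
          of_real (eig p j i * (cmod (coord x j i'))\<^sup>2)" if "h = host p e j i i'" for i' h
      proof -
        have "cnj (?c e j i x i') * ?c e j i x i' = of_real ((cmod (?c e j i x i'))\<^sup>2)" by (rule cnj_mult_self)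
        also have "(cmod (?c e j i x i'))\<^sup>2 = eig p j i * 2 ^ h * (cmod (coord x j i'))\<^sup>2"
          using eig_bounds(1)[of p j i] that by (simp add: norm_mult power_mult_distrib)
        finally have "cnj (?c e j i x i') * ?c e j i x i' * of_real ((1 / 2) ^ h) =
            of_real (eig p j i * 2 ^ h * (cmod (coord x j i'))\<^sup>2 * (1 / 2) ^ h)" by (simp only: of_real_mult)
        then show ?thesis by (simp add: mult.assoc power_divide)
      qed
      have "(\<Sum>i'\<le>j. \<Sum>k'\<le>j. cnj (?c e j i x i') * (?c e j i x k' * of_real ((1 / 2) ^ host p e j i k')) *
          (if e = e \<and> j = j \<and> i = i \<and> i' = k' \<and> x = x then 1 else 0)) =
          (\<Sum>i'\<le>j. cnj (?c e j i x i') * (?c e j i x i' * of_real ((1 / 2) ^ host p e j i i')))"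
        by (simp add: if_distrib sum.delta cong: if_cong del: of_real_power complex_cnj_mult)
      also have "\<dots> = (\<Sum>i'\<le>j. of_real (eig p j i * (cmod (coord x j i'))\<^sup>2))"
        by (intro sum.cong refl h)
      also have "\<dots> = of_real (eig p j i * (\<Sum>i'\<le>j. (cmod (coord x j i'))\<^sup>2))"
        by (simp only: of_real_sum sum_distrib_left)
      also have "\<dots> = of_real (eig p j i)" using x(1) by (simp add: base_def)
      finally show ?thesis unfolding eq by simp
    qed (auto intro!: sum.neutral)
    finally show ?thesis using jl by (simp add: active_def)
  next
    assume jl: "j < 3 * n" "\<not> l < 3 * n"
    have "cinner (host_vec (host p e j i i') x) (ket (idx l q y)) = 0" if "l mod 2 = p" for i' q
      using host_mod[of e j i i'] that by (intro cinner_host_vec_ket) auto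
    then show ?thesis unfolding A DB using jl
      by (auto simp: cinner_sum_left cinner_scaleC_left cinner_scaleC_right)
  next
    assume jl: "\<not> j < 3 * n" "l < 3 * n"
    have "cinner (ket (idx j q x)) (host_vec (host p f l k k') y) = 0" if "j mod 2 = p" for k' q
      using host_mod[of f l k k'] that by (intro cinner_host_vec_ket) auto
    then show ?thesis unfolding A DB using jl
      by (auto simp: cinner_sum_right cinner_scaleC_left cinner_scaleC_right)
  next
    assume jl: "\<not> j < 3 * n" "\<not> l < 3 * n"
    have "i + (e + 1) * n = k + (f + 1) * n \<longleftrightarrow> i = k \<and> e = f" if "i < n" "k < n"
      using e that by (cases "e = 0"; cases "f = 0") (auto simp: le_Suc_eq)
    moreover have "cnj (of_real (sqrt (2 ^ m))) * (of_real (sqrt (2 ^ m)) * of_real ((1/2) ^ (k + m))) = complex_of_real ((1/2) ^ k)" for m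
    proof -
      have "sqrt (2 ^ m) * (sqrt (2 ^ m) * (1/2) ^ (k + m)) = (1/2) ^ k"
        by (simp add: mult.assoc[symmetric] power_add power_divide)
      then show ?thesis by (simp only: complex_cnj_complex_of_real of_real_mult[symmetric])
    qed
    ultimately show ?thesis unfolding A DB using jl
      by (auto simp: cinner_scaleC_left cinner_scaleC_right cinner_ket_left active_def eig_def mult_ac simp del: of_real_power)
  qed
qed

lemma duplicator_diag:
  assumes e: "e \<le> 1" "f \<le> 1"
  shows "duplicator e o\<^sub>L diag (eig p) o\<^sub>L adj (duplicator f) = (if e = f then diag (\<lambda>j i. if active j i then eig p j i else 0) else 0)"
proof -
  have bnd: "\<forall>j i. \<bar>if active j i then eig p j i else 0\<bar> \<le> 1" using eig_bounds[of p] by auto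
  have bs: "duplicator e \<in> bounded_ops" if "e \<le> 1" for e using duplicator_core[OF that] core_bounded by blast
  have m: "melem (duplicator e o\<^sub>L diag (eig p) o\<^sub>L adj (duplicator f)) u v =
      cinner (adj (duplicator e) (ket u)) (diag (eig p) (adj (duplicator f) (ket v)))" for u v
    unfolding melem_def cinner_ket_left[symmetric] by (simp add: cinner_adj'[OF bs[OF e(1)]])
  have nv: "adj (duplicator e) (ket u) = 0" if "\<not> valid u" "e \<le> 1" for u e
  proof (rule ell2_eqI)
    fix r
    have "melem (duplicator e) u r = 0" using duplicator_core[OF that(2)] that(1) unfolding core_def block_diag_def valid_def by blast
    then show "ell2_coord (adj (duplicator e) (ket u)) r = ell2_coord 0 r"
      using melem_adj[OF bs[OF that(2)], of r u] by (simp add: melem_def[of "adj _"])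
  qed
  show ?thesis
  proof (rule melem_eqI)
    show "duplicator e o\<^sub>L diag (eig p) o\<^sub>L adj (duplicator f) \<in> bounded_ops"
      by (intro bounded_ops_comp bs e adj_bounded diag_bounded[OF eig_bounds(3)])
    show "(if e = f then diag (\<lambda>j i. if active j i then eig p j i else 0) else 0) \<in> bounded_ops"
      using diag_bounded[OF bnd] bounded_ops_zero by auto
    fix u v
    show "melem (duplicator e o\<^sub>L diag (eig p) o\<^sub>L adj (duplicator f)) u v =
      melem (if e = f then diag (\<lambda>j i. if active j i then eig p j i else 0) else 0) u v"
    proof (cases "valid u \<and> valid v")
      case True
      then obtain j i x l k y where "u = idx j i x" "x \<in> base" "i \<le> j" "v = idx l k y" "y \<in> base" "k \<le> l"
        by (auto simp: valid_def)
      then show ?thesis by (auto simp: m cinner_duplicator[OF e] melem_diag[OF bnd] melem_zero)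
    next
      case False
      then have "melem (duplicator e o\<^sub>L diag (eig p) o\<^sub>L adj (duplicator f)) u v = 0"
        unfolding m using nv e by (auto simp: blinfun.zero_right)
      then show ?thesis using False by (auto simp: melem_diag[OF bnd] melem_zero)
    qed
  qed
qed

lemma norm_duplicator_diag:
  assumes "e \<le> 1"
  shows "norm ((duplicator e o\<^sub>L diag (eig p) o\<^sub>L adj (duplicator e)) - diag (eig p)) \<le> (1 / 2) ^ n"
proof -
  have bnd: "\<forall>j i. \<bar>if active j i then eig p j i else 0\<bar> \<le> 1" using eig_bounds[of p] by auto
  have "(duplicator e o\<^sub>L diag (eig p) o\<^sub>L adj (duplicator e)) - diag (eig p) =
      diag (\<lambda>j i. (if active j i then eig p j i else 0) - eig p j i)"
    by (simp add: duplicator_diag[OF assms assms] diag_diff[OF bnd eig_bounds(3)])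
  moreover have "\<bar>(if active j i then eig p j i else 0) - eig p j i\<bar> \<le> (1 / 2) ^ n" for j i
    using power_decreasing[of n i "1/2 :: real"] power_decreasing[of n j "1/2 :: real"]
    by (auto simp: active_def eig_def not_less)
  then have "norm (diag (\<lambda>j i. (if active j i then eig p j i else 0) - eig p j i)) \<le> (1 / 2) ^ n"
    by (intro norm_diag) blast
  ultimately show ?thesis by simp
qed

end

lemma properly_infinite_eig:
  assumes p: "p < 2"
  shows "properly_infinite alg (diag (eig p))"
proof -
  have lim: "(\<lambda>n. duplicator p n e o\<^sub>L diag (eig p) o\<^sub>L adj (duplicator p n e)) \<longlonglongrightarrow> diag (eig p)" if "e \<le> 1" for e
  proof -
    have "(\<lambda>n. (duplicator p n e o\<^sub>L diag (eig p) o\<^sub>L adj (duplicator p n e)) - diag (eig p)) \<longlonglongrightarrow> 0"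
      by (rule Lim_null_comparison[OF always_eventually[OF allI[OF norm_duplicator_diag[OF p that]]]])
        (rule LIMSEQ_power_zero, simp)
    then show ?thesis by (rule LIM_zero_cancel)
  qed
  show ?thesis
    by (rule properly_infiniteI[OF cstar_algebra_alg, where s = "\<lambda>n. duplicator p n 0" and t = "\<lambda>n. duplicator p n 1"])
      (use lim[of 0] lim[of 1] in \<open>simp_all add: core_alg diag_core[OF eig_bounds(3)] duplicator_core[OF p] duplicator_diag[OF p]\<close>)
qed

subsection \<open>Their sum\<close>

abbreviation sum_eig :: "nat \<Rightarrow> nat \<Rightarrow> real" where
  "sum_eig j i \<equiv> eig 0 j i + eig 1 j i"

lemma sum_eig_bound: "\<forall>j i. \<bar>sum_eig j i\<bar> \<le> 2"
proof (intro allI)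
  fix j i
  show "\<bar>sum_eig j i\<bar> \<le> 2" using eig_bounds(1,2)[of 0 j i] eig_bounds(1,2)[of 1 j i] by linarith
qed

lemma sum_eig_0: "1 \<le> sum_eig j 0" "sum_eig 0 0 = 2"
  using eig_bounds(1)[of 0 j 0] eig_bounds(1)[of 1 j 0] mod_less_divisor[of 2 j]
  by (auto simp: eig_def)

text \<open>The vector \<zeta> is taken from the leading lines P_0, ..., P_{J-1}, where the sum has
  eigenvalue at least 1, and \<omega> from a trivial line in block 0, where it has eigenvalue 2. As
  \<open>adj s\<close> and \<open>adj t\<close> map these lines into the first \<open>J\<close>
  blocks, non-injectivity produces the relation.\<close>

lemma core_zero_vector:
  assumes s: "s \<in> core" and t: "t \<in> core"
  shows "\<exists>\<zeta> \<omega>. (\<zeta> \<noteq> 0 \<or> \<omega> \<noteq> 0) \<and> adj s \<zeta> + adj t \<omega> = 0 \<and>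
    norm \<zeta> \<le> norm (diag sum_eig \<zeta>) \<and> 2 * norm \<omega> \<le> norm (diag sum_eig \<omega>)"
proof -
  obtain J1 J2 where "block_diag J1 s" "block_diag J2 t" using s t by (auto simp: core_def)
  \<comment> \<open>The successor ensures \<open>0 < J\<close>, so that block 0, which contains
    \<omega>, is among the blocks considered.\<close>
  define J where "J = Suc (max J1 J2)"
  have Js: "block_diag J s" and Jt: "block_diag J t"
    using \<open>block_diag J1 s\<close> \<open>block_diag J2 t\<close> by (auto intro: block_diag_mono simp: J_def)
  define A where "A k j i x = cnj (melem s (idx k 0 x) (idx j i x))" for k j i x
  \<comment> \<open>\<open>coord x 0 0\<close> has modulus 1 and is odd under the antipodal map of
    the circle S_0, so it trivialises P_0; this makes \<open>B\<close> a map from a trivial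
    line.\<close>
  define B where "B j i x = coord x 0 0 * cnj (melem t (idx 0 0 x) (idx j i x))" for j i x
  have "\<exists>x\<in>base. \<exists>\<xi> l. (l \<noteq> 0 \<or> (\<exists>k<J. \<xi> k \<noteq> 0)) \<and>
    (\<forall>j<J. \<forall>i\<le>j. (\<Sum>k<J. \<xi> k * A k j i x) + complex_of_real l * B j i x = 0)"
  proof (rule equivariant_zero)
    show "continuous_on base (A k j i)" for k j i
      unfolding A_def using s by (intro continuous_on_cnj) (simp add: core_def)
    show "continuous_on base (B j i)" for j i
      unfolding B_def using t by (intro continuous_on_mult continuous_on_cnj cont_coord) (simp add: core_def)
    have cs: "cnj (sg m j) = sg m j" for m j by (simp add: sg_def)
    show "A k j i (antipode m x) = sg m k * sg m j * A k j i x" if "x \<in> base" for m k j i x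
      using s that by (simp add: A_def core_def cs)
    show "B j i (antipode m x) = sg m j * B j i x" if "x \<in> base" for m j i x
    proof -
      have "melem t (idx 0 0 (antipode m x)) (idx j i (antipode m x)) = sg m 0 * sg m j * melem t (idx 0 0 x) (idx j i x)"
        using t that by (simp add: core_def)
      then show ?thesis by (simp add: B_def coord_antipode cs mult_ac sg_sq)
    qed
  qed
  then obtain x \<xi> l where x: "x \<in> base" and nz: "l \<noteq> 0 \<or> (\<exists>k<J. \<xi> k \<noteq> 0)"
    and zero: "\<And>j i. j < J \<Longrightarrow> i \<le> j \<Longrightarrow> (\<Sum>k<J. \<xi> k * A k j i x) + complex_of_real l * B j i x = 0"
    by blast
  define \<zeta> where "\<zeta> = (\<Sum>k<J. \<xi> k *\<^sub>C ket (idx k 0 x))"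
  define \<omega> where "\<omega> = (of_real l * coord x 0 0) *\<^sub>C ket (idx 0 0 x)"
  note bs = core_bounded[OF s] and bt = core_bounded[OF t]
  have "adj s \<zeta> + adj t \<omega> = 0"
  proof (rule ell2_eqI)
    fix r
    have "ell2_coord (adj s \<zeta> + adj t \<omega>) r = (\<Sum>k<J. \<xi> k * melem (adj s) r (idx k 0 x)) +
        of_real l * coord x 0 0 * melem (adj t) r (idx 0 0 x)"
      by (simp add: \<zeta>_def \<omega>_def blinfun.sum_right bounded_opsD[OF adj_bounded[OF bs]]
          bounded_opsD[OF adj_bounded[OF bt]] melem_def)
    also have "\<dots> = (\<Sum>k<J. \<xi> k * cnj (melem s (idx k 0 x) r)) + of_real l * (coord x 0 0 * cnj (melem t (idx 0 0 x) r))"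
      by (simp add: melem_adj[OF bs] melem_adj[OF bt])
    also have "\<dots> = 0"
    proof (cases "\<exists>j i. j < J \<and> i \<le> j \<and> r = idx j i x")
      case True
      then show ?thesis using zero by (auto simp: A_def B_def)
    next
      case False
      \<comment> \<open>Rows in blocks below \<open>J\<close> have no entries outside the columns of
        these blocks over the same \<open>x\<close>, so the equations obtained cover every possibly
        nonzero coordinate.\<close>
      have "melem s (idx k 0 x) r = 0" if k: "k < J" for k
      proof (rule ccontr)
        assume "melem s (idx k 0 x) r \<noteq> 0"
        then have "\<exists>y\<in>base. \<exists>j i j' i'. idx k 0 x = idx j i y \<and> r = idx j' i' y \<and> i \<le> j \<and> i' \<le> j' \<and> (j = j' \<or> j < J \<and> j' < J)"
          using Js unfolding block_diag_def by blast
        then show False using False k by auto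
      qed
      moreover have "melem t (idx 0 0 x) r = 0"
      proof (rule ccontr)
        assume "melem t (idx 0 0 x) r \<noteq> 0"
        then have "\<exists>y\<in>base. \<exists>j i j' i'. idx 0 0 x = idx j i y \<and> r = idx j' i' y \<and> i \<le> j \<and> i' \<le> j' \<and> (j = j' \<or> j < J \<and> j' < J)"
          using Jt unfolding block_diag_def by blast
        then show False using False by (auto simp: J_def)
      qed
      ultimately show ?thesis by simp
    qed
    finally show "ell2_coord (adj s \<zeta> + adj t \<omega>) r = ell2_coord 0 r" by simp
  qed
  moreover
  note bc = bounded_opsD[OF diag_bounded[OF sum_eig_bound]] and dk = diag_ket[OF sum_eig_bound]
  have inj: "inj_on (\<lambda>k. idx k 0 x) {..<J}" by (auto simp: inj_on_def)
  have nsum: "(norm (\<Sum>k<J. f k *\<^sub>C ket (idx k 0 x)))\<^sup>2 = (\<Sum>k<J. (cmod (f k))\<^sup>2)" for f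
  proof -
    have "(\<Sum>k<J. f k *\<^sub>C ket (idx k 0 x)) = (\<Sum>v\<in>(\<lambda>k. idx k 0 x) ` {..<J}. f (lev v) *\<^sub>C ket v)"
      by (simp add: sum.reindex[OF inj])
    then have "(norm (\<Sum>k<J. f k *\<^sub>C ket (idx k 0 x)))\<^sup>2 = (\<Sum>v\<in>(\<lambda>k. idx k 0 x) ` {..<J}. (cmod (f (lev v)))\<^sup>2)"
      by (simp only: norm_sum_ket finite_imageI finite_lessThan)
    then show ?thesis by (simp add: sum.reindex[OF inj])
  qed
  have "diag sum_eig \<zeta> = (\<Sum>k<J. (\<xi> k * of_real (sum_eig k 0)) *\<^sub>C ket (idx k 0 x))"
    using x by (simp add: \<zeta>_def blinfun.sum_right bc dk del: One_nat_def)
  then have "(norm (diag sum_eig \<zeta>))\<^sup>2 = (\<Sum>k<J. (cmod (\<xi> k * of_real (sum_eig k 0)))\<^sup>2)" by (simp only: nsum)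
  moreover have "(cmod (\<xi> k))\<^sup>2 \<le> (cmod (\<xi> k * of_real (sum_eig k 0)))\<^sup>2" for k
  proof -
    have "cmod (\<xi> k) * 1 \<le> cmod (\<xi> k) * \<bar>sum_eig k 0\<bar>" using sum_eig_0(1)[of k] by (intro mult_left_mono) auto
    then show ?thesis by (intro power_mono) (auto simp: norm_mult simp del: of_real_add)
  qed
  ultimately have sq: "(norm \<zeta>)\<^sup>2 \<le> (norm (diag sum_eig \<zeta>))\<^sup>2" and z: "adj s \<zeta> + adj t \<omega> = 0"
    unfolding \<zeta>_def nsum by (auto intro: sum_mono)
  have "norm \<zeta> \<le> norm (diag sum_eig \<zeta>)" by (rule power2_le_imp_le[OF sq norm_ge_zero])
  moreover have "diag sum_eig \<omega> = 2 *\<^sub>C \<omega>"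
    unfolding \<omega>_def bc dk using x sum_eig_0(2) by (simp add: mult.commute del: One_nat_def flip: of_real_add)
  then have "norm (diag sum_eig \<omega>) = 2 * norm \<omega>" by (simp add: norm_scaleC)
  moreover have "\<zeta> \<noteq> 0 \<or> \<omega> \<noteq> 0"
  proof (rule ccontr)
    assume "\<not> ?thesis"
    then have 0: "\<zeta> = 0" "\<omega> = 0" by auto
    have "(\<Sum>k<J. (cmod (\<xi> k))\<^sup>2) = 0" using nsum[of \<xi>] 0(1) by (simp add: \<zeta>_def)
    then have "\<forall>k<J. \<xi> k = 0" by (subst (asm) sum_nonneg_eq_0_iff) auto
    moreover have "cmod (coord x 0 0) = 1" using x by (auto simp: base_def intro: power2_eq_imp_eq dest!: spec[of _ 0])
    then have "norm \<omega> = \<bar>l\<bar>" by (simp add: \<omega>_def norm_scaleC norm_mult)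
    then have "l = 0" using 0(2) by simp
    ultimately show False using nz by auto
  qed
  ultimately show ?thesis using z by (intro exI[of _ \<zeta>] exI[of _ \<omega>]) simp
qed

text \<open>Write \<open>c\<close> for the diagonal sum. Applying \<open>s c\<close> and
  \<open>t c\<close> to the relation between \<zeta> and \<omega> bounds both
  \<open>c \<zeta>\<close> and \<open>c \<omega>\<close> by a quarter of
  \<open>norm \<zeta> + norm \<omega>\<close>, against the lower bounds \<open>norm \<zeta>\<close>
  and \<open>2 * norm \<omega>\<close>. Any constant below 1/2 in place of 1/4 would give the
  contradiction.\<close>

lemma no_core_witness:
  assumes s: "s \<in> core" and t: "t \<in> core"
    and c: "norm ((s o\<^sub>L diag sum_eig o\<^sub>L adj s) - diag sum_eig) \<le> 1 / 4" "norm (s o\<^sub>L diag sum_eig o\<^sub>L adj t) \<le> 1 / 4"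
      "norm (t o\<^sub>L diag sum_eig o\<^sub>L adj s) \<le> 1 / 4" "norm ((t o\<^sub>L diag sum_eig o\<^sub>L adj t) - diag sum_eig) \<le> 1 / 4"
  shows False
proof -
  obtain \<zeta> \<omega> where nz: "\<zeta> \<noteq> 0 \<or> \<omega> \<noteq> 0" and z: "adj s \<zeta> + adj t \<omega> = 0"
    and n: "norm \<zeta> \<le> norm (diag sum_eig \<zeta>)" "2 * norm \<omega> \<le> norm (diag sum_eig \<omega>)"
    using core_zero_vector[OF s t] by blast
  have "s (diag sum_eig (adj s \<zeta> + adj t \<omega>)) = 0" "t (diag sum_eig (adj s \<zeta> + adj t \<omega>)) = 0"
    by (simp_all add: z blinfun.zero_right)
  then have e: "diag sum_eig \<zeta> = - (((s o\<^sub>L diag sum_eig o\<^sub>L adj s) - diag sum_eig) \<zeta> + (s o\<^sub>L diag sum_eig o\<^sub>L adj t) \<omega>)"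
    "diag sum_eig \<omega> = - (((t o\<^sub>L diag sum_eig o\<^sub>L adj t) - diag sum_eig) \<omega> + (t o\<^sub>L diag sum_eig o\<^sub>L adj s) \<zeta>)"
    by (auto simp: blinfun.add_right blinfun.diff_left algebra_simps add_eq_0_iff)
  have le: "norm (T y) \<le> 1 / 4 * norm y" if "norm T \<le> 1 / 4" for T :: "(nat \<Rightarrow> real) op" and y
    using norm_blinfun[of T y] mult_right_mono[OF that, of "norm y"] by simp
  have "norm (diag sum_eig \<zeta>) \<le> 1 / 4 * norm \<zeta> + 1 / 4 * norm \<omega>"
    unfolding e(1) norm_minus_cancel by (intro norm_triangle_mono le c)
  moreover have "norm (diag sum_eig \<omega>) \<le> 1 / 4 * norm \<omega> + 1 / 4 * norm \<zeta>"
    unfolding e(2) norm_minus_cancel by (intro norm_triangle_mono le c)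
  ultimately have "norm \<zeta> + norm \<omega> \<le> 0" using n by simp
  then show False using nz norm_ge_zero[of \<zeta>] norm_ge_zero[of \<omega>] by (metis add_nonneg_eq_0_iff antisym add_nonneg_nonneg norm_eq_zero)
qed

text \<open>The four strict estimates are open conditions on \<open>s\<close> and \<open>t\<close>,
  so they persist for sufficiently close core elements, to which the topological obstruction
  applies.\<close>

lemma not_properly_infinite_sum: "\<not> properly_infinite alg (diag sum_eig)"
proof
  let ?c = "diag sum_eig"
  assume "properly_infinite alg ?c"
  then obtain s t where st: "s \<in> alg" "t \<in> alg"
    and n: "norm ((s o\<^sub>L ?c o\<^sub>L adj s) - ?c) < 1 / 4" "norm (s o\<^sub>L ?c o\<^sub>L adj t) < 1 / 4"
      "norm (t o\<^sub>L ?c o\<^sub>L adj s) < 1 / 4" "norm ((t o\<^sub>L ?c o\<^sub>L adj t) - ?c) < 1 / 4"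
    using properly_infiniteD[OF cstar_algebra_alg core_alg[OF diag_core[OF sum_eig_bound]], of "1 / 4"] by auto
  obtain f g where f: "\<And>n. f n \<in> core" "f \<longlonglongrightarrow> s" and g: "\<And>n. g n \<in> core" "g \<longlonglongrightarrow> t"
    using alg_seq[OF st(1)] alg_seq[OF st(2)] by blast
  note comp = bounded_bilinear.tendsto[OF bounded_bilinear_blinfun_compose]
  have af: "(\<lambda>n. adj (f n)) \<longlonglongrightarrow> adj s" and ag: "(\<lambda>n. adj (g n)) \<longlonglongrightarrow> adj t"
    by (rule adj_tendsto[OF core_bounded[OF f(1)] alg_bounded[OF st(1)] f(2)])
      (rule adj_tendsto[OF core_bounded[OF g(1)] alg_bounded[OF st(2)] g(2)])
  have "\<forall>\<^sub>F n in sequentially. norm ((f n o\<^sub>L ?c o\<^sub>L adj (f n)) - ?c) < 1 / 4"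
    by (rule order_tendstoD(2)[OF tendsto_norm[OF tendsto_diff[OF comp[OF comp[OF f(2) tendsto_const] af] tendsto_const]] n(1)])
  moreover have "\<forall>\<^sub>F n in sequentially. norm (f n o\<^sub>L ?c o\<^sub>L adj (g n)) < 1 / 4"
    by (rule order_tendstoD(2)[OF tendsto_norm[OF comp[OF comp[OF f(2) tendsto_const] ag]] n(2)])
  moreover have "\<forall>\<^sub>F n in sequentially. norm (g n o\<^sub>L ?c o\<^sub>L adj (f n)) < 1 / 4"
    by (rule order_tendstoD(2)[OF tendsto_norm[OF comp[OF comp[OF g(2) tendsto_const] af]] n(3)])
  moreover have "\<forall>\<^sub>F n in sequentially. norm ((g n o\<^sub>L ?c o\<^sub>L adj (g n)) - ?c) < 1 / 4"
    by (rule order_tendstoD(2)[OF tendsto_norm[OF tendsto_diff[OF comp[OF comp[OF g(2) tendsto_const] ag] tendsto_const]] n(4)])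
  ultimately have "\<forall>\<^sub>F n in sequentially. False"
  proof eventually_elim
    case (elim n)
    then show ?case by (intro no_core_witness[OF f(1)[of n] g(1)[of n]] less_imp_le)
  qed
  then show False by simp
qed

theorem mainTheorem12:
  shows "\<exists>(A :: (nat \<Rightarrow> real) op set) a b.
    cstar_algebra A \<and>
    a \<in> positive_elements A \<and> b \<in> positive_elements A \<and>
    properly_infinite A a \<and> properly_infinite A b \<and>
    \<not> properly_infinite A (a + b)"
proof (intro exI conjI)
  show "cstar_algebra alg" by (rule cstar_algebra_alg)
  show "diag (eig 0) \<in> positive_elements alg" "diag (eig 1) \<in> positive_elements alg"
    using eig_bounds(1,2) by (auto intro!: diag_positive simp: less_imp_le)
  show "properly_infinite alg (diag (eig 0))" "properly_infinite alg (diag (eig 1))"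
    by (simp_all add: properly_infinite_eig)
  show "\<not> properly_infinite alg (diag (eig 0) + diag (eig 1))"
    using not_properly_infinite_sum by (simp add: diag_add[OF eig_bounds(3) eig_bounds(3)])
qed

end
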